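(* Let $n\ge2$, $q\ge1$, and let $f:M^n\looparrowright\mathbb S^{n+q}(1)$ be a closed minimal immersion. Let $p\in f(M)$ and $f^{-1}(p)=\{x_1,\ldots,x_m\}$ (distinct points), and put $\varphi_p=\langle f,p\rangle$. Then $$\int_{\{\varphi_p\ge0\}}\varphi_p\,dV=m\beta_n+\mathcal R_p,\qquad\text{where}\qquad \mathcal R_p=\int_{\{\varphi_p>0\}}\frac{\varphi_p|p^\perp|^2}{(1-\varphi_p^2)^{n/2+1}}\,dV .$$ The integral $\mathcal R_p$ is finite and nonnegative.
   Context: All manifolds and immersions are smooth; $M$ is closed (compact without boundary) with the induced metric and volume measure $dV$; $\mathbb S^{n+q}(1)\subset\mathbb R^{n+q+1}$ is the unit sphere. Minimal means that the mean curvature vector of $M$ in the sphere vanishes. For a fixed vector $p\in\mathbb R^{n+q+1}$, $p^\perp$ denotes at each $x\in M$ the component of $p$ in the normal space $N_xM$ of $M$ inside the sphere, i.e. $p=\varphi_p f+\nabla\varphi_p+p^\perp$. $\beta_n=\operatorname{Vol}(\mathbb B^n)$ is the volume of the Euclidean unit ball. The integrand of $\mathcal R_p$ is undefined only on the null set $f^{-1}(p)$. *)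

theory Defs
  imports "HOL-Analysis.Analysis"
begin

section \<open>Smooth maps between Euclidean spaces\<close>

text \<open>In finite dimension, and for open \<open>S\<close>, a map is \<open>C\<^sup>k\<close> on \<open>S\<close> iff its iterated directional
  derivatives up to order \<open>k\<close> exist and are continuous.\<close>

primrec Ck_on :: "nat \<Rightarrow> 'a::euclidean_space set \<Rightarrow> ('a \<Rightarrow> 'b::euclidean_space) \<Rightarrow> bool" where
  "Ck_on 0 S F \<longleftrightarrow> continuous_on S F"
| "Ck_on (Suc k) S F \<longleftrightarrow>
     (\<forall>u\<in>S. F differentiable (at u)) \<and> (\<forall>v. Ck_on k S (\<lambda>u. frechet_derivative F (at u) v))"

definition smooth_on :: "'a::euclidean_space set \<Rightarrow> ('a \<Rightarrow> 'b::euclidean_space) \<Rightarrow> bool" where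
  "smooth_on S F \<longleftrightarrow> (\<forall>k. Ck_on k S F)"


section \<open>Smooth manifolds and immersions\<close>

text \<open>The manifold is the whole (Hausdorff, second countable) type \<open>'m\<close>.  A chart is a pair of its
  domain and its coordinate map; values of the coordinate map off the domain are irrelevant.\<close>

type_synonym ('m, 'n) chart = "'m set \<times> ('m \<Rightarrow> real ^ 'n)"

definition cdom :: "('m, 'n::finite) chart \<Rightarrow> 'm set" where
  "cdom c = fst c"

definition coord :: "('m, 'n::finite) chart \<Rightarrow> 'm \<Rightarrow> real ^ 'n" where
  "coord c = snd c"

definition cimg :: "('m, 'n::finite) chart \<Rightarrow> (real ^ 'n) set" where
  "cimg c = coord c ` cdom c"

definition coord_inv :: "('m, 'n::finite) chart \<Rightarrow> real ^ 'n \<Rightarrow> 'm" where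
  "coord_inv c = inv_into (cdom c) (coord c)"

text \<open>The atlas need not be maximal.\<close>

definition smooth_atlas ::
  "('m::{t2_space, second_countable_topology}, 'n::finite) chart set \<Rightarrow> bool" where
  "smooth_atlas A \<longleftrightarrow>
     (\<forall>c\<in>A. open (cdom c) \<and> open (cimg c) \<and>
            homeomorphism (cdom c) (cimg c) (coord c) (coord_inv c)) \<and>
     (\<Union>c\<in>A. cdom c) = UNIV \<and>
     (\<forall>c\<in>A. \<forall>d\<in>A. smooth_on (coord c ` (cdom c \<inter> cdom d)) (coord d \<circ> coord_inv c))"

definition local_rep ::
  "('m, 'n::finite) chart \<Rightarrow> ('m \<Rightarrow> real ^ 'k::finite) \<Rightarrow> real ^ 'n \<Rightarrow> real ^ 'k" where
  "local_rep c f = f \<circ> coord_inv c"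

definition smooth_immersion ::
  "('m, 'n::finite) chart set \<Rightarrow> ('m \<Rightarrow> real ^ 'k::finite) \<Rightarrow> bool" where
  "smooth_immersion A f \<longleftrightarrow>
     (\<forall>c\<in>A. smooth_on (cimg c) (local_rep c f) \<and>
            (\<forall>u\<in>cimg c. inj (frechet_derivative (local_rep c f) (at u))))"


section \<open>Induced metric and volume measure\<close>

definition metric_matrix ::
  "('m, 'n::finite) chart \<Rightarrow> ('m \<Rightarrow> real ^ 'k::finite) \<Rightarrow> real ^ 'n \<Rightarrow> real ^ 'n ^ 'n" where
  "metric_matrix c f u =
     (\<chi> i j. frechet_derivative (local_rep c f) (at u) (axis i 1) \<bullet>
            frechet_derivative (local_rep c f) (at u) (axis j 1))"

text \<open>The Borel measure that is \<open>sqrt (det g) du\<close> in every chart.  It is unique because countably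
  many chart domains cover the manifold, and it exists by the change of variables formula.\<close>

definition volume_measure ::
  "('m::{t2_space, second_countable_topology}, 'n::finite) chart set \<Rightarrow>
   ('m \<Rightarrow> real ^ 'k::finite) \<Rightarrow> 'm measure" where
  "volume_measure A f =
     (THE \<mu>. sets \<mu> = sets borel \<and>
        (\<forall>c\<in>A. \<forall>B\<in>sets borel. B \<subseteq> cdom c \<longrightarrow>
           emeasure \<mu> B =
             (\<integral>\<^sup>+u\<in>coord c ` B. ennreal (sqrt (det (metric_matrix c f u))) \<partial>lborel)))"


section \<open>Immersions into the unit sphere\<close>

text \<open>The image of the differential of \<open>f\<close> at \<open>x\<close>; all charts around \<open>x\<close> contribute the same
  subspace.\<close>

definition tangent_space ::
  "('m, 'n::finite) chart set \<Rightarrow> ('m \<Rightarrow> real ^ 'k::finite) \<Rightarrow> 'm \<Rightarrow> (real ^ 'k) set" where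
  "tangent_space A f x =
     (\<Union>c\<in>{c\<in>A. x \<in> cdom c}. range (frechet_derivative (local_rep c f) (at (coord c x))))"

text \<open>The tangent space of the unit sphere at \<open>f x\<close> is the orthogonal complement of \<open>f x\<close>.\<close>

definition sphere_normal_space ::
  "('m, 'n::finite) chart set \<Rightarrow> ('m \<Rightarrow> real ^ 'k::finite) \<Rightarrow> 'm \<Rightarrow> (real ^ 'k) set" where
  "sphere_normal_space A f x = (insert (f x) (tangent_space A f x))\<^sup>\<bottom>"

definition orth_proj :: "'a::euclidean_space set \<Rightarrow> 'a \<Rightarrow> 'a" where
  "orth_proj S v = (THE w. w \<in> S \<and> v - w \<in> S\<^sup>\<bottom>)"

definition normal_part ::
  "('m, 'n::finite) chart set \<Rightarrow> ('m \<Rightarrow> real ^ 'k::finite) \<Rightarrow> real ^ 'k \<Rightarrow> 'm \<Rightarrow> real ^ 'k" where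
  "normal_part A f p x = orth_proj (sphere_normal_space A f x) p"

text \<open>The second fundamental form of the immersion into the sphere on the coordinate fields
  \<open>i\<close>, \<open>j\<close>.  The Levi-Civita connection of the sphere is the tangential part of the flat
  derivative, so its component normal to the immersion is the normal part of the flat second
  derivative of \<open>f\<close>.\<close>

definition second_fundamental_form ::
  "('m, 'n::finite) chart set \<Rightarrow> ('m \<Rightarrow> real ^ 'k::finite) \<Rightarrow> ('m, 'n) chart \<Rightarrow> 'm \<Rightarrow>
   'n \<Rightarrow> 'n \<Rightarrow> real ^ 'k" where
  "second_fundamental_form A f c x i j =
     orth_proj (sphere_normal_space A f x)
       (frechet_derivative (\<lambda>u. frechet_derivative (local_rep c f) (at u) (axis j 1))
          (at (coord c x)) (axis i 1))"

text \<open>The trace of the second fundamental form, without the factor \<open>1/n\<close>.\<close>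

definition mean_curvature_vector ::
  "('m, 'n::finite) chart set \<Rightarrow> ('m \<Rightarrow> real ^ 'k::finite) \<Rightarrow> ('m, 'n) chart \<Rightarrow> 'm \<Rightarrow> real ^ 'k"
  where
  "mean_curvature_vector A f c x =
     (\<Sum>i\<in>UNIV. \<Sum>j\<in>UNIV.
        (matrix_inv (metric_matrix c f (coord c x)) $ i $ j) *\<^sub>R second_fundamental_form A f c x i j)"

definition minimal_in_sphere ::
  "('m, 'n::finite) chart set \<Rightarrow> ('m \<Rightarrow> real ^ 'k::finite) \<Rightarrow> bool" where
  "minimal_in_sphere A f \<longleftrightarrow> (\<forall>c\<in>A. \<forall>x\<in>cdom c. mean_curvature_vector A f c x = 0)"

end

theory Submission
  imports Defs
begin

text \<open>Write \<open>n = CARD('n)\<close>, \<open>\<phi> = \<langle>f, p\<rangle>\<close> and \<open>Q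
  = |p\<^sup>\<bottom>|\<^sup>2\<close>. Since \<open>f\<close> is minimal in the sphere, every
  height function satisfies \<open>\<Delta>\<phi> = - n \<phi>\<close>
  (\<open>divergence_height_gradient\<close>), and the decomposition of the unit vector
  \<open>p\<close> into its position, tangent and normal parts gives
  \<open>|\<nabla>\<phi>|\<^sup>2 = 1 - \<phi>\<^sup>2 - Q\<close>
  (\<open>slope_height\<close>). The divergence theorem applied to the field
  \<open>\<psi>(\<phi>) \<nabla>\<phi>\<close> on the closed manifold therefore yields
  \<open>\<integral> \<psi>'(\<phi>) (1 - \<phi>\<^sup>2 - Q) - n \<psi>(\<phi>) \<phi> dV =
  0\<close> for every \<open>C\<^sup>1\<close> function \<open>\<psi>\<close>
  (\<open>integral_height_identity\<close>).

  The profile \<open>\<psi>(t) = (1 - t\<^sup>2) powr (- n/2)\<close> makes all terms without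
  \<open>Q\<close> cancel, but it is singular at \<open>t = 1\<close>, that is, on the fibre
  over \<open>p\<close>. Replacing \<open>1 - t\<^sup>2\<close> by \<open>1 + e -
  t\<^sup>2\<close> removes the singularity. Subtracting the value at \<open>t = 0\<close> and
  cutting off for \<open>t \<le> 0\<close> keeps the profile \<open>C\<^sup>1\<close> and
  restricts the identity to \<open>\<phi> > 0\<close>. The result
  (\<open>regularised_identity\<close>) is, with integrals over \<open>{\<phi> > 0}\<close> and
  \<open>a = n/2 + 1\<close>, \<open>(1 + e) powr (- n/2) \<integral> \<phi> = \<integral>
  \<phi> Q / (1 + e - \<phi>\<^sup>2) powr a + \<integral> e \<phi> / (1 + e - \<phi>\<^sup>2)
  powr a\<close>.

  Now let \<open>e\<close> tend to \<open>0\<close>. The integrands of the first term on the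
  right increase to the integrand of \<open>\<R>\<^sub>p\<close>, so monotone convergence gives
  the integrability of the latter as well as the limit. The last integrand concentrates at the
  fibre. Near each of its points \<open>1 - \<phi>\<^sup>2\<close> is asymptotic to the squared
  distance, and after rescaling by the square root of \<open>e\<close> the local contribution
  tends to the integral of \<open>(1 + |s|\<^sup>2) powr (- a)\<close> over Euclidean space
  (\<open>kernel_concentration\<close>). This integral is the volume of the unit ball, because
  the integrand is the Jacobian of \<open>s \<mapsto> s / sqrt (1 + |s|\<^sup>2)\<close>
  (\<open>nn_integral_ball_kernel\<close>).

  The rest is groundwork: the volume measure is glued from charts by the change of variables
  formula (\<open>ex1_represents_volume\<close>), and the divergence theorem is reduced by a
  \<open>C\<^sup>1\<close> partition of unity to compactly supported functions on
  \<open>\<real>\<^sup>n\<close>, whose derivatives integrate to \<open>0\<close> by translation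
  invariance (\<open>integral_directional_derivative_eq_0\<close>).\<close>

section \<open>Continuously differentiable maps\<close>

abbreviation fderiv :: "('a::real_normed_vector \<Rightarrow> 'b::real_normed_vector) \<Rightarrow> 'a \<Rightarrow> 'a \<Rightarrow> 'b" where
  "fderiv F u \<equiv> frechet_derivative F (at u)"

abbreviation C1_on :: "'a::euclidean_space set \<Rightarrow> ('a \<Rightarrow> 'b::euclidean_space) \<Rightarrow> bool" where
  "C1_on S F \<equiv> Ck_on (Suc 0) S F"

lemma fderiv_eq: "(F has_derivative F') (at u) \<Longrightarrow> fderiv F u = F'"
  by (rule frechet_derivative_at[symmetric])

lemma C1_onI:
  assumes "\<And>u. u \<in> S \<Longrightarrow> (F has_derivative F' u) (at u)"
    and "\<And>v. continuous_on S (\<lambda>u. F' u v)"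
  shows "C1_on S F"
proof -
  have "continuous_on S (\<lambda>u. fderiv F u v)" for v
    using assms(2)[of v] by (rule continuous_on_eq) (simp add: fderiv_eq[OF assms(1)])
  then show ?thesis using assms(1) by (auto simp: differentiable_def)
qed

lemma C1_on_has_derivative:
  "C1_on S F \<Longrightarrow> u \<in> S \<Longrightarrow> (F has_derivative fderiv F u) (at u)"
  by (simp add: frechet_derivative_works)

lemma C1_on_continuous_fderiv: "C1_on S F \<Longrightarrow> continuous_on S (\<lambda>u. fderiv F u v)"
  by simp

lemma C1_on_continuous: "C1_on S F \<Longrightarrow> continuous_on S F"
  by (auto intro!: continuous_at_imp_continuous_on differentiable_imp_continuous_within)

lemma fderiv_cong_open:
  assumes "open S" "u \<in> S" "\<And>v. v \<in> S \<Longrightarrow> F v = G v"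
  shows "fderiv F u = fderiv G u"
proof -
  have "(F has_derivative D) (at u) \<longleftrightarrow> (G has_derivative D) (at u)" for D
    using assms by (metis has_derivative_transform_within_open)
  then show ?thesis by (simp add: frechet_derivative_def)
qed

lemma C1_on_cong_open:
  assumes "open S" "\<And>v. v \<in> S \<Longrightarrow> F v = G v" "C1_on S F"
  shows "C1_on S G"
proof (rule C1_onI)
  show "(G has_derivative fderiv F u) (at u)" if "u \<in> S" for u
    by (rule has_derivative_transform_within_open[OF C1_on_has_derivative[OF assms(3) that] assms(1) that assms(2)])
qed (use assms(3) in simp)

lemma C1_on_local:
  assumes "\<And>u. u \<in> S \<Longrightarrow> \<exists>N. open N \<and> u \<in> N \<and> C1_on N F"
  shows "C1_on S F"
proof -
  have "continuous_on S (\<lambda>u. fderiv F u v)" for v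
  proof (rule continuous_at_imp_continuous_on, rule ballI)
    fix u assume "u \<in> S"
    then obtain N where N: "open N" "u \<in> N" "C1_on N F" using assms by blast
    then show "continuous (at u) (\<lambda>u. fderiv F u v)"
      using continuous_on_eq_continuous_at[OF N(1)] C1_on_continuous_fderiv[OF N(3)] by blast
  qed
  then show ?thesis using assms by auto
qed

lemma C1_on_const: "C1_on S (\<lambda>u. c)"
  by (rule C1_onI[where F' = "\<lambda>u v. 0"]) (auto intro: derivative_eq_intros)

lemma C1_on_ident: "C1_on S (\<lambda>v. v)"
  by (rule C1_onI[where F' = "\<lambda>u v. v"]) auto

lemma C1_on_add: "C1_on S F \<Longrightarrow> C1_on S G \<Longrightarrow> C1_on S (\<lambda>u. F u + G u)"
  by (rule C1_onI[where F' = "\<lambda>u v. fderiv F u v + fderiv G u v"])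
     (auto intro!: has_derivative_add C1_on_has_derivative continuous_intros simp del: Ck_on.simps
       dest: C1_on_continuous_fderiv)

lemma C1_on_diff: "C1_on S F \<Longrightarrow> C1_on S G \<Longrightarrow> C1_on S (\<lambda>u. F u - G u)"
  by (rule C1_onI[where F' = "\<lambda>u v. fderiv F u v - fderiv G u v"])
     (auto intro!: has_derivative_diff C1_on_has_derivative continuous_intros simp del: Ck_on.simps
       dest: C1_on_continuous_fderiv)

lemma C1_on_sum:
  "(\<And>i. i \<in> I \<Longrightarrow> C1_on S (F i)) \<Longrightarrow> C1_on S (\<lambda>u. \<Sum>i\<in>I. F i u)"
  by (induction I rule: infinite_finite_induct) (auto intro!: C1_on_const C1_on_add simp del: Ck_on.simps)

lemma C1_on_inner:
  assumes "C1_on S F" "C1_on S G"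
  shows "C1_on S (\<lambda>u. F u \<bullet> G u)"
  by (rule C1_onI[where F' = "\<lambda>u v. F u \<bullet> fderiv G u v + fderiv F u v \<bullet> G u"])
     (use assms in \<open>auto intro!: has_derivative_inner C1_on_has_derivative continuous_intros simp del: Ck_on.simps
       dest: C1_on_continuous_fderiv C1_on_continuous\<close>)

lemma C1_on_mult:
  fixes F G :: "'a::euclidean_space \<Rightarrow> real"
  shows "C1_on S F \<Longrightarrow> C1_on S G \<Longrightarrow> C1_on S (\<lambda>u. F u * G u)"
  using C1_on_inner[of S F G] by simp

lemma C1_on_prod:
  fixes F :: "'i \<Rightarrow> 'a::euclidean_space \<Rightarrow> real"
  shows "(\<And>i. i \<in> I \<Longrightarrow> C1_on S (F i)) \<Longrightarrow> C1_on S (\<lambda>u. \<Prod>i\<in>I. F i u)"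
  by (induction I rule: infinite_finite_induct) (auto intro!: C1_on_const C1_on_mult simp del: Ck_on.simps)

lemma C1_on_real_comp:
  fixes F :: "'a::euclidean_space \<Rightarrow> real"
  assumes F: "C1_on S F" and "F ` S \<subseteq> T"
    and h: "\<And>t. t \<in> T \<Longrightarrow> (h has_real_derivative h' t) (at t)" and h': "continuous_on T h'"
  shows "C1_on S (\<lambda>u. h (F u))"
proof (rule C1_onI[where F' = "\<lambda>u v. fderiv F u v * h' (F u)"])
  show "((\<lambda>u. h (F u)) has_derivative (\<lambda>v. fderiv F u v * h' (F u))) (at u)" if "u \<in> S" for u
    using has_derivative_compose[OF C1_on_has_derivative[OF F that] h[unfolded has_field_derivative_def]]
      assms(2) that by (auto simp: mult.commute)
  show "continuous_on S (\<lambda>u. fderiv F u v * h' (F u))" for v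
    by (intro continuous_on_mult C1_on_continuous_fderiv F continuous_on_compose2[OF h'] C1_on_continuous[OF F] assms)
qed

lemma C1_on_inverse:
  fixes F :: "'a::euclidean_space \<Rightarrow> real"
  assumes F: "C1_on S F" and "\<And>u. u \<in> S \<Longrightarrow> F u \<noteq> 0"
  shows "C1_on S (\<lambda>u. inverse (F u))"
  by (rule C1_on_real_comp[OF F, of "-{0}" inverse "\<lambda>t. - inverse (t * t)"])
     (use assms in \<open>auto intro!: derivative_eq_intros continuous_intros\<close>)

lemma C1_on_divide:
  fixes F G :: "'a::euclidean_space \<Rightarrow> real"
  shows "C1_on S F \<Longrightarrow> C1_on S G \<Longrightarrow> (\<And>u. u \<in> S \<Longrightarrow> G u \<noteq> 0) \<Longrightarrow> C1_on S (\<lambda>u. F u / G u)"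
  unfolding divide_inverse by (intro C1_on_mult C1_on_inverse)

lemma C1_on_sqrt:
  fixes F :: "'a::euclidean_space \<Rightarrow> real"
  assumes F: "C1_on S F" and "\<And>u. u \<in> S \<Longrightarrow> F u > 0"
  shows "C1_on S (\<lambda>u. sqrt (F u))"
  by (rule C1_on_real_comp[OF F, of "{0<..}" sqrt "\<lambda>t. inverse (sqrt t) / 2"])
     (use assms in \<open>auto intro!: DERIV_real_sqrt continuous_intros\<close>)

lemma fderiv_linear: "F differentiable (at u) \<Longrightarrow> linear (fderiv F u)"
  by (meson frechet_derivative_works has_derivative_linear)

lemma fderiv_expand:
  fixes F :: "'a::euclidean_space \<Rightarrow> 'b::real_normed_vector"
  assumes "F differentiable (at u)"
  shows "fderiv F u v = (\<Sum>b\<in>Basis. (v \<bullet> b) *\<^sub>R fderiv F u b)"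
proof -
  interpret linear "fderiv F u" by (rule fderiv_linear[OF assms])
  have "fderiv F u v = fderiv F u (\<Sum>b\<in>Basis. (v \<bullet> b) *\<^sub>R b)" by (simp add: euclidean_representation)
  then show ?thesis by (simp add: sum scaleR)
qed

lemma fderiv_compose:
  assumes "F differentiable (at u)" "G differentiable (at (F u))"
  shows "fderiv (\<lambda>x. G (F x)) u v = fderiv G (F u) (fderiv F u v)"
  using fderiv_eq[OF has_derivative_compose[OF assms[unfolded frechet_derivative_works]]] by simp

lemma C1_on_compose:
  assumes F: "C1_on S F" and G: "C1_on T G" and "F ` S \<subseteq> T"
  shows "C1_on S (\<lambda>u. G (F u))"
proof (rule C1_onI[where F' = "\<lambda>u v. fderiv G (F u) (fderiv F u v)"])
  show "((\<lambda>u. G (F u)) has_derivative (\<lambda>v. fderiv G (F u) (fderiv F u v))) (at u)" if "u \<in> S" for u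
    by (rule has_derivative_compose[OF C1_on_has_derivative[OF F that] C1_on_has_derivative[OF G]])
      (use assms(3) that in auto)
  have "continuous_on S (\<lambda>u. \<Sum>b\<in>Basis. (fderiv F u v \<bullet> b) *\<^sub>R fderiv G (F u) b)" for v
    by (intro continuous_intros C1_on_continuous_fderiv[OF F]
        continuous_on_compose2[OF C1_on_continuous_fderiv[OF G] C1_on_continuous[OF F]] assms(3))
  then show "continuous_on S (\<lambda>u. fderiv G (F u) (fderiv F u v))" for v
    by (rule continuous_on_eq) (use G assms(3) in \<open>subst fderiv_expand[of G]; auto\<close>)
qed

lemma smooth_on_C1: "smooth_on S F \<Longrightarrow> C1_on S F"
  unfolding smooth_on_def by blast

lemma smooth_on_C1_fderiv: "smooth_on S F \<Longrightarrow> C1_on S (\<lambda>u. fderiv F u v)"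
  unfolding smooth_on_def by (metis Ck_on.simps(2))

text \<open>Both orders of differentiation are compared through the second difference, which is symmetric
  in \<open>a\<close> and \<open>b\<close>: two applications of the mean value theorem turn it
  into a mixed derivative at a nearby point.\<close>

lemma second_difference_mean_value:
  fixes F :: "'a::euclidean_space \<Rightarrow> real"
  assumes t: "t > 0" and in_S: "\<And>r s. \<bar>r\<bar> \<le> t \<Longrightarrow> \<bar>s\<bar> \<le> t \<Longrightarrow> u + r *\<^sub>R a + s *\<^sub>R b \<in> S"
    and F: "C1_on S F" and Fa: "C1_on S (\<lambda>u. fderiv F u a)"
  obtains r s where "\<bar>r\<bar> \<le> t" "\<bar>s\<bar> \<le> t"
    "F (u + t *\<^sub>R a + t *\<^sub>R b) - F (u + t *\<^sub>R a) - F (u + t *\<^sub>R b) + F u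
      = t\<^sup>2 * fderiv (\<lambda>u. fderiv F u a) (u + r *\<^sub>R a + s *\<^sub>R b) b"
proof -
  have line: "((\<lambda>r. G (c + r *\<^sub>R d)) has_real_derivative fderiv G (c + r *\<^sub>R d) d) (at r)"
    if "C1_on S G" "c + r *\<^sub>R d \<in> S" for G :: "'a \<Rightarrow> real" and c d r
  proof -
    have "((\<lambda>r. c + r *\<^sub>R d) has_derivative (\<lambda>h. h *\<^sub>R d)) (at r)"
      by (auto intro!: derivative_eq_intros)
    from has_derivative_compose[OF this C1_on_has_derivative[OF that]]
    have "((\<lambda>r. G (c + r *\<^sub>R d)) has_derivative (\<lambda>h. fderiv G (c + r *\<^sub>R d) (h *\<^sub>R d))) (at r)" .
    moreover have "linear (fderiv G (c + r *\<^sub>R d))"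
      using that by (auto intro: fderiv_linear)
    ultimately show ?thesis
      by (simp add: has_field_derivative_def linear_cmul mult_commute_abs)
  qed
  define \<phi> where "\<phi> r = F ((u + t *\<^sub>R b) + r *\<^sub>R a) - F (u + r *\<^sub>R a)" for r
  have S1: "(u + t *\<^sub>R b) + r *\<^sub>R a \<in> S" "u + r *\<^sub>R a \<in> S" if "0 \<le> r" "r \<le> t" for r
    using in_S[of r t] in_S[of r 0] that t by (auto simp: algebra_simps)
  have "(\<phi> has_real_derivative
      fderiv F ((u + t *\<^sub>R b) + r *\<^sub>R a) a - fderiv F (u + r *\<^sub>R a) a) (at r)" if "0 \<le> r" "r \<le> t" for r
    unfolding \<phi>_def by (intro DERIV_diff line F S1 that)
  from MVT2[OF t this] obtain r where r: "0 < r" "r < t"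
    "\<phi> t - \<phi> 0 = t * (fderiv F ((u + t *\<^sub>R b) + r *\<^sub>R a) a - fderiv F (u + r *\<^sub>R a) a)"
    by auto
  have S2: "(u + r *\<^sub>R a) + s *\<^sub>R b \<in> S" if "0 \<le> s" "s \<le> t" for s
    using in_S[of r s] that r by auto
  have "((\<lambda>s. fderiv F ((u + r *\<^sub>R a) + s *\<^sub>R b) a) has_real_derivative
      fderiv (\<lambda>u. fderiv F u a) ((u + r *\<^sub>R a) + s *\<^sub>R b) b) (at s)" if "0 \<le> s" "s \<le> t" for s
    using line[OF Fa S2[OF that]] .
  from MVT2[OF t this] obtain s where s: "0 < s" "s < t"
    "fderiv F (u + r *\<^sub>R a + t *\<^sub>R b) a - fderiv F (u + r *\<^sub>R a) a
      = t * fderiv (\<lambda>u. fderiv F u a) (u + r *\<^sub>R a + s *\<^sub>R b) b" by auto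
  show ?thesis
  proof (rule that[of r s])
    show "F (u + t *\<^sub>R a + t *\<^sub>R b) - F (u + t *\<^sub>R a) - F (u + t *\<^sub>R b) + F u
      = t\<^sup>2 * fderiv (\<lambda>u. fderiv F u a) (u + r *\<^sub>R a + s *\<^sub>R b) b"
      using r(3) s(3) by (simp add: \<phi>_def algebra_simps power2_eq_square)
  qed (use r s in auto)
qed

lemma fderiv_symmetric_real:
  fixes F :: "'a::euclidean_space \<Rightarrow> real"
  assumes "open S" "u \<in> S" "C1_on S F" "C1_on S (\<lambda>u. fderiv F u a)" "C1_on S (\<lambda>u. fderiv F u b)"
  shows "fderiv (\<lambda>u. fderiv F u a) u b = fderiv (\<lambda>u. fderiv F u b) u a"
proof -
  define D1 where "D1 w = fderiv (\<lambda>u. fderiv F u a) w b" for w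
  define D2 where "D2 w = fderiv (\<lambda>u. fderiv F u b) w a" for w
  have "isCont D1 u" "isCont D2 u"
    using assms C1_on_continuous_fderiv[OF assms(4), of b] C1_on_continuous_fderiv[OF assms(5), of a]
    unfolding D1_def D2_def by (auto simp: continuous_on_eq_continuous_at)
  have small: "\<bar>D1 u - D2 u\<bar> < 2 * e" if "e > 0" for e
  proof -
    obtain d1 where d1: "d1 > 0" "\<And>w. dist w u < d1 \<Longrightarrow> dist (D1 w) (D1 u) < e"
      using \<open>isCont D1 u\<close> \<open>e > 0\<close> unfolding continuous_at_eps_delta by blast
    obtain d2 where d2: "d2 > 0" "\<And>w. dist w u < d2 \<Longrightarrow> dist (D2 w) (D2 u) < e"
      using \<open>isCont D2 u\<close> \<open>e > 0\<close> unfolding continuous_at_eps_delta by blast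
    obtain d3 where d3: "d3 > 0" "ball u d3 \<subseteq> S"
      using assms(1,2) open_contains_ball by blast
    define d where "d = min d1 (min d2 d3)"
    \<comment> \<open>small enough for the whole parallelogram of side \<open>t\<close> to lie in the ball of radius \<open>d\<close>\<close>
    define t where "t = d / (2 * (norm a + norm b + 1))"
    have "d > 0" using d1 d2 d3 by (simp add: d_def)
    have K: "norm a + norm b + 1 > 0" by (simp add: add_nonneg_pos)
    have t: "t > 0" using K by (simp add: t_def \<open>d > 0\<close>)
    have near: "dist (u + r *\<^sub>R a + s *\<^sub>R b) u < d" if "\<bar>r\<bar> \<le> t" "\<bar>s\<bar> \<le> t" for r s
    proof -
      have "dist (u + r *\<^sub>R a + s *\<^sub>R b) u = norm (r *\<^sub>R a + s *\<^sub>R b)" by (simp add: dist_norm algebra_simps)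
      also have "\<dots> \<le> \<bar>r\<bar> * norm a + \<bar>s\<bar> * norm b" by (metis norm_scaleR norm_triangle_ineq)
      also have "\<dots> \<le> t * norm a + t * norm b" using that by (intro add_mono mult_right_mono) auto
      also have "\<dots> \<le> t * (norm a + norm b + 1)" using t by (simp add: algebra_simps)
      also have "\<dots> = d / 2" using K by (simp add: t_def field_simps)
      finally show ?thesis using \<open>d > 0\<close> by simp
    qed
    have S: "u + r *\<^sub>R a + s *\<^sub>R b \<in> S" "u + r *\<^sub>R b + s *\<^sub>R a \<in> S" if "\<bar>r\<bar> \<le> t" "\<bar>s\<bar> \<le> t" for r s
      using near[OF that] near[OF that(2) that(1)] d3
      by (auto simp: d_def dist_commute subset_iff algebra_simps)
    obtain r s where rs: "\<bar>r\<bar> \<le> t" "\<bar>s\<bar> \<le> t"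
      "F (u + t *\<^sub>R a + t *\<^sub>R b) - F (u + t *\<^sub>R a) - F (u + t *\<^sub>R b) + F u
        = t\<^sup>2 * D1 (u + r *\<^sub>R a + s *\<^sub>R b)"
      using second_difference_mean_value[OF t S(1) assms(3,4)] unfolding D1_def by metis
    obtain r' s' where rs': "\<bar>r'\<bar> \<le> t" "\<bar>s'\<bar> \<le> t"
      "F (u + t *\<^sub>R b + t *\<^sub>R a) - F (u + t *\<^sub>R b) - F (u + t *\<^sub>R a) + F u
        = t\<^sup>2 * D2 (u + r' *\<^sub>R b + s' *\<^sub>R a)"
      using second_difference_mean_value[OF t S(2) assms(3,5)] unfolding D2_def by metis
    have "t\<^sup>2 * D1 (u + r *\<^sub>R a + s *\<^sub>R b) = t\<^sup>2 * D2 (u + r' *\<^sub>R b + s' *\<^sub>R a)"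
      using rs(3) rs'(3) by (simp add: algebra_simps)
    then have "D1 (u + r *\<^sub>R a + s *\<^sub>R b) = D2 (u + r' *\<^sub>R b + s' *\<^sub>R a)" using t by simp
    moreover have "dist (D1 (u + r *\<^sub>R a + s *\<^sub>R b)) (D1 u) < e"
      using near[OF rs(1,2)] d1 by (simp add: d_def)
    moreover have "dist (D2 (u + r' *\<^sub>R b + s' *\<^sub>R a)) (D2 u) < e"
      using near[OF rs'(2,1)] d2 by (simp add: d_def algebra_simps)
    ultimately show ?thesis by (simp add: dist_real_def)
  qed
  have "D1 u = D2 u"
  proof (rule ccontr)
    assume "D1 u \<noteq> D2 u"
    then show False using small[of "\<bar>D1 u - D2 u\<bar> / 2"] by auto
  qed
  then show ?thesis by (simp add: D1_def D2_def)
qed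

lemma fderiv_symmetric:
  fixes F :: "'a::euclidean_space \<Rightarrow> 'b::euclidean_space"
  assumes "open S" "u \<in> S" "C1_on S F" "\<And>v. C1_on S (\<lambda>u. fderiv F u v)"
  shows "fderiv (\<lambda>u. fderiv F u a) u b = fderiv (\<lambda>u. fderiv F u b) u a"
proof (rule euclidean_eqI)
  fix k :: 'b
  have 1: "fderiv (\<lambda>x. G x \<bullet> k) w v = fderiv G w v \<bullet> k"
    if "G differentiable (at w)" for G :: "'a \<Rightarrow> 'b" and w v
    using fderiv_eq[OF has_derivative_inner_left[OF that[unfolded frechet_derivative_works], of k]] by simp
  have 2: "fderiv (\<lambda>w. fderiv (\<lambda>x. F x \<bullet> k) w a) u b = fderiv (\<lambda>w. fderiv F w a) u b \<bullet> k" for a b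
  proof -
    have "fderiv (\<lambda>w. fderiv (\<lambda>x. F x \<bullet> k) w a) u b = fderiv (\<lambda>w. fderiv F w a \<bullet> k) u b"
      using assms by (subst fderiv_cong_open[of S u _ "\<lambda>w. fderiv F w a \<bullet> k"]) (auto simp: 1)
    also have "\<dots> = fderiv (\<lambda>w. fderiv F w a) u b \<bullet> k" using assms by (intro 1) auto
    finally show ?thesis .
  qed
  have "C1_on S (\<lambda>w. fderiv (\<lambda>x. F x \<bullet> k) w v)" for v
    by (rule C1_on_cong_open[OF assms(1) _ C1_on_inner[OF assms(4)[of v] C1_on_const[of S k]]])
       (use assms in \<open>auto simp: 1\<close>)
  then have "fderiv (\<lambda>w. fderiv (\<lambda>x. F x \<bullet> k) w a) u b = fderiv (\<lambda>w. fderiv (\<lambda>x. F x \<bullet> k) w b) u a"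
    by (intro fderiv_symmetric_real[OF assms(1,2)] C1_on_inner assms(3) C1_on_const)
  then show "fderiv (\<lambda>u. fderiv F u a) u b \<bullet> k = fderiv (\<lambda>u. fderiv F u b) u a \<bullet> k"
    by (simp add: 2)
qed

section \<open>Determinants and Gram matrices\<close>

text \<open>Only the identity permutation contributes: any other one moves at least two indices, so a
  vanishing off-diagonal factor survives when one factor is differentiated.\<close>

lemma has_derivative_det_at_identity:
  fixes C :: "'a::real_normed_vector \<Rightarrow> real^'n^'n"
  assumes C: "\<And>i j. ((\<lambda>x. C x $ i $ j) has_derivative C' i j) (at u)" and id: "C u = mat 1"
  shows "((\<lambda>x. det (C x)) has_derivative (\<lambda>h. \<Sum>i\<in>UNIV. C' i i h)) (at u)"
proof -
  let ?P = "{p. p permutes (UNIV :: 'n set)}"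
  let ?T = "\<lambda>p h. of_int (sign p) * (\<Sum>i\<in>UNIV. C' i (p i) h * (\<Prod>j\<in>UNIV - {i}. C u $ j $ p j))"
  have "((\<lambda>x. det (C x)) has_derivative (\<lambda>h. \<Sum>p\<in>?P. ?T p h)) (at u)"
    unfolding det_def by (intro has_derivative_sum has_derivative_mult_right has_derivative_prod C)
  moreover have "(\<Sum>p\<in>?P. ?T p h) = (\<Sum>i\<in>UNIV. C' i i h)" for h
  proof -
    have zero: "?T p h = 0" if "p \<in> ?P - {id}" for p
    proof -
      have p: "bij p" "p \<noteq> id" using that permutes_bij by auto
      have "(\<Prod>j\<in>UNIV - {i}. C u $ j $ p j) = 0" for i
      proof -
        have "\<exists>j. j \<noteq> i \<and> p j \<noteq> j"
        proof (rule ccontr)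
          assume *: "\<nexists>j. j \<noteq> i \<and> p j \<noteq> j"
          then have "p i = i" using p(1) by (metis bij_pointE)
          then have "p = id" using * by (auto simp: fun_eq_iff)
          then show False using p by simp
        qed
        then obtain j where "j \<noteq> i" "p j \<noteq> j" by blast
        then show ?thesis
          by (intro prod_zero bexI[of _ j]) (auto simp: id mat_def)
      qed
      then show ?thesis by (simp del: prod_zero_iff)
    qed
    have "(\<Sum>p\<in>?P. ?T p h) = (\<Sum>p\<in>{id}. ?T p h)"
      by (rule sum.mono_neutral_right) (use zero in \<open>auto simp: permutes_id finite_permutations\<close>)
    also have "\<dots> = (\<Sum>i\<in>UNIV. C' i i h)" by (simp add: id mat_def)
    finally show ?thesis .
  qed
  ultimately show ?thesis by simp
qed

lemma matrix_inv_mult: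
  fixes A :: "real^'n^'n"
  assumes "det A \<noteq> 0"
  shows "A ** matrix_inv A = mat 1" "matrix_inv A ** A = mat 1"
proof -
  have "\<exists>B. A ** B = mat 1 \<and> B ** A = mat 1"
    using assms by (simp add: invertible_def flip: invertible_det_nz)
  then have "A ** matrix_inv A = mat 1 \<and> matrix_inv A ** A = mat 1"
    unfolding matrix_inv_def by (rule someI_ex)
  then show "A ** matrix_inv A = mat 1" "matrix_inv A ** A = mat 1" by auto
qed

text \<open>Jacobi's formula. Multiplication by the inverse of \<open>A u\<close> moves the base point to
  the identity.\<close>

lemma has_derivative_det:
  fixes A :: "'a::real_normed_vector \<Rightarrow> real^'n^'n"
  assumes A: "\<And>i j. ((\<lambda>x. A x $ i $ j) has_derivative A' i j) (at u)" and nz: "det (A u) \<noteq> 0"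
  shows "((\<lambda>x. det (A x)) has_derivative
    (\<lambda>h. det (A u) * (\<Sum>i\<in>UNIV. \<Sum>k\<in>UNIV. matrix_inv (A u) $ i $ k * A' k i h))) (at u)"
proof -
  define B where "B = matrix_inv (A u)"
  have B: "A u ** B = mat 1" "B ** A u = mat 1"
    unfolding B_def by (rule matrix_inv_mult[OF nz])+
  have "((\<lambda>x. det (B ** A x)) has_derivative (\<lambda>h. \<Sum>i\<in>UNIV. \<Sum>k\<in>UNIV. B $ i $ k * A' k i h)) (at u)"
  proof (rule has_derivative_det_at_identity[where C' = "\<lambda>i j h. \<Sum>k\<in>UNIV. B $ i $ k * A' k j h"])
    show "((\<lambda>x. (B ** A x) $ i $ j) has_derivative (\<lambda>h. \<Sum>k\<in>UNIV. B $ i $ k * A' k j h)) (at u)" for i j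
      by (simp add: matrix_matrix_mult_def) (intro has_derivative_sum has_derivative_mult_right A)
  qed (rule B)
  from has_derivative_mult_right[OF this, of "det (A u)"]
  have "((\<lambda>x. det (A u) * det (B ** A x)) has_derivative
    (\<lambda>h. det (A u) * (\<Sum>i\<in>UNIV. \<Sum>k\<in>UNIV. B $ i $ k * A' k i h))) (at u)" .
  moreover have "det (A u) * det (B ** A x) = det (A x)" for x
  proof -
    have "det (A u) * det B = 1" using arg_cong[OF B(1), of det] by (simp add: det_mul)
    then show ?thesis by (simp add: det_mul flip: mult.assoc)
  qed
  ultimately show ?thesis by (simp add: B_def)
qed

lemma C1_on_det:
  fixes A :: "'a::euclidean_space \<Rightarrow> real^'n^'n"
  assumes "\<And>i j. C1_on S (\<lambda>x. A x $ i $ j)"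
  shows "C1_on S (\<lambda>x. det (A x))"
  unfolding det_def by (rule C1_on_sum, rule C1_on_mult, rule C1_on_const, rule C1_on_prod, rule assms)

text \<open>By Cramer's rule the entries of the inverse are quotients of determinants, hence inherit the
  regularity of the matrix.\<close>

lemma C1_on_matrix_inv:
  fixes A :: "'a::euclidean_space \<Rightarrow> real^'n^'n"
  assumes A: "\<And>i j. C1_on S (\<lambda>x. A x $ i $ j)" and nz: "\<And>x. x \<in> S \<Longrightarrow> det (A x) \<noteq> 0" and "open S"
  shows "C1_on S (\<lambda>x. matrix_inv (A x) $ i $ j)"
proof -
  let ?B = "\<lambda>x. \<chi> a b. if b = i then (axis j 1 :: real^'n) $ a else A x $ a $ b"
  have eq: "matrix_inv (A x) $ i $ j = det (?B x) / det (A x)" if "x \<in> S" for x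
  proof -
    have "A x *v (matrix_inv (A x) *v axis j 1) = axis j 1"
      using nz[OF that] by (simp add: matrix_vector_mul_assoc matrix_inv_mult)
    then have "matrix_inv (A x) *v axis j 1 =
        (\<chi> k. det (\<chi> a b. if b = k then (axis j 1 :: real^'n) $ a else A x $ a $ b) / det (A x))"
      using cramer[OF nz[OF that]] by blast
    then have "(matrix_inv (A x) *v axis j 1) $ i = det (?B x) / det (A x)" by simp
    then show ?thesis by (simp add: matrix_vector_mul_component inner_axis)
  qed
  have "C1_on S (\<lambda>x. det (?B x) / det (A x))"
  proof (rule C1_on_divide)
    have "C1_on S (\<lambda>x. ?B x $ a $ b)" for a b
      using A[of a b] C1_on_const[of S "(axis j 1 :: real^'n) $ a"] by (cases "b = i") simp_all
    then show "C1_on S (\<lambda>x. det (?B x))" by (rule C1_on_det)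
  qed (rule C1_on_det[OF A] nz)+
  then show ?thesis by (rule C1_on_cong_open[OF \<open>open S\<close>, rotated]) (rule eq[symmetric])
qed

definition gram :: "(real^'n \<Rightarrow> real^'k) \<Rightarrow> real^'n^'n" where
  "gram L = (\<chi> i j. L (axis i 1) \<bullet> L (axis j 1))"

lemma gram_component: "gram L $ i $ j = L (axis i 1) \<bullet> L (axis j 1)"
  by (simp add: gram_def)

text \<open>The range of \<open>L\<close> is isometric to its domain, so as far as lengths are concerned
  \<open>L\<close> can be replaced by an endomorphism. Its ordinary determinant then computes
  the Gram determinant of \<open>L\<close>.\<close>

lemma isometric_square_factor:
  fixes L :: "real^'n \<Rightarrow> real^'k"
  assumes L: "linear L" "inj L"
  obtains T :: "real^'n \<Rightarrow> real^'n" where "linear T" "inj T" "\<And>v w. T v \<bullet> T w = L v \<bullet> L w"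
proof -
  have dim: "dim (range L) = dim (UNIV :: (real^'n) set)"
    by (rule dim_image_eq[OF L(1)]) (use L(2) in simp)
  obtain f :: "real^'k \<Rightarrow> real^'n" where f: "linear f" "f ` range L = UNIV"
      "\<And>x. x \<in> range L \<Longrightarrow> norm (f x) = norm x"
    by (rule isometry_subspaces[OF linear_subspace_image[OF L(1) subspace_UNIV] subspace_UNIV dim]) blast
  define T where "T = f \<circ> L"
  have lin: "linear T" unfolding T_def using f(1) L(1) by (rule linear_compose[rotated])
  have norm: "norm (T v) = norm (L v)" for v by (simp add: T_def f)
  have inner: "T v \<bullet> T w = L v \<bullet> L w" for v w
  proof -
    have "norm (T v + T w) = norm (L v + L w)"
      by (simp add: norm flip: linear_add[OF lin] linear_add[OF L(1)])
    then have "(T v + T w) \<bullet> (T v + T w) = (L v + L w) \<bullet> (L v + L w)" by (simp add: norm_eq_sqrt_inner)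
    moreover have "T v \<bullet> T v = L v \<bullet> L v" "T w \<bullet> T w = L w \<bullet> L w"
      using norm by (simp_all add: norm_eq_sqrt_inner)
    ultimately show ?thesis by (simp add: inner_simps inner_commute)
  qed
  have "inj T"
    unfolding linear_injective_0[OF lin]
    using L(2) norm unfolding linear_injective_0[OF L(1)] by (metis norm_eq_zero)
  then show ?thesis using that lin inner by blast
qed

lemma det_gram_factor:
  fixes T :: "real^'n \<Rightarrow> real^'n"
  assumes T: "\<And>v w. T v \<bullet> T w = L v \<bullet> L w"
  shows "det (gram L) = (det (matrix T))\<^sup>2"
proof -
  have "gram L $ i $ j = (transpose (matrix T) ** matrix T) $ i $ j" for i j
    unfolding gram_component T[symmetric]
    by (simp add: inner_vec_def matrix_matrix_mult_def transpose_def matrix_def)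
  then have "gram L = transpose (matrix T) ** matrix T" by (simp add: vec_eq_iff)
  then show ?thesis by (simp add: det_mul power2_eq_square)
qed

lemma sqrt_det_gram_factor:
  fixes T :: "real^'n \<Rightarrow> real^'n"
  assumes "\<And>v w. T v \<bullet> T w = L v \<bullet> L w"
  shows "sqrt (det (gram L)) = \<bar>det (matrix T)\<bar>"
  by (simp add: det_gram_factor[of T L, OF assms])

lemma det_gram_pos:
  fixes L :: "real^'n \<Rightarrow> real^'k"
  assumes "linear L" "inj L"
  shows "det (gram L) > 0"
proof -
  obtain T :: "real^'n \<Rightarrow> real^'n" where T: "linear T" "inj T" "\<And>v w. T v \<bullet> T w = L v \<bullet> L w"
    using isometric_square_factor[OF assms] by blast
  then have "det (matrix T) \<noteq> 0" using det_nz_iff_inj by blast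
  then show ?thesis unfolding det_gram_factor[of T L, OF T(3)] by (rule zero_less_power2[THEN iffD2])
qed

text \<open>The transformation rule that makes the Riemannian volume density independent of the chart.\<close>

lemma sqrt_det_gram_compose:
  fixes L :: "real^'n \<Rightarrow> real^'k" and B :: "real^'n \<Rightarrow> real^'n"
  assumes "linear L" "inj L" "linear B"
  shows "sqrt (det (gram (L \<circ> B))) = \<bar>det (matrix B)\<bar> * sqrt (det (gram L))"
proof -
  obtain T :: "real^'n \<Rightarrow> real^'n" where T: "linear T" "inj T" "\<And>v w. T v \<bullet> T w = L v \<bullet> L w"
    using isometric_square_factor[OF assms(1,2)] by blast
  have "sqrt (det (gram (L \<circ> B))) = \<bar>det (matrix (T \<circ> B))\<bar>"
    by (rule sqrt_det_gram_factor[of "T \<circ> B" "L \<circ> B"]) (simp add: T)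
  then show ?thesis
    by (simp add: matrix_compose[OF assms(3) T(1)] det_mul abs_mult sqrt_det_gram_factor[of T L, OF T(3)])
qed

text \<open>A rotation that takes \<open>v\<close> to a multiple of a basis vector makes the map diagonal.\<close>

lemma det_identity_minus_rank_one:
  fixes v :: "real^'n"
  shows "det (matrix (\<lambda>x. x - (v \<bullet> x) *\<^sub>R v)) = 1 - v \<bullet> v"
proof -
  define k where "k = (undefined :: 'n)"
  define e where "e = (axis k 1 :: real^'n)"
  define B where "B x = x - (v \<bullet> x) *\<^sub>R v" for x
  define D where "D x = x - ((v \<bullet> v) * (e \<bullet> x)) *\<^sub>R e" for x
  have e: "norm e = 1" by (simp add: e_def)
  have "norm v = norm (norm v *\<^sub>R e)" by (simp add: e)
  then obtain f where f: "orthogonal_transformation f" "f v = norm v *\<^sub>R e"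
    using orthogonal_transformation_exists by blast
  have lf: "linear f" using f(1) by (simp add: orthogonal_transformation_linear)
  have lB: "linear B" "linear D"
    unfolding B_def D_def by (auto intro!: linearI simp: algebra_simps inner_simps)
  have D_entry: "matrix D $ i $ j =
      (if i = j then 1 else 0) - (v \<bullet> v) * (if j = k then 1 else 0) * (if i = k then 1 else 0)" for i j
    by (simp add: matrix_def D_def inner_axis) (simp add: e_def axis_def)
  have "f (B x) = D (f x)" for x
  proof -
    have "v \<bullet> x = f v \<bullet> f x" using f(1) by (simp add: orthogonal_transformation_def)
    then show ?thesis
      by (simp add: B_def D_def linear_diff[OF lf] linear_cmul[OF lf] f(2) dot_square_norm power2_eq_square)
  qed
  then have "f \<circ> B = D \<circ> f" by auto
  then have "matrix f ** matrix B = matrix D ** matrix f"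
    by (simp add: lf lB flip: matrix_compose)
  then have "det (matrix f) * det (matrix B) = det (matrix D) * det (matrix f)"
    by (simp flip: det_mul)
  moreover have "det (matrix f) \<noteq> 0"
    using det_orthogonal_matrix[of "matrix f"] f(1) orthogonal_transformation_matrix[of f] by auto
  ultimately have "det (matrix B) = det (matrix D)" by simp
  also have "\<dots> = (\<Prod>i\<in>UNIV. matrix D $ i $ i)"
    by (rule det_diagonal) (auto simp: D_entry)
  also have "\<dots> = (\<Prod>i\<in>UNIV. if i = k then 1 - v \<bullet> v else 1)"
    by (rule prod.cong) (auto simp: D_entry)
  also have "\<dots> = 1 - v \<bullet> v" by simp
  finally show ?thesis by (simp add: B_def[abs_def])
qed

section \<open>Change of variables for nonnegative integrands\<close>

text \<open>The change of variables theorem is stated for well-ordered index types. A finite index type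
  carries such an order after the relabelling below, and relabelling coordinates changes neither
  Lebesgue measure nor determinants.\<close>

typedef 'n windex = "UNIV :: 'n set"
  morphisms unwrap wrap ..

lemma wrap_unwrap [simp]: "wrap (unwrap i) = i" "unwrap (wrap j) = j"
  by (simp_all add: unwrap_inverse wrap_inverse)

lemma bij_unwrap: "bij unwrap" and bij_wrap: "bij wrap"
  by (rule o_bij[of wrap] o_bij[of unwrap]; simp add: fun_eq_iff)+

instance windex :: (finite) finite
proof
  have "UNIV = range (wrap :: 'a \<Rightarrow> 'a windex)" using bij_is_surj[OF bij_wrap] by (rule sym)
  then show "finite (UNIV :: 'a windex set)" by (metis finite_imageI finite)
qed

definition index_rank :: "'n::finite windex \<Rightarrow> nat" where
  "index_rank i = (SOME r :: 'n \<Rightarrow> nat. inj r) (unwrap i)"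

lemma inj_index_rank: "inj (index_rank :: 'n::finite windex \<Rightarrow> nat)"
proof -
  have "\<exists>r :: 'n \<Rightarrow> nat. inj r" using finite_imp_inj_to_nat_seg[of "UNIV :: 'n set"] by auto
  then have "inj (SOME r :: 'n \<Rightarrow> nat. inj r)" by (rule someI_ex)
  moreover have "inj unwrap" using bij_unwrap by (rule bij_is_inj)
  ultimately have "inj ((SOME r :: 'n \<Rightarrow> nat. inj r) \<circ> unwrap)" by (rule inj_compose)
  then show ?thesis by (simp add: index_rank_def[abs_def] o_def)
qed

instantiation windex :: (finite) wellorder
begin
definition "i \<le> j \<longleftrightarrow> index_rank i \<le> index_rank (j :: 'a windex)"
definition "i < j \<longleftrightarrow> index_rank i < index_rank (j :: 'a windex)"
instance
proof
  fix x y :: "'a windex"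
  show "x = y" if "x \<le> y" "y \<le> x"
    using that inj_index_rank unfolding less_eq_windex_def by (meson antisym inj_def)
next
  fix P :: "'a windex \<Rightarrow> bool" and a
  assume step: "\<And>x. (\<And>y. y < x \<Longrightarrow> P y) \<Longrightarrow> P x"
  show "P a"
    by (induction a rule: measure_induct_rule[of index_rank]) (rule step, simp add: less_windex_def)
qed (auto simp: less_eq_windex_def less_windex_def)
end

definition wrapv :: "real^'n \<Rightarrow> real^('n windex)" where
  "wrapv x = (\<chi> i. x $ unwrap i)"

definition unwrapv :: "real^('n windex) \<Rightarrow> real^'n" where
  "unwrapv x = (\<chi> i. x $ wrap i)"

lemma wrapv_unwrapv [simp]: "wrapv (unwrapv x) = x" "unwrapv (wrapv y) = y"
  by (simp_all add: wrapv_def unwrapv_def)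

lemma linear_wrapv: "linear wrapv" and linear_unwrapv: "linear unwrapv"
  by (auto intro!: linearI simp: wrapv_def unwrapv_def vec_eq_iff)

lemma measurable_wrapv [measurable]: "wrapv \<in> borel_measurable borel"
  and measurable_unwrapv [measurable]: "unwrapv \<in> borel_measurable borel"
  by (auto intro!: borel_measurable_continuous_onI linear_continuous_on
      simp: linear_wrapv linear_unwrapv simp flip: linear_conv_bounded_linear)

lemma lborel_distr_unwrapv: "distr lborel borel unwrapv = (lborel :: (real^'n) measure)"
proof (rule lborel_eqI[symmetric])
  fix l u :: "real^'n" assume le: "\<And>b. b \<in> Basis \<Longrightarrow> l \<bullet> b \<le> u \<bullet> b"
  have le': "l $ i \<le> u $ i" for i using le[of "axis i 1"] by (simp add: inner_axis axis_in_Basis_iff)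
  have prod_Basis: "(\<Prod>b\<in>Basis. x \<bullet> b) = (\<Prod>i\<in>UNIV. x $ i)" for x :: "real^'i"
  proof -
    have "bij_betw (\<lambda>i. axis i 1 :: real^'i) UNIV Basis"
      by (auto simp: bij_betw_def inj_def axis_eq_axis Basis_vec_def)
    from prod.reindex_bij_betw[OF this, of "\<lambda>b. x \<bullet> b"] show ?thesis by (simp add: inner_axis)
  qed
  have "unwrapv -` box l u = box (wrapv l) (wrapv u)"
  proof (rule set_eqI)
    fix x :: "real^('n windex)"
    have "(\<forall>i. l $ i < x $ wrap i \<and> x $ wrap i < u $ i) \<longleftrightarrow>
          (\<forall>j. l $ unwrap j < x $ j \<and> x $ j < u $ unwrap j)"
      by (metis wrap_unwrap)
    then show "x \<in> unwrapv -` box l u \<longleftrightarrow> x \<in> box (wrapv l) (wrapv u)"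
      by (simp add: mem_box_cart unwrapv_def wrapv_def)
  qed
  then have "emeasure (distr lborel borel unwrapv) (box l u) = emeasure lborel (box (wrapv l) (wrapv u))"
    by (simp add: emeasure_distr)
  also have "\<dots> = (\<Prod>b\<in>Basis. (wrapv u - wrapv l) \<bullet> b)"
  proof (rule emeasure_lborel_box)
    fix b :: "real^('n windex)" assume "b \<in> Basis"
    then obtain i where "b = axis i 1" by (auto simp: Basis_vec_def)
    then show "wrapv l \<bullet> b \<le> wrapv u \<bullet> b" by (simp add: inner_axis wrapv_def le')
  qed
  also have "(\<Prod>b\<in>Basis. (wrapv u - wrapv l) \<bullet> b) = (\<Prod>i\<in>UNIV. (u - l) $ unwrap i)"
    unfolding prod_Basis by (simp add: wrapv_def)
  also have "\<dots> = (\<Prod>i\<in>UNIV. (u - l) $ i)"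
    using bij_unwrap by (rule prod.reindex_bij_betw)
  finally show "emeasure (distr lborel borel unwrapv) (box l u) = (\<Prod>b\<in>Basis. (u - l) \<bullet> b)"
    by (simp add: prod_Basis)
qed simp

lemma nn_integral_unwrapv:
  fixes h :: "real^'n \<Rightarrow> ennreal"
  assumes "h \<in> borel_measurable borel"
  shows "(\<integral>\<^sup>+x. h (unwrapv x) \<partial>lborel) = (\<integral>\<^sup>+x. h x \<partial>lborel)"
  using assms by (subst lborel_distr_unwrapv[symmetric]) (simp add: nn_integral_distr)

lemma emeasure_wrapv_image:
  fixes S :: "(real^'n) set"
  assumes "S \<in> sets borel"
  shows "emeasure lborel (wrapv ` S) = emeasure lborel S"
proof -
  have "wrapv ` S = unwrapv -` S" by (auto simp: image_iff) (metis wrapv_unwrapv(1))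
  then show ?thesis
    using assms by (subst (2) lborel_distr_unwrapv[symmetric]) (simp add: emeasure_distr)
qed

text \<open>Relabelling conjugates the permutations in the Leibniz formula and preserves their signs.\<close>

lemma det_matrix_wrap:
  fixes A :: "real^'n^'n"
  shows "det ((\<chi> i j. A $ unwrap i $ unwrap j) :: real^('n windex)^('n windex)) = det A"
proof -
  let ?m = "map_permutation (UNIV :: 'n set) wrap"
  have m: "?m p = wrap \<circ> p \<circ> unwrap" if "p permutes UNIV" for p
  proof -
    have "inv_into UNIV wrap = (unwrap :: 'n windex \<Rightarrow> 'n)"
      by (rule inv_equality) auto
    then show ?thesis
      unfolding map_permutation_def restrict_id_def bij_is_surj[OF bij_wrap] by auto
  qed
  have bij: "bij_betw ?m {p. p permutes (UNIV :: 'n set)} {p. p permutes (UNIV :: 'n windex set)}"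
  proof (rule bij_betw_byWitness[where f' = "map_permutation UNIV unwrap"])
    let ?m' = "map_permutation (UNIV :: 'n windex set) unwrap"
    have bw: "bij_betw (wrap :: 'n \<Rightarrow> 'n windex) UNIV UNIV" "bij_betw (unwrap :: 'n windex \<Rightarrow> 'n) UNIV UNIV"
      using bij_wrap bij_unwrap by auto
    show "\<forall>p\<in>{p. p permutes (UNIV :: 'n set)}. ?m' (?m p) = p"
      by (auto intro!: map_permutation_compose_inv[OF bw(1)])
    show "\<forall>p\<in>{p. p permutes (UNIV :: 'n windex set)}. ?m (?m' p) = p"
      by (auto intro!: map_permutation_compose_inv[OF bw(2)])
    show "?m ` {p. p permutes (UNIV :: 'n set)} \<subseteq> {p. p permutes (UNIV :: 'n windex set)}"
      by (auto intro!: map_permutation_permutes[OF bw(1)])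
    show "?m' ` {p. p permutes (UNIV :: 'n windex set)} \<subseteq> {p. p permutes (UNIV :: 'n set)}"
      by (auto intro!: map_permutation_permutes[OF bw(2)])
  qed
  have "det ((\<chi> i j. A $ unwrap i $ unwrap j) :: real^('n windex)^('n windex))
    = (\<Sum>p\<in>{p. p permutes (UNIV :: 'n set)}.
        of_int (sign (?m p)) * (\<Prod>i\<in>UNIV. A $ unwrap i $ unwrap (?m p i)))"
    unfolding det_def by (subst sum.reindex_bij_betw[OF bij, symmetric]) simp
  also have "\<dots> = det A"
    unfolding det_def
  proof (rule sum.cong)
    fix p :: "'n \<Rightarrow> 'n" assume "p \<in> {p. p permutes UNIV}"
    then have p: "p permutes UNIV" by simp
    have "sign (?m p) = sign p"
      using p bij_wrap by (intro sign_map_permutation) (auto simp: bij_def)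
    moreover have "(\<Prod>i\<in>UNIV. A $ unwrap i $ unwrap (?m p i)) = (\<Prod>i\<in>UNIV. A $ i $ p i)"
      using prod.reindex_bij_betw[OF bij_unwrap, of "\<lambda>i. A $ i $ p i"] by (simp add: m[OF p])
    ultimately show "of_int (sign (?m p)) * (\<Prod>i\<in>UNIV. A $ unwrap i $ unwrap (?m p i))
      = of_int (sign p) * (\<Prod>i\<in>UNIV. A $ i $ p i)" by simp
  qed simp
  finally show ?thesis .
qed

text \<open>The finite case is the measure form of the change of variables theorem. If the integral is
  infinite, a finite measure of the image would make the Jacobian integrable after all.\<close>

lemma emeasure_differentiable_image_wellorder:
  fixes g :: "real^'m::{finite,wellorder} \<Rightarrow> real^'m::_"
  assumes S: "S \<in> sets borel" and gS: "g ` S \<in> sets borel"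
    and der: "\<And>x. x \<in> S \<Longrightarrow> (g has_derivative g' x) (at x within S)" and inj: "inj_on g S"
    and meas: "(\<lambda>x. \<bar>det (matrix (g' x))\<bar> * indicator S x) \<in> borel_measurable borel"
  shows "emeasure lborel (g ` S) = (\<integral>\<^sup>+x\<in>S. ennreal \<bar>det (matrix (g' x))\<bar> \<partial>lborel)"
proof -
  define D where "D x = \<bar>det (matrix (g' x))\<bar>" for x
  note image = has_measure_differentiable_image[OF _ der inj]
  have SL: "S \<in> sets lebesgue" using S by (auto intro: sets_completionI_sets)
  show ?thesis
  proof (cases "(\<integral>\<^sup>+x\<in>S. ennreal (D x) \<partial>lborel) = \<infinity>")
    case False
    then obtain r where r: "(\<integral>\<^sup>+x\<in>S. ennreal (D x) \<partial>lborel) = ennreal r" "r \<ge> 0"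
      by (metis ennreal_cases infinity_ennreal_def)
    have "((\<lambda>x. D x * indicator S x) has_integral r) UNIV"
    proof (rule nn_integral_has_integral)
      show "(\<integral>\<^sup>+x. ennreal (D x * indicator S x) \<partial>lborel) = ennreal r"
        by (simp add: r(1)[symmetric] ennreal_mult' D_def ennreal_indicator)
    qed (use meas r(2) in \<open>auto simp: D_def\<close>)
    then have "(D has_integral r) S"
      by (subst has_integral_restrict_UNIV[symmetric])
         (simp add: indicator_def of_bool_def if_distrib cong: if_cong)
    then have "g ` S \<in> lmeasurable \<and> measure lebesgue (g ` S) = r"
      using image[OF SL] unfolding D_def by blast
    then have "emeasure lebesgue (g ` S) = ennreal r"
      using emeasure_eq_measure2 by blast
    then show ?thesis using r(1) gS by (simp add: D_def emeasure_completion)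
  next
    case True
    have "emeasure lborel (g ` S) = \<infinity>"
    proof (rule ccontr)
      assume "emeasure lborel (g ` S) \<noteq> \<infinity>"
      then have "g ` S \<in> lmeasurable"
        using gS by (intro fmeasurableI) (auto simp: emeasure_completion less_top[symmetric] intro: sets_completionI_sets)
      then have "(D has_integral measure lebesgue (g ` S)) S"
        using image[OF SL] unfolding D_def by blast
      from nn_integral_has_integral_lebesgue'[OF _ this] True show False
        by (simp add: D_def)
    qed
    then show ?thesis using True by (simp add: D_def)
  qed
qed

lemma emeasure_differentiable_image:
  fixes g :: "real^'n \<Rightarrow> real^'n"
  assumes S: "S \<in> sets borel" and gS: "g ` S \<in> sets borel"
    and der: "\<And>x. x \<in> S \<Longrightarrow> (g has_derivative g' x) (at x within S)" and inj: "inj_on g S"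
    and meas: "(\<lambda>x. \<bar>det (matrix (g' x))\<bar> * indicator S x) \<in> borel_measurable borel"
  shows "emeasure lborel (g ` S) = (\<integral>\<^sup>+x\<in>S. ennreal \<bar>det (matrix (g' x))\<bar> \<partial>lborel)"
proof -
  define h where "h = wrapv \<circ> g \<circ> unwrapv"
  define h' where "h' x = wrapv \<circ> g' (unwrapv x) \<circ> unwrapv" for x
  have bl: "bounded_linear (wrapv :: real^'n \<Rightarrow> _)" "bounded_linear (unwrapv :: _ \<Rightarrow> real^'n)"
    using linear_wrapv linear_unwrapv linear_conv_bounded_linear by auto
  have vim: "wrapv ` X = unwrapv -` X" for X :: "(real^'n) set"
    by (auto simp: image_iff) (metis wrapv_unwrapv(1))
  have mS: "wrapv ` X \<in> sets borel" if "X \<in> sets borel" for X :: "(real^'n) set"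
    unfolding vim using measurable_sets[OF measurable_unwrapv that] by simp
  have hS: "h ` (wrapv ` S) = wrapv ` (g ` S)" by (force simp: h_def)
  have det: "det (matrix (h' x)) = det (matrix (g' (unwrapv x)))" for x
  proof -
    have "matrix (h' x) = (\<chi> i j. matrix (g' (unwrapv x)) $ unwrap i $ unwrap j)"
    proof -
      have "unwrapv (axis j 1) = axis (unwrap j) 1" for j :: "'n windex"
        by (auto simp: unwrapv_def axis_def vec_eq_iff)
      then show ?thesis by (simp add: h'_def matrix_def wrapv_def)
    qed
    then show ?thesis by (simp add: det_matrix_wrap)
  qed
  have "emeasure lborel (h ` (wrapv ` S)) = (\<integral>\<^sup>+x\<in>wrapv ` S. ennreal \<bar>det (matrix (h' x))\<bar> \<partial>lborel)"
  proof (rule emeasure_differentiable_image_wellorder)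
    show "wrapv ` S \<in> sets borel" "h ` (wrapv ` S) \<in> sets borel"
      unfolding hS by (auto intro: mS S gS)
    show "(h has_derivative h' x) (at x within wrapv ` S)" if x: "x \<in> wrapv ` S" for x
    proof -
      have 1: "(unwrapv has_derivative unwrapv) (at x within wrapv ` S)"
        using bl(2) by (rule bounded_linear_imp_has_derivative)
      have 2: "(g has_derivative g' (unwrapv x)) (at (unwrapv x) within unwrapv ` wrapv ` S)"
        using der[of "unwrapv x"] x by (auto simp: image_image)
      have "(wrapv \<circ> (g \<circ> unwrapv) has_derivative wrapv \<circ> (g' (unwrapv x) \<circ> unwrapv)) (at x within wrapv ` S)"
        using bounded_linear.has_derivative[OF bl(1) diff_chain_within[OF 1 2]] by (simp add: o_def)
      then show ?thesis unfolding h_def h'_def by (simp add: o_assoc)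
    qed
    show "inj_on h (wrapv ` S)"
    proof (rule inj_onI)
      fix x y assume "x \<in> wrapv ` S" "y \<in> wrapv ` S" "h x = h y"
      then obtain a b where "x = wrapv a" "y = wrapv b" "a \<in> S" "b \<in> S" "wrapv (g a) = wrapv (g b)"
        by (auto simp: h_def)
      then show "x = y" using inj by (metis inj_onD wrapv_unwrapv(2))
    qed
    have "(\<lambda>x. (\<lambda>x. \<bar>det (matrix (g' x))\<bar> * indicator S x) (unwrapv x)) \<in> borel_measurable borel"
      using meas by measurable
    then show "(\<lambda>x. \<bar>det (matrix (h' x))\<bar> * indicator (wrapv ` S) x) \<in> borel_measurable borel"
      by (simp add: det vim indicator_def)
  qed
  also have "\<dots> = (\<integral>\<^sup>+x. (\<lambda>x. ennreal \<bar>det (matrix (g' x))\<bar> * indicator S x) (unwrapv x) \<partial>lborel)"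
    by (simp add: det vim indicator_def)
  also have "\<dots> = (\<integral>\<^sup>+x\<in>S. ennreal \<bar>det (matrix (g' x))\<bar> \<partial>lborel)"
  proof (rule nn_integral_unwrapv)
    have "(\<lambda>x. ennreal (\<bar>det (matrix (g' x))\<bar> * indicator S x)) \<in> borel_measurable borel"
      using meas by measurable
    then show "(\<lambda>x. ennreal \<bar>det (matrix (g' x))\<bar> * indicator S x) \<in> borel_measurable borel"
      by (simp add: ennreal_mult' ennreal_indicator)
  qed
  finally show ?thesis unfolding hS using emeasure_wrapv_image[OF gS] by simp
qed

text \<open>Applied to the parts of \<open>S\<close> that \<open>g\<close> maps into a given Borel set,
  the formula for measures of images says that two measures agree: the push-forward of the
  measure with density \<open>|det g'|\<close> on \<open>S\<close>, and Lebesgue measure on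
  \<open>g ` S\<close>.\<close>

lemma nn_integral_change_of_variables:
  fixes g :: "real^'n \<Rightarrow> real^'n" and f :: "real^'n \<Rightarrow> ennreal"
  assumes S: "S \<in> sets borel"
    and gX: "\<And>X. X \<in> sets borel \<Longrightarrow> X \<subseteq> S \<Longrightarrow> g ` X \<in> sets borel"
    and der: "\<And>x. x \<in> S \<Longrightarrow> (g has_derivative g' x) (at x within S)" and inj: "inj_on g S"
    and cont: "continuous_on S (\<lambda>x. det (matrix (g' x)))"
    and f [measurable]: "f \<in> borel_measurable borel"
  shows "(\<integral>\<^sup>+y\<in>g ` S. f y \<partial>lborel) = (\<integral>\<^sup>+x\<in>S. ennreal \<bar>det (matrix (g' x))\<bar> * f (g x) \<partial>lborel)"
proof -
  define G where "G x = (if x \<in> S then g x else 0)" for x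
  define D where "D x = ennreal \<bar>det (matrix (g' x))\<bar> * indicator S x" for x
  have gS [measurable]: "g ` S \<in> sets borel" using S gX by blast
  have contg: "continuous_on S g" using der by (rule has_derivative_continuous_on)
  have G [measurable]: "G \<in> borel_measurable borel"
    unfolding G_def using S contg by (intro borel_measurable_continuous_on_if) auto
  have meas: "(\<lambda>x. \<bar>det (matrix (g' x))\<bar> * indicator X x) \<in> borel_measurable borel"
    if "X \<in> sets borel" "X \<subseteq> S" for X
  proof -
    have "(\<lambda>x. indicator X x *\<^sub>R \<bar>det (matrix (g' x))\<bar>) \<in> borel_measurable borel"
      using that cont by (intro borel_measurable_continuous_on_indicator continuous_intros)
        (auto intro: continuous_on_subset)
    then show ?thesis by (simp add: mult.commute)
  qed
  have "(\<lambda>x. ennreal (\<bar>det (matrix (g' x))\<bar> * indicator S x)) \<in> borel_measurable borel"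
    using meas[OF S] by measurable
  then have D [measurable]: "D \<in> borel_measurable borel"
    unfolding D_def[abs_def] by (simp add: ennreal_mult' ennreal_indicator)
  have eq: "distr (density lborel D) borel G = density lborel (indicator (g ` S))"
  proof (rule measure_eqI)
    fix E assume "E \<in> sets (distr (density lborel D) borel G)"
    then have E [measurable]: "E \<in> sets borel" by simp
    define X where "X = S \<inter> G -` E"
    have GE: "G -` E \<in> sets borel" using measurable_sets[OF G E] by simp
    have X: "X \<in> sets borel" "X \<subseteq> S" using S GE by (auto simp: X_def)
    have "emeasure (distr (density lborel D) borel G) E = (\<integral>\<^sup>+x\<in>G -` E. D x \<partial>lborel)"
      using GE by (simp add: emeasure_distr emeasure_density)
    also have "\<dots> = (\<integral>\<^sup>+x\<in>X. ennreal \<bar>det (matrix (g' x))\<bar> \<partial>lborel)"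
      by (intro nn_integral_cong) (auto simp: D_def X_def indicator_def)
    also have "\<dots> = emeasure lborel (g ` X)"
      by (rule emeasure_differentiable_image[symmetric])
         (use X der inj meas[OF X] gX[OF X] in \<open>auto intro: has_derivative_subset inj_on_subset\<close>)
    also have "g ` X = g ` S \<inter> E" by (auto simp: X_def G_def)
    finally show "emeasure (distr (density lborel D) borel G) E = emeasure (density lborel (indicator (g ` S))) E"
      by (simp add: emeasure_density flip: indicator_inter_arith)
  qed simp
  have "(\<integral>\<^sup>+y\<in>g ` S. f y \<partial>lborel) = (\<integral>\<^sup>+y. f y \<partial>density lborel (indicator (g ` S)))"
    by (simp add: nn_integral_density mult.commute)
  also have "\<dots> = (\<integral>\<^sup>+x. D x * f (G x) \<partial>lborel)"
    unfolding eq[symmetric] by (simp add: nn_integral_distr nn_integral_density)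
  also have "\<dots> = (\<integral>\<^sup>+x\<in>S. ennreal \<bar>det (matrix (g' x))\<bar> * f (g x) \<partial>lborel)"
    by (intro nn_integral_cong) (auto simp: D_def G_def indicator_def)
  finally show ?thesis .
qed

section \<open>Two integrals over Euclidean space\<close>

text \<open>The central projection of the tangent plane onto the open upper hemisphere, followed by the
  orthogonal projection of the hemisphere onto the unit ball.\<close>

definition gnomonic :: "'a::euclidean_space \<Rightarrow> 'a" where
  "gnomonic w = inverse (sqrt (1 + w \<bullet> w)) *\<^sub>R w"

lemma has_derivative_gnomonic:
  "(gnomonic has_derivative
     (\<lambda>h. inverse (sqrt (1 + w \<bullet> w)) *\<^sub>R (h - (gnomonic w \<bullet> h) *\<^sub>R gnomonic w))) (at w)"
proof -
  define c where "c = inverse (sqrt (1 + w \<bullet> w))"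
  have pos: "0 < 1 + w \<bullet> w" by (simp add: add_pos_nonneg)
  have "((\<lambda>t. inverse (sqrt t)) has_real_derivative - (c ^ 3) / 2) (at (1 + w \<bullet> w))"
    using pos by (auto intro!: derivative_eq_intros simp: c_def field_simps power3_eq_cube)
  moreover have "((\<lambda>w. 1 + w \<bullet> w) has_derivative (\<lambda>h. 2 * (w \<bullet> h))) (at w)"
    by (auto intro!: derivative_eq_intros simp: inner_commute)
  ultimately have "((\<lambda>w. inverse (sqrt (1 + w \<bullet> w))) has_derivative (\<lambda>h. - (c ^ 3) / 2 * (2 * (w \<bullet> h)))) (at w)"
    unfolding has_field_derivative_def by (rule has_derivative_compose[rotated])
  from has_derivative_scaleR[OF this has_derivative_ident]
  have "(gnomonic has_derivative (\<lambda>h. c *\<^sub>R h + (- (c ^ 3) / 2 * (2 * (w \<bullet> h))) *\<^sub>R w)) (at w)"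
    unfolding gnomonic_def[abs_def] c_def by simp
  moreover have "c *\<^sub>R h + (- (c ^ 3) / 2 * (2 * (w \<bullet> h))) *\<^sub>R w = c *\<^sub>R (h - (gnomonic w \<bullet> h) *\<^sub>R gnomonic w)" for h
    by (simp add: gnomonic_def algebra_simps power3_eq_cube flip: c_def)
  ultimately show ?thesis by (simp add: c_def)
qed

lemma inner_gnomonic: "gnomonic w \<bullet> gnomonic w = 1 - inverse (1 + w \<bullet> w)"
proof -
  have "0 < 1 + w \<bullet> w" by (simp add: add_pos_nonneg)
  then show ?thesis by (simp add: gnomonic_def field_simps flip: power2_eq_square)
qed

lemma inj_gnomonic: "inj gnomonic"
proof (rule injI)
  fix x y :: 'a assume eq: "gnomonic x = gnomonic y"
  have pos: "0 < 1 + x \<bullet> x" "0 < 1 + y \<bullet> y" by (simp_all add: add_pos_nonneg)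
  have "1 + x \<bullet> x = 1 + y \<bullet> y" using inner_gnomonic[of x] inner_gnomonic[of y] by (simp add: eq)
  then show "x = y" using eq pos by (simp add: gnomonic_def)
qed

lemma range_gnomonic: "range gnomonic = ball 0 1"
proof (intro equalityI subsetI)
  fix y :: 'a assume "y \<in> range gnomonic"
  then obtain w where "y = gnomonic w" by auto
  then have "y \<bullet> y < 1" by (simp add: inner_gnomonic add_pos_nonneg)
  then show "y \<in> ball 0 1" by (simp add: norm_eq_sqrt_inner)
next
  fix y :: 'a assume "y \<in> ball 0 1"
  then have y: "y \<bullet> y < 1" by (simp add: norm_eq_sqrt_inner)
  define a where "a = inverse (sqrt (1 - y \<bullet> y))"
  have a: "a > 0" "a\<^sup>2 = inverse (1 - y \<bullet> y)" using y by (simp_all add: a_def power_inverse)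
  have "1 + (a *\<^sub>R y) \<bullet> (a *\<^sub>R y) = 1 + a\<^sup>2 * (y \<bullet> y)" by (simp add: power2_eq_square)
  also have "\<dots> = a\<^sup>2" using y by (simp add: a(2) field_simps)
  finally have "gnomonic (a *\<^sub>R y) = y" using a(1) by (simp add: gnomonic_def)
  then show "y \<in> range gnomonic" by (metis rangeI)
qed

text \<open>The gnomonic map carries the whole space onto the unit ball. Its derivative at
  \<open>w\<close> is \<open>(1 + |w|\<^sup>2) powr (- 1/2)\<close> times a rank one
  perturbation of the identity with determinant \<open>1 / (1 + |w|\<^sup>2)\<close>, so the
  integrand is the Jacobian of its composition with \<open>T\<close>.\<close>

lemma nn_integral_ball_kernel:
  fixes T :: "real^'n \<Rightarrow> real^'n"
  assumes T: "linear T" "inj T"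
  shows "(\<integral>\<^sup>+s. ennreal (\<bar>det (matrix T)\<bar> / (1 + T s \<bullet> T s) powr (real CARD('n) / 2 + 1)) \<partial>lborel)
    = emeasure lborel (ball (0 :: real^'n) 1)"
proof -
  define c where "c s = inverse (sqrt (1 + T s \<bullet> T s))" for s
  define R where "R s x = x - (gnomonic (T s) \<bullet> x) *\<^sub>R gnomonic (T s)" for s and x :: "real^'n"
  define g' where "g' s = (*\<^sub>R) (c s) \<circ> (R s \<circ> T)" for s
  have pos: "0 < 1 + T s \<bullet> T s" for s by (simp add: add_pos_nonneg)
  have linR: "linear (R s)" for s
    unfolding R_def by (auto intro!: linearI simp: algebra_simps inner_simps)
  have cpow: "c s ^ CARD('n) * inverse (1 + T s \<bullet> T s) = inverse ((1 + T s \<bullet> T s) powr (real CARD('n) / 2 + 1))" for s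
  proof -
    have "c s ^ CARD('n) = inverse ((1 + T s \<bullet> T s) powr (real CARD('n) / 2))"
      using pos[of s] powr_power[of "1 + T s \<bullet> T s" "1/2" "CARD('n)"]
      by (simp add: c_def power_inverse powr_half_sqrt)
    then show ?thesis using pos[of s] by (simp add: powr_add)
  qed
  have det: "\<bar>det (matrix (g' s))\<bar> = \<bar>det (matrix T)\<bar> / (1 + T s \<bullet> T s) powr (real CARD('n) / 2 + 1)" for s
  proof -
    have "matrix (g' s) = matrix ((*\<^sub>R) (c s)) ** (matrix (R s) ** matrix T)"
      unfolding g'_def
      by (simp only: matrix_compose[OF linear_compose[OF T(1) linR] linear_scale_self] matrix_compose[OF T(1) linR])
    then have "det (matrix (g' s)) = c s ^ CARD('n) * ((1 - gnomonic (T s) \<bullet> gnomonic (T s)) * det (matrix T))"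
      using det_identity_minus_rank_one[of "gnomonic (T s)"]
      by (simp add: det_mul det_matrix_scaleR R_def[abs_def])
    also have "\<dots> = (c s ^ CARD('n) * inverse (1 + T s \<bullet> T s)) * det (matrix T)"
      by (simp add: inner_gnomonic)
    also have "\<dots> = inverse ((1 + T s \<bullet> T s) powr (real CARD('n) / 2 + 1)) * det (matrix T)"
      by (simp only: cpow)
    finally show ?thesis by (simp only: abs_mult abs_inverse abs_of_nonneg[OF powr_ge_zero] divide_inverse mult.commute)
  qed
  have "surj T" using T by (simp add: linear_injective_imp_surjective)
  then have im: "(gnomonic \<circ> T) ` UNIV = ball 0 1" by (metis image_comp range_gnomonic)
  have "emeasure lborel ((gnomonic \<circ> T) ` UNIV) = (\<integral>\<^sup>+s\<in>UNIV. ennreal \<bar>det (matrix (g' s))\<bar> \<partial>lborel)"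
  proof (rule emeasure_differentiable_image)
    show "(gnomonic \<circ> T has_derivative g' s) (at s within UNIV)" for s
    proof -
      have "(T has_derivative T) (at s)"
        using T(1) by (simp add: bounded_linear_imp_has_derivative flip: linear_conv_bounded_linear)
      from has_derivative_compose[OF this has_derivative_gnomonic]
      show ?thesis by (simp add: g'_def R_def[abs_def] c_def o_def)
    qed
    show "inj_on (gnomonic \<circ> T) UNIV" using inj_gnomonic T(2) by (rule inj_compose)
    have "continuous_on UNIV (\<lambda>s. \<bar>det (matrix T)\<bar> / (1 + T s \<bullet> T s) powr (real CARD('n) / 2 + 1))"
      using T(1) pos by (intro continuous_intros linear_continuous_on)
        (auto simp: linear_conv_bounded_linear less_imp_neq[symmetric] add_pos_nonneg)
    then show "(\<lambda>s. \<bar>det (matrix (g' s))\<bar> * indicator UNIV s) \<in> borel_measurable borel"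
      by (simp add: det borel_measurable_continuous_onI)
    show "(gnomonic \<circ> T) ` UNIV \<in> sets borel" unfolding im by simp
  qed simp
  then show ?thesis unfolding im by (simp add: det)
qed

lemma integral_ball_kernel:
  fixes T :: "real^'n \<Rightarrow> real^'n"
  assumes T: "linear T" "inj T"
  defines "k \<equiv> \<lambda>s. \<bar>det (matrix T)\<bar> / (1 + T s \<bullet> T s) powr (real CARD('n) / 2 + 1)"
  shows "integrable lborel k" "integral\<^sup>L lborel k = measure lborel (ball (0 :: real^'n) 1)"
proof -
  have k: "k \<in> borel_measurable borel"
    unfolding k_def using T(1)
    by (intro borel_measurable_continuous_onI continuous_intros linear_continuous_on)
       (auto simp: linear_conv_bounded_linear add_pos_nonneg less_imp_neq[symmetric])
  have nn: "(\<integral>\<^sup>+s. ennreal (k s) \<partial>lborel) = ennreal (measure lborel (ball (0 :: real^'n) 1))"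
    unfolding k_def nn_integral_ball_kernel[OF T]
    by (rule emeasure_eq_ennreal_measure) (use emeasure_lborel_ball_finite[of "0 :: real^'n" 1] in auto)
  have pos: "0 \<le> k s" for s by (simp add: k_def)
  show "integrable lborel k" using k nn pos by (intro integrableI_nn_integral_finite) auto
  show "integral\<^sup>L lborel k = measure lborel (ball (0 :: real^'n) 1)"
    using k nn pos by (subst integral_eq_nn_integral) auto
qed

text \<open>Difference quotients integrate to \<open>0\<close> because Lebesgue measure is translation
  invariant, and they converge boundedly to the derivative.\<close>

lemma integral_directional_derivative_eq_0:
  fixes w :: "'a::euclidean_space \<Rightarrow> real"
  assumes der: "\<And>x. (w has_derivative w' x) (at x)" and bound: "\<And>x. \<bar>w' x e\<bar> \<le> B"
    and supp: "\<And>x. norm x > R \<Longrightarrow> w x = 0"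
  shows "integrable lborel (\<lambda>x. w' x e)" "(\<integral>x. w' x e \<partial>lborel) = 0"
proof -
  define d where "d k = inverse (real (Suc k))" for k
  define q where "q k x = (w (x + d k *\<^sub>R e) - w x) / d k" for k x
  have d: "d k > 0" "d k \<le> 1" for k by (simp_all add: d_def field_simps)
  have d0: "d \<longlonglongrightarrow> 0" unfolding d_def by (rule LIMSEQ_inverse_real_of_nat)
  have contw: "continuous_on UNIV w"
    using der by (intro continuous_at_imp_continuous_on) (auto intro: has_derivative_continuous)
  have [measurable]: "w \<in> borel_measurable borel" using contw by (rule borel_measurable_continuous_onI)
  have line: "((\<lambda>t. w (x + t *\<^sub>R e)) has_real_derivative w' (x + t *\<^sub>R e) e) (at t)" for x t
  proof -
    have "((\<lambda>t. x + t *\<^sub>R e) has_derivative (\<lambda>h. h *\<^sub>R e)) (at t)" by (auto intro!: derivative_eq_intros)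
    from has_derivative_compose[OF this der]
    have "((\<lambda>t. w (x + t *\<^sub>R e)) has_derivative (\<lambda>h. w' (x + t *\<^sub>R e) (h *\<^sub>R e))) (at t)" .
    moreover have "linear (w' (x + t *\<^sub>R e))" using der has_derivative_linear by blast
    ultimately show ?thesis by (simp add: has_field_derivative_def linear_cmul mult_commute_abs)
  qed
  have q_bound: "\<bar>q k x\<bar> \<le> B * indicator (cball 0 (R + norm e)) x" for k x
  proof (cases "x \<in> cball 0 (R + norm e)")
    case True
    obtain t where "w (x + d k *\<^sub>R e) - w (x + 0 *\<^sub>R e) = (d k - 0) * w' (x + t *\<^sub>R e) e"
      using MVT2[OF d(1)[of k] line[of x]] by blast
    then have "q k x = w' (x + t *\<^sub>R e) e" using d(1)[of k] by (simp add: q_def)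
    then show ?thesis using True bound by simp
  next
    case False
    then have x: "norm x > R + norm e" by simp
    have "norm (d k *\<^sub>R e) \<le> norm e" using d[of k] by (simp add: mult_left_le_one_le)
    then have "norm (x + d k *\<^sub>R e) > R"
      using x norm_triangle_ineq4[of "x + d k *\<^sub>R e" "d k *\<^sub>R e"] by simp
    moreover have "norm x > R" using x norm_ge_zero[of e] by linarith
    ultimately show ?thesis using supp False by (simp add: q_def)
  qed
  have lim: "(\<lambda>k. q k x) \<longlonglongrightarrow> w' x e" for x
  proof -
    have "((\<lambda>h. (w (x + h *\<^sub>R e) - w x) / h) \<longlongrightarrow> w' x e) (at 0)"
      using line[of x 0] by (simp add: DERIV_def)
    moreover have "filterlim d (at 0) sequentially"
      using d0 d(1) by (auto intro!: filterlim_atI always_eventually less_imp_neq[symmetric])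
    ultimately show ?thesis unfolding q_def by (rule filterlim_compose)
  qed
  have intw: "integrable lborel w"
  proof -
    have "integrable lborel (\<lambda>x. indicator (cball 0 R) x *\<^sub>R w x)"
      using contw by (intro borel_integrable_compact) (auto intro: continuous_on_subset)
    moreover have "(\<lambda>x. indicator (cball 0 R) x *\<^sub>R w x) = w"
      using supp by (auto simp: indicator_def fun_eq_iff)
    ultimately show ?thesis by metis
  qed
  have shift: "integrable lborel (\<lambda>x. w (x + v))" "(\<integral>x. w (x + v) \<partial>lborel) = integral\<^sup>L lborel w" for v
  proof -
    have eq: "distr lborel borel ((+) v) = lborel" by (rule lborel_distr_plus)
    have "integrable (distr lborel borel ((+) v)) w" using intw by (simp add: eq)
    then show "integrable lborel (\<lambda>x. w (x + v))" by (subst (asm) integrable_distr_eq) (auto simp: add.commute)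
    have "integral\<^sup>L (distr lborel borel ((+) v)) w = (\<integral>x. w (v + x) \<partial>lborel)"
      by (rule integral_distr) auto
    then show "(\<integral>x. w (x + v) \<partial>lborel) = integral\<^sup>L lborel w" by (simp add: eq add.commute)
  qed
  have q0: "integral\<^sup>L lborel (q k) = 0" for k
    unfolding q_def by (simp add: shift intw)
  have meas_q: "q k \<in> borel_measurable lborel" for k unfolding q_def by measurable
  then have meas: "(\<lambda>x. w' x e) \<in> borel_measurable lborel"
    by (rule borel_measurable_LIMSEQ_real[OF lim])
  have dom: "integrable lborel (\<lambda>x :: 'a. B * indicator (cball 0 (R + norm e)) x)"
    by (intro integrable_mult_right integrable_real_indicator) (use emeasure_lborel_cball_finite[of "0 :: 'a" "R + norm e"] in auto)
  note dc = meas meas_q dom AE_I2[OF lim] AE_I2[OF q_bound[folded real_norm_def]]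
  show "integrable lborel (\<lambda>x. w' x e)" by (rule integrable_dominated_convergence[OF dc])
  have "(\<lambda>k. integral\<^sup>L lborel (q k)) \<longlonglongrightarrow> (\<integral>x. w' x e \<partial>lborel)"
    by (rule integral_dominated_convergence[OF dc])
  then show "(\<integral>x. w' x e \<partial>lborel) = 0" by (simp add: q0 LIMSEQ_const_iff)
qed

text \<open>The extension of \<open>w\<close> by \<open>0\<close> is differentiable everywhere, since
  \<open>U\<close> and the complement of \<open>K\<close> are open and cover the space.\<close>

lemma integral_fderiv_compact_support_eq_0:
  fixes w :: "'a::euclidean_space \<Rightarrow> real"
  assumes U: "open U" and K: "compact K" "K \<subseteq> U" and w: "C1_on U w"
    and supp: "\<And>u. u \<in> U - K \<Longrightarrow> w u = 0"
  shows "integrable lborel (\<lambda>u. indicator U u * fderiv w u e)"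
    "(\<integral>u. indicator U u * fderiv w u e \<partial>lborel) = 0"
proof -
  define W where "W x = (if x \<in> U then w x else 0)" for x
  define W' where "W' x = (if x \<in> U then fderiv w x else (\<lambda>_. 0))" for x
  have zero: "((\<lambda>_. 0) has_derivative (\<lambda>_. 0)) (at x)" for x :: 'a by simp
  have openK: "open (- K)" using K(1) by (simp add: compact_imp_closed open_Compl)
  have W'0: "W' x = (\<lambda>_. 0)" if "x \<notin> K" for x
  proof (cases "x \<in> U")
    case True
    have "(w has_derivative (\<lambda>_. 0)) (at x)"
      by (rule has_derivative_transform_within_open[OF zero, of "U - K"])
         (use U openK that True supp in \<open>auto simp: Diff_eq\<close>)
    then show ?thesis using True by (simp add: W'_def fderiv_eq)
  qed (simp add: W'_def)
  have der: "(W has_derivative W' x) (at x)" for x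
  proof (cases "x \<in> U")
    case True
    have "(W has_derivative fderiv w x) (at x)"
      by (rule has_derivative_transform_within_open[OF C1_on_has_derivative[OF w True] U True]) (simp add: W_def)
    then show ?thesis using True by (simp add: W'_def)
  next
    case False
    then have x: "x \<in> - K" using K by auto
    have "(W has_derivative (\<lambda>_. 0)) (at x)"
      by (rule has_derivative_transform_within_open[OF zero openK x]) (use supp in \<open>auto simp: W_def\<close>)
    then show ?thesis using x by (simp add: W'0)
  qed
  have "compact ((\<lambda>x. fderiv w x e) ` K)"
    using C1_on_continuous_fderiv[OF w] K by (intro compact_continuous_image) (auto intro: continuous_on_subset)
  then have "bounded ((\<lambda>x. fderiv w x e) ` K)" by (rule compact_imp_bounded)
  then obtain B where B: "\<And>x. x \<in> K \<Longrightarrow> \<bar>fderiv w x e\<bar> \<le> B"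
    unfolding bounded_iff by auto
  have bound: "\<bar>W' x e\<bar> \<le> max B 0" for x
    using B[of x] K(2) W'0[of x] by (cases "x \<in> K") (auto simp: W'_def)
  obtain R where R: "\<And>x. x \<in> K \<Longrightarrow> norm x \<le> R"
    using compact_imp_bounded[OF K(1)] unfolding bounded_iff by blast
  have sup: "W x = 0" if "norm x > R" for x
    using R[of x] supp[of x] that by (auto simp: W_def)
  have eq: "W' x e = indicator U x * fderiv w x e" for x by (simp add: W'_def)
  show "integrable lborel (\<lambda>u. indicator U u * fderiv w u e)"
    "(\<integral>u. indicator U u * fderiv w u e \<partial>lborel) = 0"
    using integral_directional_derivative_eq_0[OF der bound sup] by (simp_all add: eq)
qed

section \<open>The volume measure of a closed immersed manifold\<close>

lemma metric_matrix_eq_gram: "metric_matrix c f u = gram (fderiv (local_rep c f) u)"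
  by (simp add: metric_matrix_def gram_def)

locale closed_immersion =
  fixes A :: "('m::{t2_space, second_countable_topology}, 'n::finite) chart set"
    and f :: "'m \<Rightarrow> real ^ 'k::finite"
  assumes atlas: "smooth_atlas A"
    and compact_M: "compact (UNIV :: 'm set)"
    and immersion: "smooth_immersion A f"
begin

abbreviation volume_density :: "('m, 'n) chart \<Rightarrow> real ^ 'n \<Rightarrow> real" where
  "volume_density c u \<equiv> sqrt (det (metric_matrix c f u))"

abbreviation transition :: "('m, 'n) chart \<Rightarrow> ('m, 'n) chart \<Rightarrow> real ^ 'n \<Rightarrow> real ^ 'n" where
  "transition c d u \<equiv> coord d (coord_inv c u)"

abbreviation dV :: "'m measure" where
  "dV \<equiv> volume_measure A f"

lemma open_cdom: "c \<in> A \<Longrightarrow> open (cdom c)"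
  and open_cimg: "c \<in> A \<Longrightarrow> open (cimg c)"
  and chart_homeomorphism: "c \<in> A \<Longrightarrow> homeomorphism (cdom c) (cimg c) (coord c) (coord_inv c)"
  and cover: "\<exists>c\<in>A. x \<in> cdom c"
  and smooth_transition: "c \<in> A \<Longrightarrow> d \<in> A \<Longrightarrow>
    smooth_on (coord c ` (cdom c \<inter> cdom d)) (transition c d)"
  using atlas unfolding smooth_atlas_def o_def by blast+

lemma continuous_coord: "c \<in> A \<Longrightarrow> continuous_on (cdom c) (coord c)"
  and continuous_coord_inv: "c \<in> A \<Longrightarrow> continuous_on (cimg c) (coord_inv c)"
  and coord_inv_coord: "c \<in> A \<Longrightarrow> x \<in> cdom c \<Longrightarrow> coord_inv c (coord c x) = x"
  and coord_coord_inv: "c \<in> A \<Longrightarrow> u \<in> cimg c \<Longrightarrow> coord c (coord_inv c u) = u"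
  and coord_in_cimg: "x \<in> cdom c \<Longrightarrow> coord c x \<in> cimg c"
  and coord_inv_in_cdom: "c \<in> A \<Longrightarrow> u \<in> cimg c \<Longrightarrow> coord_inv c u \<in> cdom c"
  using chart_homeomorphism[of c] by (auto simp: homeomorphism_def cimg_def)

lemma coord_image_eq_vimage:
  assumes "c \<in> A" "X \<subseteq> cdom c"
  shows "coord c ` X = cimg c \<inter> coord_inv c -` X"
  using assms coord_coord_inv[OF assms(1)]
  by (auto simp: image_iff coord_inv_coord coord_in_cimg subset_iff) (metis)

lemma coord_inv_image_eq_vimage:
  assumes "c \<in> A" "X \<subseteq> cimg c"
  shows "coord_inv c ` X = cdom c \<inter> coord c -` X"
  using assms coord_inv_coord[OF assms(1)]
  by (auto simp: image_iff coord_coord_inv coord_inv_in_cdom subset_iff) (metis)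

lemma open_coord_image:
  assumes "c \<in> A" "open X" "X \<subseteq> cdom c"
  shows "open (coord c ` X)"
  unfolding coord_image_eq_vimage[OF assms(1,3)]
  by (rule continuous_open_preimage[OF continuous_coord_inv open_cimg]) (use assms in auto)

lemma open_coord_inv_image:
  assumes "c \<in> A" "open X" "X \<subseteq> cimg c"
  shows "open (coord_inv c ` X)"
  unfolding coord_inv_image_eq_vimage[OF assms(1,3)]
  by (rule continuous_open_preimage[OF continuous_coord open_cdom]) (use assms in auto)

lemma continuous_preimage_borel:
  fixes g :: "'a::topological_space \<Rightarrow> 'b::topological_space"
  assumes "open S" "continuous_on S g" "X \<in> sets borel"
  shows "S \<inter> g -` X \<in> sets borel"
proof -
  have "g \<in> measurable (restrict_space borel S) borel"
    using assms(2) by (rule borel_measurable_continuous_on_restrict)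
  from measurable_sets[OF this assms(3)] show ?thesis
    using assms(1) by (simp add: sets_restrict_space space_restrict_space) (auto simp: Int_commute)
qed

lemma coord_image_borel:
  assumes "c \<in> A" "X \<in> sets borel" "X \<subseteq> cdom c"
  shows "coord c ` X \<in> sets borel"
  unfolding coord_image_eq_vimage[OF assms(1,3)]
  by (rule continuous_preimage_borel[OF open_cimg continuous_coord_inv]) (use assms in auto)

lemma coord_inv_image_borel:
  assumes "c \<in> A" "X \<in> sets borel" "X \<subseteq> cimg c"
  shows "coord_inv c ` X \<in> sets borel"
  unfolding coord_inv_image_eq_vimage[OF assms(1,3)]
  by (rule continuous_preimage_borel[OF open_cdom continuous_coord]) (use assms in auto)

subsection \<open>The immersion in two charts\<close>

lemma smooth_local_rep: "c \<in> A \<Longrightarrow> smooth_on (cimg c) (local_rep c f)"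
  and inj_fderiv_local_rep: "c \<in> A \<Longrightarrow> u \<in> cimg c \<Longrightarrow> inj (fderiv (local_rep c f) u)"
  using immersion unfolding smooth_immersion_def by blast+

lemma C1_local_rep: "c \<in> A \<Longrightarrow> C1_on (cimg c) (local_rep c f)"
  using smooth_local_rep by (rule smooth_on_C1)

lemma C1_fderiv_local_rep: "c \<in> A \<Longrightarrow> C1_on (cimg c) (\<lambda>u. fderiv (local_rep c f) u v)"
  using smooth_local_rep by (rule smooth_on_C1_fderiv)

lemma linear_fderiv_local_rep: "c \<in> A \<Longrightarrow> u \<in> cimg c \<Longrightarrow> linear (fderiv (local_rep c f) u)"
  using C1_local_rep[of c] by (auto intro: fderiv_linear)

lemma continuous_f: "continuous_on UNIV f"
proof (rule continuous_at_imp_continuous_on, rule ballI)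
  fix x
  obtain c where c: "c \<in> A" "x \<in> cdom c" using cover by blast
  have "continuous_on (cdom c) (\<lambda>y. local_rep c f (coord c y))"
    by (rule continuous_on_compose2[OF C1_on_continuous[OF C1_local_rep[OF c(1)]] continuous_coord[OF c(1)]])
       (auto simp: coord_in_cimg)
  then have "continuous_on (cdom c) f"
    by (rule continuous_on_eq) (simp add: local_rep_def coord_inv_coord c)
  then show "isCont f x" using c open_cdom by (simp add: continuous_on_eq_continuous_at)
qed

lemma metric_pos: "c \<in> A \<Longrightarrow> u \<in> cimg c \<Longrightarrow> det (metric_matrix c f u) > 0"
  unfolding metric_matrix_eq_gram by (intro det_gram_pos linear_fderiv_local_rep inj_fderiv_local_rep)

lemma C1_metric: "c \<in> A \<Longrightarrow> C1_on (cimg c) (\<lambda>u. metric_matrix c f u $ i $ j)"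
  unfolding metric_matrix_eq_gram gram_component by (intro C1_on_inner C1_fderiv_local_rep)

lemma C1_volume_density: "c \<in> A \<Longrightarrow> C1_on (cimg c) (volume_density c)"
  by (intro C1_on_sqrt C1_on_det C1_metric metric_pos)

lemma open_overlap: "c \<in> A \<Longrightarrow> d \<in> A \<Longrightarrow> open (coord c ` (cdom c \<inter> cdom d))"
  by (rule open_coord_image) (auto intro: open_cdom)

lemma overlap_subset: "coord c ` (cdom c \<inter> cdom d) \<subseteq> cimg c"
  by (auto simp: cimg_def)

lemma transition_in_cimg:
  "c \<in> A \<Longrightarrow> u \<in> coord c ` (cdom c \<inter> cdom d) \<Longrightarrow> transition c d u \<in> cimg d"
  by (auto simp: coord_inv_coord coord_in_cimg)

lemma transition_C1: "c \<in> A \<Longrightarrow> d \<in> A \<Longrightarrow> C1_on (coord c ` (cdom c \<inter> cdom d)) (transition c d)"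
  using smooth_transition by (rule smooth_on_C1)

text \<open>The chain rule for the local representatives of a function in two charts.\<close>

lemma fderiv_chart_change:
  fixes \<eta> :: "'m \<Rightarrow> 'b::euclidean_space"
  assumes c: "c \<in> A" "d \<in> A" and u: "u \<in> coord c ` (cdom c \<inter> cdom d)"
    and diff: "(\<eta> \<circ> coord_inv d) differentiable (at (transition c d u))"
  shows "fderiv (\<eta> \<circ> coord_inv c) u v = fderiv (\<eta> \<circ> coord_inv d) (transition c d u) (fderiv (transition c d) u v)"
proof -
  have "fderiv (\<eta> \<circ> coord_inv c) u v = fderiv (\<lambda>u. (\<eta> \<circ> coord_inv d) (transition c d u)) u v"
    by (subst fderiv_cong_open[OF open_overlap[OF c] u, of _ "\<lambda>u. (\<eta> \<circ> coord_inv d) (transition c d u)"])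
       (auto simp: coord_inv_coord c)
  also have "\<dots> = fderiv (\<eta> \<circ> coord_inv d) (transition c d u) (fderiv (transition c d) u v)"
    by (rule fderiv_compose) (use transition_C1[OF c] u diff in \<open>auto simp: o_def\<close>)
  finally show ?thesis .
qed

lemma fderiv_local_rep_chart_change:
  assumes c: "c \<in> A" "d \<in> A" and u: "u \<in> coord c ` (cdom c \<inter> cdom d)"
  shows "fderiv (local_rep c f) u = fderiv (local_rep d f) (transition c d u) \<circ> fderiv (transition c d) u"
  using fderiv_chart_change[OF c u, of f] C1_local_rep[OF c(2)] transition_in_cimg[OF c(1) u]
  by (auto simp: local_rep_def)

lemma volume_density_chart_change:
  assumes c: "c \<in> A" "d \<in> A" and u: "u \<in> coord c ` (cdom c \<inter> cdom d)"
  shows "volume_density c u = \<bar>det (matrix (fderiv (transition c d) u))\<bar> * volume_density d (transition c d u)"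
  unfolding metric_matrix_eq_gram fderiv_local_rep_chart_change[OF c u]
  by (rule sqrt_det_gram_compose)
     (use transition_in_cimg[OF c(1) u] transition_C1[OF c] u
       in \<open>auto intro: linear_fderiv_local_rep inj_fderiv_local_rep fderiv_linear c\<close>)

text \<open>The two charts assign the same volume to a set in the overlap of their domains, because the
  densities differ by the Jacobian of the transition map.\<close>

lemma nn_integral_density_chart_change:
  assumes c: "c \<in> A" "d \<in> A" and B: "B \<in> sets borel" "B \<subseteq> cdom c \<inter> cdom d"
  shows "(\<integral>\<^sup>+u\<in>coord d ` B. ennreal (volume_density d u) \<partial>lborel)
    = (\<integral>\<^sup>+u\<in>coord c ` B. ennreal (volume_density c u) \<partial>lborel)"
proof -
  let ?S = "coord c ` B" and ?O = "coord c ` (cdom c \<inter> cdom d)"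
  define h where "h u = ennreal (indicator (cimg d) u *\<^sub>R volume_density d u)" for u
  have SO: "?S \<subseteq> ?O" using B by auto
  have im: "transition c d ` ?S = coord d ` B"
    using B c by (auto simp: image_image coord_inv_coord subset_iff intro!: image_cong)
  have Bd: "coord d ` B \<subseteq> cimg d" using B by (auto simp: cimg_def)
  have "(\<integral>\<^sup>+u\<in>coord d ` B. ennreal (volume_density d u) \<partial>lborel) = (\<integral>\<^sup>+u\<in>transition c d ` ?S. h u \<partial>lborel)"
    unfolding im using Bd by (intro nn_integral_cong) (auto simp: h_def indicator_def)
  also have "\<dots> = (\<integral>\<^sup>+u\<in>?S. ennreal \<bar>det (matrix (fderiv (transition c d) u))\<bar> * h (transition c d u) \<partial>lborel)"
  proof (rule nn_integral_change_of_variables)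
    show "?S \<in> sets borel" using B c by (intro coord_image_borel) auto
    show "transition c d ` X \<in> sets borel" if "X \<in> sets borel" "X \<subseteq> ?S" for X
    proof -
      have X: "X \<subseteq> cimg c" using that B by (auto simp: cimg_def)
      have "coord_inv c ` X \<in> sets borel" by (rule coord_inv_image_borel[OF c(1) that(1) X])
      moreover have "coord_inv c ` X \<subseteq> cdom d"
        using that(2) B(2) c by (auto simp: subset_iff coord_inv_coord image_iff)
      ultimately have "coord d ` (coord_inv c ` X) \<in> sets borel" by (rule coord_image_borel[OF c(2)])
      then show ?thesis by (simp add: image_image)
    qed
    show "(transition c d has_derivative fderiv (transition c d) u) (at u within ?S)" if "u \<in> ?S" for u
      by (rule has_derivative_at_withinI[OF C1_on_has_derivative[OF transition_C1[OF c]]]) (use that SO in blast)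
    show "inj_on (transition c d) ?S"
    proof (rule inj_onI)
      fix u v assume "u \<in> ?S" "v \<in> ?S" "transition c d u = transition c d v"
      then obtain x y where "u = coord c x" "v = coord c y" "x \<in> B" "y \<in> B" "coord d x = coord d y"
        using B c by (auto simp: coord_inv_coord subset_iff)
      then show "u = v" using B(2) coord_inv_coord[OF c(2)] by (metis IntD2 subsetD)
    qed
    have "continuous_on ?O (\<lambda>u. det (matrix (fderiv (transition c d) u)))"
    proof -
      have "continuous_on ?O (\<lambda>u. fderiv (transition c d) u (axis j 1) $ i)" for i j
        by (intro continuous_intros C1_on_continuous_fderiv transition_C1 c)
      then show ?thesis
        unfolding det_def matrix_def vec_lambda_beta
        by (intro continuous_on_sum continuous_on_mult continuous_on_const continuous_on_prod)
    qed
    then show "continuous_on ?S (\<lambda>u. det (matrix (fderiv (transition c d) u)))"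
      using SO by (rule continuous_on_subset)
    have "(\<lambda>u. indicator (cimg d) u *\<^sub>R volume_density d u) \<in> borel_measurable borel"
      using open_cimg[OF c(2)] C1_on_continuous[OF C1_volume_density[OF c(2)]]
      by (intro borel_measurable_continuous_on_indicator) auto
    then show "h \<in> borel_measurable borel" unfolding h_def[abs_def] by measurable
  qed
  also have "\<dots> = (\<integral>\<^sup>+u\<in>?S. ennreal (volume_density c u) \<partial>lborel)"
  proof (intro nn_integral_cong)
    fix u
    show "ennreal \<bar>det (matrix (fderiv (transition c d) u))\<bar> * h (transition c d u) * indicator ?S u
      = ennreal (volume_density c u) * indicator ?S u"
    proof (cases "u \<in> ?S")
      case True
      then have u: "u \<in> ?O" using SO by auto
      show ?thesis
        using transition_in_cimg[OF c(1) u]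
        by (simp add: h_def volume_density_chart_change[OF c u] ennreal_mult')
    qed simp
  qed
  finally show ?thesis .
qed

subsection \<open>Existence and uniqueness\<close>

text \<open>The value off the image of the chart is arbitrary but constant, which keeps the map Borel
  measurable; the density used below vanishes there.\<close>

definition total_coord_inv :: "('m, 'n) chart \<Rightarrow> real ^ 'n \<Rightarrow> 'm" where
  "total_coord_inv c u = (if u \<in> cimg c then coord_inv c u else undefined)"

definition chart_measure :: "('m, 'n) chart \<Rightarrow> 'm measure" where
  "chart_measure c =
    distr (density lborel (\<lambda>u. ennreal (indicator (cimg c) u * volume_density c u))) borel (total_coord_inv c)"

lemma measurable_total_coord_inv: "c \<in> A \<Longrightarrow> total_coord_inv c \<in> borel_measurable borel"
  unfolding total_coord_inv_def[abs_def] using open_cimg continuous_coord_inv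
  by (intro borel_measurable_continuous_on_if) auto

lemma measurable_volume_density:
  "c \<in> A \<Longrightarrow> (\<lambda>u. indicator (cimg c) u * volume_density c u) \<in> borel_measurable borel"
  using borel_measurable_continuous_on_indicator[OF _ C1_on_continuous[OF C1_volume_density[of c]]]
    open_cimg[of c] by simp

lemma sets_chart_measure [simp]: "sets (chart_measure c) = sets borel"
  by (simp add: chart_measure_def)

lemma emeasure_chart_measure:
  assumes c: "c \<in> A" and B: "B \<in> sets borel"
  shows "emeasure (chart_measure c) B = (\<integral>\<^sup>+u\<in>coord c ` (B \<inter> cdom c). ennreal (volume_density c u) \<partial>lborel)"
proof -
  note [measurable] = measurable_total_coord_inv[OF c] measurable_volume_density[OF c] B
  have m: "total_coord_inv c -` B \<in> sets borel"
    using measurable_sets[OF measurable_total_coord_inv[OF c] B] by simp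
  have "emeasure (chart_measure c) B
    = (\<integral>\<^sup>+u\<in>total_coord_inv c -` B. ennreal (indicator (cimg c) u * volume_density c u) \<partial>lborel)"
    unfolding chart_measure_def using m by (simp add: emeasure_distr emeasure_density)
  also have "\<dots> = (\<integral>\<^sup>+u\<in>coord c ` (B \<inter> cdom c). ennreal (volume_density c u) \<partial>lborel)"
    unfolding coord_image_eq_vimage[OF c Int_lower2]
    using coord_inv_in_cdom[OF c]
    by (intro nn_integral_cong) (auto simp: total_coord_inv_def indicator_def)
  finally show ?thesis .
qed

lemma emeasure_chart_measure_subset:
  assumes "c \<in> A" "B \<in> sets borel" "B \<subseteq> cdom c"
  shows "emeasure (chart_measure c) B = (\<integral>\<^sup>+u\<in>coord c ` B. ennreal (volume_density c u) \<partial>lborel)"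
  using emeasure_chart_measure[OF assms(1,2)] assms(3) by (simp add: Int_absorb2)

lemma chart_measure_unique:
  assumes "c \<in> A" "d \<in> A" "B \<in> sets borel" "B \<subseteq> cdom c \<inter> cdom d"
  shows "emeasure (chart_measure c) B = emeasure (chart_measure d) B"
  using nn_integral_density_chart_change[OF assms] assms
  by (simp add: emeasure_chart_measure_subset)

text \<open>The characterising property in the definition of the volume measure, with the chart integrals
  expressed as measures on the manifold.\<close>

definition represents_volume :: "'m measure \<Rightarrow> bool" where
  "represents_volume \<mu> \<longleftrightarrow> sets \<mu> = sets borel \<and>
     (\<forall>c\<in>A. \<forall>B\<in>sets borel. B \<subseteq> cdom c \<longrightarrow> emeasure \<mu> B = emeasure (chart_measure c) B)"

lemma volume_measure_eq_The: "dV = (THE \<mu>. represents_volume \<mu>)"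
  unfolding volume_measure_def represents_volume_def
  by (intro arg_cong[where f = The] ext) (auto simp: emeasure_chart_measure_subset)

lemma chart_partition:
  obtains N :: nat and cs :: "nat \<Rightarrow> ('m, 'n) chart" and D :: "nat \<Rightarrow> 'm set"
  where "\<And>i. i < N \<Longrightarrow> cs i \<in> A" "\<And>i. i < N \<Longrightarrow> D i \<subseteq> cdom (cs i)"
    "\<And>i. D i \<in> sets borel" "disjoint_family D" "(\<Union>i<N. D i) = UNIV"
proof -
  have "UNIV \<subseteq> \<Union>(cdom ` A)" using cover by auto
  then obtain C where C: "C \<subseteq> A" "finite C" "UNIV \<subseteq> \<Union>(cdom ` C)"
    using compactE_image[OF compact_M, of A cdom] open_cdom by metis
  obtain xs where xs: "set xs = C" using finite_list[OF C(2)] by blast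
  define E where "E i = (if i < length xs then cdom (xs ! i) else {})" for i
  have E: "E i \<in> sets borel" for i
    using xs C(1) open_cdom[of "xs ! i"] nth_mem[of i xs] by (cases "i < length xs") (auto simp: E_def)
  show ?thesis
  proof (rule that[of "length xs" "(!) xs" "disjointed E"])
    show "xs ! i \<in> A" if "i < length xs" for i using that xs C(1) by auto
    show "disjointed E i \<subseteq> cdom (xs ! i)" if "i < length xs" for i
      using disjointed_subset[of E i] that by (auto simp: E_def)
    show "disjointed E i \<in> sets borel" for i
      using E by (auto simp: disjointed_def)
    show "disjoint_family (disjointed E)" by (rule disjoint_family_disjointed)
    have "(\<Union>i<length xs. E i) = UNIV"
      using C(3) xs by (auto simp: E_def set_conv_nth subset_iff)
    then have "(\<Union>i. E i) = UNIV" by auto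
    then have all: "(\<Union>i. disjointed E i) = UNIV" by (simp add: UN_disjointed_eq)
    have empty: "disjointed E i = {}" if "\<not> i < length xs" for i
      using disjointed_subset[of E i] that by (auto simp: E_def)
    have "x \<in> (\<Union>i<length xs. disjointed E i)" for x
    proof -
      obtain i where "x \<in> disjointed E i" using all by blast
      then show ?thesis using empty[of i] by (cases "i < length xs") auto
    qed
    then show "(\<Union>i<length xs. disjointed E i) = UNIV" by blast
  qed
qed

lemma emeasure_partition:
  fixes D :: "nat \<Rightarrow> 'm set"
  assumes "sets \<mu> = sets borel" "B \<in> sets borel" "\<And>i. D i \<in> sets borel" "disjoint_family D" "(\<Union>i<N. D i) = UNIV"
  shows "emeasure \<mu> B = (\<Sum>i<N. emeasure \<mu> (B \<inter> D i))"
proof -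
  have "(\<Union>i<N. B \<inter> D i) = B" using assms(5) by blast
  moreover have "(\<Sum>i<N. emeasure \<mu> (B \<inter> D i)) = emeasure \<mu> (\<Union>i<N. B \<inter> D i)"
  proof (rule sum_emeasure)
    show "disjoint_family_on (\<lambda>i. B \<inter> D i) {..<N}"
      using assms(4) unfolding disjoint_family_on_def by blast
  qed (use assms in auto)
  ultimately show ?thesis by simp
qed

text \<open>Finitely many charts cover the compact manifold, and their domains can be cut down to disjoint
  Borel pieces. A measure is determined by its restrictions to the pieces, and summing the chart
  measures of the pieces defines one, by the agreement of the charts on overlaps.\<close>

lemma ex1_represents_volume: "\<exists>!\<mu>. represents_volume \<mu>"
proof -
  obtain N cs and D :: "nat \<Rightarrow> 'm set" where D: "\<And>i. i < N \<Longrightarrow> cs i \<in> A" "\<And>i. i < N \<Longrightarrow> D i \<subseteq> cdom (cs i)"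
    "\<And>i. D i \<in> sets borel" "disjoint_family D" "(\<Union>i<N. D i) = UNIV"
    by (rule chart_partition) blast
  define m where "m B = (\<Sum>i<N. emeasure (chart_measure (cs i)) (B \<inter> D i))" for B
  define \<mu> where "\<mu> = measure_of UNIV (sets (borel :: 'm measure)) m"
  have sets: "sets \<mu> = sets borel"
    unfolding \<mu>_def by (simp add: sets.sigma_sets_eq[of "borel :: 'm measure", simplified])
  have em: "emeasure \<mu> B = m B" if B: "B \<in> sets borel" for B
  proof (rule emeasure_measure_of[OF \<mu>_def])
    show "positive (sets \<mu>) m" by (simp add: positive_def m_def)
    show "countably_additive (sets \<mu>) m"
      unfolding countably_additive_def sets
    proof safe
      fix X :: "nat \<Rightarrow> 'm set"
      assume X: "range X \<subseteq> sets borel" "disjoint_family X"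
      have "(\<Sum>k. m (X k)) = (\<Sum>i<N. \<Sum>k. emeasure (chart_measure (cs i)) (X k \<inter> D i))"
        unfolding m_def by (rule suminf_sum) auto
      also have "\<dots> = (\<Sum>i<N. emeasure (chart_measure (cs i)) (\<Union>k. X k \<inter> D i))"
        using X D(3) by (intro sum.cong suminf_emeasure) (auto simp: disjoint_family_on_def)
      also have "\<dots> = m (\<Union>k. X k)" by (simp add: m_def)
      finally show "(\<Sum>k. m (X k)) = m (\<Union>k. X k)" .
    qed
  qed (use B sets in auto)
  have part: "m B = emeasure \<mu>' B" if "represents_volume \<mu>'" "B \<in> sets borel" for \<mu>' B
  proof -
    have "emeasure (chart_measure (cs i)) (B \<inter> D i) = emeasure \<mu>' (B \<inter> D i)" if "i < N" for i
    proof -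
      have "B \<inter> D i \<in> sets borel" "B \<inter> D i \<subseteq> cdom (cs i)" using D(2)[OF that] D(3) \<open>B \<in> sets borel\<close> by auto
      then show ?thesis using \<open>represents_volume \<mu>'\<close> D(1)[OF that] by (simp add: represents_volume_def)
    qed
    moreover have "emeasure \<mu>' B = (\<Sum>i<N. emeasure \<mu>' (B \<inter> D i))"
      using that D(3-5) by (intro emeasure_partition) (auto simp: represents_volume_def)
    ultimately show ?thesis by (simp add: m_def)
  qed
  have rep: "represents_volume \<mu>"
    unfolding represents_volume_def
  proof (intro conjI ballI impI)
    fix c B assume c: "c \<in> A" and B: "B \<in> sets borel" "B \<subseteq> cdom c"
    have "emeasure (chart_measure c) B = (\<Sum>i<N. emeasure (chart_measure c) (B \<inter> D i))"
      by (rule emeasure_partition[OF _ B(1) D(3-5)]) simp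
    also have "\<dots> = m B"
      unfolding m_def
    proof (rule sum.cong)
      fix i assume i: "i \<in> {..<N}"
      show "emeasure (chart_measure c) (B \<inter> D i) = emeasure (chart_measure (cs i)) (B \<inter> D i)"
        using i D(1,2)[of i] D(3)[of i] B c by (intro chart_measure_unique) auto
    qed simp
    finally show "emeasure \<mu> B = emeasure (chart_measure c) B" by (simp add: em B)
  qed (rule sets)
  show ?thesis
  proof (rule ex1I[where P = represents_volume, OF rep])
    fix \<mu>' assume r: "represents_volume \<mu>'"
    show "\<mu>' = \<mu>"
      by (rule measure_eqI) (use r sets part[OF r] em in \<open>auto simp: represents_volume_def\<close>)
  qed
qed

lemma represents_volume_dV: "represents_volume dV"
  unfolding volume_measure_eq_The by (rule theI'[OF ex1_represents_volume])

lemma sets_dV [simp, measurable_cong]: "sets dV = sets borel"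
  using represents_volume_dV by (simp add: represents_volume_def)

lemma space_dV [simp]: "space dV = UNIV"
  using sets_eq_imp_space_eq[OF sets_dV] by simp

lemma emeasure_dV_chart:
  "c \<in> A \<Longrightarrow> B \<in> sets borel \<Longrightarrow> B \<subseteq> cdom c \<Longrightarrow> emeasure dV B = emeasure (chart_measure c) B"
  using represents_volume_dV by (simp add: represents_volume_def)

text \<open>On a chart domain the volume measure is the push-forward of a density on Euclidean space; this
  turns integrals over the manifold into Lebesgue integrals.\<close>

lemma density_dV_chart:
  assumes c: "c \<in> A"
  shows "density dV (\<lambda>x. ennreal (indicator (cdom c) x)) = chart_measure c"
proof (rule measure_eqI)
  fix B assume "B \<in> sets (density dV (\<lambda>x. ennreal (indicator (cdom c) x)))"
  then have B: "B \<in> sets borel" by simp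
  have m: "cdom c \<in> sets borel" using open_cdom[OF c] by simp
  have "emeasure (density dV (\<lambda>x. ennreal (indicator (cdom c) x))) B = emeasure dV (cdom c \<inter> B)"
    using B m by (simp add: emeasure_density ennreal_indicator flip: indicator_inter_arith)
  also have "\<dots> = emeasure (chart_measure c) (cdom c \<inter> B)"
    using B m by (intro emeasure_dV_chart c) auto
  also have "\<dots> = emeasure (chart_measure c) B"
  proof -
    have "cdom c \<inter> B \<inter> cdom c = B \<inter> cdom c" by auto
    then show ?thesis using B m by (simp add: emeasure_chart_measure[OF c])
  qed
  finally show "emeasure (density dV (\<lambda>x. ennreal (indicator (cdom c) x))) B = emeasure (chart_measure c) B" .
qed simp

lemma
  fixes g :: "'m \<Rightarrow> real"
  assumes c: "c \<in> A" and g: "g \<in> borel_measurable borel" and supp: "\<And>x. x \<notin> cdom c \<Longrightarrow> g x = 0"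
  shows integrable_chart:
      "integrable dV g \<longleftrightarrow> integrable lborel (\<lambda>u. indicator (cimg c) u * (volume_density c u * g (coord_inv c u)))"
    and integral_chart:
      "integral\<^sup>L dV g = (\<integral>u. indicator (cimg c) u * (volume_density c u * g (coord_inv c u)) \<partial>lborel)"
proof -
  note [measurable] = measurable_total_coord_inv[OF c] measurable_volume_density[OF c] g
  have m: "(indicator (cdom c) :: 'm \<Rightarrow> real) \<in> borel_measurable dV"
    using open_cdom[OF c] by (intro borel_measurable_indicator) simp
  have g_eq: "(\<lambda>x. indicator (cdom c) x * g x) = g" using supp by (auto simp: indicator_def fun_eq_iff)
  have h_eq: "(indicator (cimg c) u * volume_density c u) *\<^sub>R g (total_coord_inv c u)
    = indicator (cimg c) u * (volume_density c u * g (coord_inv c u))" for u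
    by (simp add: total_coord_inv_def indicator_def)
  have nonneg: "AE u in lborel. 0 \<le> indicator (cimg c) u * volume_density c u"
    using metric_pos[OF c] by (auto simp: indicator_def less_imp_le)
  let ?\<rho> = "\<lambda>u. indicator (cimg c) u * volume_density c u"
  have mg: "(\<lambda>u. g (total_coord_inv c u)) \<in> borel_measurable lborel" by measurable
  have m\<rho>: "?\<rho> \<in> borel_measurable lborel" by measurable
  have "integrable dV g \<longleftrightarrow> integrable (chart_measure c) g"
    unfolding density_dV_chart[OF c, symmetric]
    by (subst integrable_density) (use m g in \<open>auto simp: g_eq measurable_cong_sets[OF sets_dV refl]\<close>)
  also have "\<dots> \<longleftrightarrow> integrable lborel (\<lambda>u. indicator (cimg c) u * (volume_density c u * g (coord_inv c u)))"
    unfolding chart_measure_def h_eq[symmetric]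
    using integrable_density[OF mg m\<rho> nonneg] by (subst integrable_distr_eq) auto
  finally show "integrable dV g \<longleftrightarrow> integrable lborel (\<lambda>u. indicator (cimg c) u * (volume_density c u * g (coord_inv c u)))" .
  have "integral\<^sup>L dV g = integral\<^sup>L (chart_measure c) g"
    unfolding density_dV_chart[OF c, symmetric]
    by (subst integral_density) (use m g in \<open>auto simp: g_eq measurable_cong_sets[OF sets_dV refl]\<close>)
  also have "\<dots> = (\<integral>u. indicator (cimg c) u * (volume_density c u * g (coord_inv c u)) \<partial>lborel)"
    unfolding chart_measure_def h_eq[symmetric]
    using integral_density[OF mg m\<rho> nonneg] by (subst integral_distr) auto
  finally show "integral\<^sup>L dV g = (\<integral>u. indicator (cimg c) u * (volume_density c u * g (coord_inv c u)) \<partial>lborel)" .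
qed

text \<open>The density is bounded on closed coordinate balls, and finitely many of their interiors cover
  the manifold.\<close>

lemma finite_measure_dV: "finite_measure dV"
proof -
  have "\<exists>W. open W \<and> x \<in> W \<and> emeasure dV W < \<infinity>" for x
  proof -
    obtain c where c: "c \<in> A" "x \<in> cdom c" using cover by blast
    obtain r where r: "r > 0" "cball (coord c x) r \<subseteq> cimg c"
      using open_contains_cball open_cimg[OF c(1)] coord_in_cimg[OF c(2)] by blast
    let ?K = "cball (coord c x) r"
    have b: "ball (coord c x) r \<subseteq> cimg c" using r by auto
    define W where "W = coord_inv c ` ball (coord c x) r"
    have W: "open W" "W \<subseteq> cdom c"
      using open_coord_inv_image[OF c(1) _ b] coord_inv_in_cdom[OF c(1)] b by (auto simp: W_def)
    have xW: "x \<in> W" using c r by (auto simp: W_def image_iff intro!: bexI[of _ "coord c x"] simp: coord_inv_coord)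
    have "compact (volume_density c ` ?K)"
      using C1_on_continuous[OF C1_volume_density[OF c(1)]] r(2)
      by (intro compact_continuous_image) (auto intro: continuous_on_subset)
    then have "bounded (volume_density c ` ?K)" by (rule compact_imp_bounded)
    then obtain b where b: "\<And>u. u \<in> ?K \<Longrightarrow> \<bar>volume_density c u\<bar> \<le> b"
      unfolding bounded_iff by (auto simp del: mem_cball)
    have "emeasure dV W = (\<integral>\<^sup>+u\<in>coord c ` W. ennreal (volume_density c u) \<partial>lborel)"
      using W c by (simp add: emeasure_dV_chart emeasure_chart_measure_subset)
    also have "\<dots> \<le> (\<integral>\<^sup>+u. ennreal b * indicator ?K u \<partial>lborel)"
    proof (intro nn_integral_mono)
      fix u
      have "u \<in> ?K" if "u \<in> coord c ` W"
        using that r(2) c(1) by (auto simp: W_def coord_coord_inv subset_iff dist_commute)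
      then show "ennreal (volume_density c u) * indicator (coord c ` W) u \<le> ennreal b * indicator ?K u"
        using b[of u] by (auto simp: indicator_def intro!: ennreal_leI)
    qed
    also have "\<dots> = ennreal b * emeasure lborel ?K" by (simp add: nn_integral_cmult_indicator)
    also have "\<dots> < \<infinity>" using emeasure_lborel_cball_finite[of "coord c x" r] by (simp add: ennreal_mult_less_top)
    finally show ?thesis using W xW by blast
  qed
  then obtain W where W: "\<And>x. open (W x) \<and> x \<in> W x \<and> emeasure dV (W x) < \<infinity>" by metis
  obtain T where T: "finite T" "UNIV \<subseteq> (\<Union>x\<in>T. W x)"
    using compactE_image[OF compact_M, of UNIV W] W by (metis UNIV_I UN_I subsetI)
  have "emeasure dV UNIV \<le> emeasure dV (\<Union>x\<in>T. W x)" using W T by (intro emeasure_mono) auto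
  also have "\<dots> \<le> (\<Sum>x\<in>T. emeasure dV (W x))" using W T by (intro emeasure_subadditive_finite) auto
  also have "\<dots> < \<infinity>" using W T(1) by (simp add: less_top[symmetric])
  finally show ?thesis by (intro finite_measureI) simp
qed

end

section \<open>Height functions on minimal immersions into the sphere\<close>

lemma orth_proj_eqI:
  assumes S: "subspace S" and w: "w \<in> S" "v - w \<in> S\<^sup>\<bottom>"
  shows "orth_proj S v = w"
  unfolding orth_proj_def
proof (rule the_equality)
  fix w' assume w': "w' \<in> S \<and> v - w' \<in> S\<^sup>\<bottom>"
  have "(v - w) - (v - w') \<in> S\<^sup>\<bottom>" by (rule subspace_diff[OF subspace_orthogonal_comp w(2)]) (use w' in simp)
  then have "w' - w \<in> S\<^sup>\<bottom>" by simp
  moreover have "w' - w \<in> S" by (rule subspace_diff[OF S _ w(1)]) (use w' in simp)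
  ultimately have "(w' - w) \<bullet> (w' - w) = 0" by (simp add: orthogonal_comp_def orthogonal_def)
  then show "w' = w" by simp
qed (use w in simp)

lemma orth_proj_works:
  assumes "subspace S"
  shows "orth_proj S v \<in> S" "v - orth_proj S v \<in> S\<^sup>\<bottom>"
proof -
  have "v \<in> S + S\<^sup>\<bottom>" using subspace_sum_orthogonal_comp[OF assms] by simp
  then obtain w z where "v = w + z" "w \<in> S" "z \<in> S\<^sup>\<bottom>" by (auto simp: set_plus_def)
  then have "w \<in> S" "v - w \<in> S\<^sup>\<bottom>" by simp_all
  then show "orth_proj S v \<in> S" "v - orth_proj S v \<in> S\<^sup>\<bottom>" by (simp_all add: orth_proj_eqI[OF assms])
qed

lemma inner_orth_proj:
  assumes "subspace S" "w \<in> S"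
  shows "orth_proj S v \<bullet> w = v \<bullet> w"
proof -
  have "(v - orth_proj S v) \<bullet> w = 0"
    using orth_proj_works(2)[OF assms(1), of v] assms(2)
    by (auto simp: orthogonal_comp_def orthogonal_def inner_commute)
  then show ?thesis by (simp add: inner_diff_left)
qed

locale minimal_sphere_immersion = closed_immersion A f
  for A :: "('m::{t2_space, second_countable_topology}, 'n::finite) chart set"
    and f :: "'m \<Rightarrow> real ^ 'k::finite" +
  fixes p :: "real ^ 'k"
  assumes in_sphere: "range f \<subseteq> sphere 0 1" and minimal: "minimal_in_sphere A f"
    and p_in_image: "p \<in> range f"
begin

abbreviation \<phi> :: "'m \<Rightarrow> real" where "\<phi> x \<equiv> f x \<bullet> p"

abbreviation d1 :: "('m, 'n) chart \<Rightarrow> 'n \<Rightarrow> real ^ 'n \<Rightarrow> real ^ 'k" where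
  "d1 c i u \<equiv> fderiv (local_rep c f) u (axis i 1)"

abbreviation d2 :: "('m, 'n) chart \<Rightarrow> 'n \<Rightarrow> 'n \<Rightarrow> real ^ 'n \<Rightarrow> real ^ 'k" where
  "d2 c i j u \<equiv> fderiv (d1 c j) u (axis i 1)"

abbreviation inv_metric :: "('m, 'n) chart \<Rightarrow> real ^ 'n \<Rightarrow> real ^ 'n ^ 'n" where
  "inv_metric c u \<equiv> matrix_inv (metric_matrix c f u)"

text \<open>The coordinates \<open>g\<^sup>i\<^sup>j \<partial>\<^sub>j \<phi>\<close> of the gradient of
  \<open>\<phi>\<close> in the induced metric.\<close>

definition height_gradient :: "('m, 'n) chart \<Rightarrow> real ^ 'n \<Rightarrow> real ^ 'n" where
  "height_gradient c u = (\<chi> i. \<Sum>j\<in>UNIV. inv_metric c u $ i $ j * (d1 c j u \<bullet> p))"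

lemma inner_f_self [simp]: "f x \<bullet> f x = 1"
  using in_sphere by (auto simp: norm_eq_sqrt_inner subset_iff)

lemma inner_p_self [simp]: "p \<bullet> p = 1"
  using p_in_image by auto

lemma metric_component: "metric_matrix c f u $ i $ j = d1 c i u \<bullet> d1 c j u"
  by (simp add: metric_matrix_def)

lemma local_rep_inner_self: "local_rep c f u \<bullet> local_rep c f u = 1"
  by (simp add: local_rep_def)

lemma inner_local_rep_fderiv:
  assumes "c \<in> A" "u \<in> cimg c"
  shows "local_rep c f u \<bullet> fderiv (local_rep c f) u v = 0"
proof -
  note F = C1_on_has_derivative[OF C1_local_rep[OF assms(1)] assms(2)]
  have "(\<lambda>v. local_rep c f u \<bullet> fderiv (local_rep c f) u v + fderiv (local_rep c f) u v \<bullet> local_rep c f u)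
    = (\<lambda>v. 0)"
    using has_derivative_unique[OF has_derivative_inner[OF F F]] by (simp add: local_rep_inner_self)
  then show ?thesis by (simp add: fun_eq_iff inner_commute)
qed

lemma inner_local_rep_d2:
  assumes "c \<in> A" "u \<in> cimg c"
  shows "local_rep c f u \<bullet> d2 c i j u = - metric_matrix c f u $ i $ j"
proof -
  note F = C1_on_has_derivative[OF C1_local_rep[OF assms(1)] assms(2)]
  note F1 = C1_on_has_derivative[OF C1_fderiv_local_rep[OF assms(1)] assms(2)]
  have "((\<lambda>u. local_rep c f u \<bullet> d1 c j u) has_derivative (\<lambda>v. 0)) (at u)"
    by (rule has_derivative_transform_within_open[OF has_derivative_const open_cimg[OF assms(1)] assms(2)])
       (simp add: inner_local_rep_fderiv assms(1))
  from fun_cong[OF has_derivative_unique[OF has_derivative_inner[OF F F1] this], of "axis i 1"]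
  show ?thesis by (simp add: metric_component)
qed

lemma d2_symmetric:
  assumes "c \<in> A" "u \<in> cimg c"
  shows "d2 c i j u = d2 c j i u"
  using fderiv_symmetric[OF open_cimg[OF assms(1)] assms(2) C1_local_rep[OF assms(1)] C1_fderiv_local_rep[OF assms(1)]] .

lemma metric_inverse:
  assumes "c \<in> A" "u \<in> cimg c"
  shows "metric_matrix c f u ** inv_metric c u = mat 1" "inv_metric c u ** metric_matrix c f u = mat 1"
  using metric_pos[OF assms] by (auto intro!: matrix_inv_mult)

lemma metric_symmetric:
  fixes c :: "('m, 'n) chart"
  shows "metric_matrix c f u $ i $ j = metric_matrix c f u $ j $ i"
  unfolding metric_component by (rule inner_commute)

lemma inv_metric_symmetric:
  assumes "c \<in> A" "u \<in> cimg c"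
  shows "inv_metric c u $ i $ j = inv_metric c u $ j $ i"
proof -
  let ?G = "metric_matrix c f u" and ?I = "inv_metric c u"
  have "transpose ?G = ?G" by (simp add: transpose_def vec_eq_iff metric_symmetric)
  then have "transpose ?I ** ?G = mat 1"
    using arg_cong[OF metric_inverse(1)[OF assms], of transpose] by (simp add: matrix_transpose_mul transpose_mat)
  then have "transpose ?I = ?I"
    using metric_inverse[OF assms] by (metis matrix_mul_assoc matrix_mul_lid matrix_mul_rid)
  then have "transpose ?I $ j $ i = ?I $ j $ i" by (rule arg_cong)
  then show ?thesis by (simp add: transpose_def)
qed

lemma trace_inv_metric:
  assumes "c \<in> A" "u \<in> cimg c"
  shows "(\<Sum>i\<in>UNIV. \<Sum>j\<in>UNIV. inv_metric c u $ i $ j * metric_matrix c f u $ i $ j) = real CARD('n)"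
proof -
  have "(\<Sum>j\<in>UNIV. inv_metric c u $ i $ j * metric_matrix c f u $ i $ j) = (inv_metric c u ** metric_matrix c f u) $ i $ i" for i
    by (simp add: matrix_matrix_mult_def metric_symmetric[of c u i])
  then show ?thesis by (simp add: metric_inverse(2)[OF assms] mat_def)
qed

lemma metric_height_gradient:
  assumes "c \<in> A" "u \<in> cimg c"
  shows "(\<Sum>j\<in>UNIV. metric_matrix c f u $ k $ j * height_gradient c u $ j) = d1 c k u \<bullet> p"
proof -
  let ?b = "(\<chi> j. d1 c j u \<bullet> p) :: real ^ 'n"
  have "height_gradient c u = inv_metric c u *v ?b"
    by (simp add: height_gradient_def matrix_vector_mult_def)
  then have "metric_matrix c f u *v height_gradient c u = ?b"
    by (simp add: matrix_vector_mul_assoc metric_inverse(1)[OF assms])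
  then show ?thesis by (simp add: matrix_vector_mult_def vec_eq_iff)
qed

lemma fderiv_local_rep_sum:
  assumes "c \<in> A" "u \<in> cimg c"
  shows "fderiv (local_rep c f) u v = (\<Sum>j\<in>UNIV. v $ j *\<^sub>R d1 c j u)"
proof -
  have L: "linear (fderiv (local_rep c f) u)" using linear_fderiv_local_rep[OF assms] .
  have "v = (\<Sum>j\<in>UNIV. v $ j *\<^sub>R axis j 1)" by (simp add: basis_expansion flip: scalar_mult_eq_scaleR)
  then have "fderiv (local_rep c f) u v = fderiv (local_rep c f) u (\<Sum>j\<in>UNIV. v $ j *\<^sub>R axis j 1)" by simp
  also have "\<dots> = (\<Sum>j\<in>UNIV. v $ j *\<^sub>R d1 c j u)" by (simp add: linear_sum[OF L] linear_cmul[OF L])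
  finally show ?thesis .
qed

text \<open>The immersion pushes the gradient of \<open>\<phi>\<close> forward to the tangential part of
  \<open>p\<close>.\<close>

lemma inner_fderiv_height_gradient:
  assumes "c \<in> A" "u \<in> cimg c"
  shows "fderiv (local_rep c f) u (height_gradient c u) \<bullet> fderiv (local_rep c f) u v
    = p \<bullet> fderiv (local_rep c f) u v"
proof -
  have "fderiv (local_rep c f) u (height_gradient c u) \<bullet> d1 c k u = p \<bullet> d1 c k u" for k
  proof -
    have "fderiv (local_rep c f) u (height_gradient c u) \<bullet> d1 c k u
      = (\<Sum>j\<in>UNIV. (d1 c j u \<bullet> d1 c k u) * height_gradient c u $ j)"
      by (simp add: fderiv_local_rep_sum[OF assms, of "height_gradient c u"] inner_sum_left mult.commute)
    also have "\<dots> = d1 c k u \<bullet> p"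
      unfolding metric_height_gradient[OF assms, of k, symmetric]
      by (simp add: metric_component inner_commute)
    finally show ?thesis by (simp add: inner_commute)
  qed
  then show ?thesis
    by (simp add: fderiv_local_rep_sum[OF assms, of v] inner_sum_right)
qed

text \<open>By the chain rule the differentials in two charts have the same image.\<close>

lemma tangent_space_eq:
  assumes c: "c \<in> A" and x: "x \<in> cdom c"
  shows "tangent_space A f x = range (fderiv (local_rep c f) (coord c x))"
proof -
  have sub: "range (fderiv (local_rep d f) (coord d x)) \<subseteq> range (fderiv (local_rep e f) (coord e x))"
    if "d \<in> A" "e \<in> A" "x \<in> cdom d" "x \<in> cdom e" for d e
    using fderiv_local_rep_chart_change[OF that(1,2), of "coord d x"] that
    by (auto simp: coord_inv_coord)
  then have "range (fderiv (local_rep d f) (coord d x)) = range (fderiv (local_rep c f) (coord c x))"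
    if "d \<in> A" "x \<in> cdom d" for d
    using that c x by blast
  then show ?thesis unfolding tangent_space_def using c x by blast
qed

lemma subspace_sphere_normal_space: "subspace (sphere_normal_space A f x)"
  unfolding sphere_normal_space_def by (rule subspace_orthogonal_comp)

lemma normal_part_local:
  assumes c: "c \<in> A" and u: "u \<in> cimg c"
  shows "normal_part A f p (coord_inv c u)
    = p - \<phi> (coord_inv c u) *\<^sub>R f (coord_inv c u) - fderiv (local_rep c f) u (height_gradient c u)"
proof -
  let ?x = "coord_inv c u" and ?D = "fderiv (local_rep c f) u"
  let ?w = "p - \<phi> ?x *\<^sub>R f ?x - ?D (height_gradient c u)"
  have T: "tangent_space A f ?x = range ?D"
    using tangent_space_eq[OF c coord_inv_in_cdom[OF c u]] by (simp add: coord_coord_inv c u)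
  have f0: "f ?x \<bullet> ?D v = 0" for v using inner_local_rep_fderiv[OF c u] by (simp add: local_rep_def)
  show ?thesis
    unfolding normal_part_def
  proof (rule orth_proj_eqI[OF subspace_sphere_normal_space])
    have "f ?x \<bullet> ?w = 0" by (simp add: inner_diff_right f0 inner_commute)
    moreover have "?D v \<bullet> ?w = 0" for v
      using inner_fderiv_height_gradient[OF c u, of v] f0[of v]
      by (simp add: inner_diff_right inner_commute)
    ultimately show "?w \<in> sphere_normal_space A f ?x"
      by (auto simp: sphere_normal_space_def T orthogonal_comp_def orthogonal_def)
    show "p - ?w \<in> (sphere_normal_space A f ?x)\<^sup>\<bottom>"
      by (auto simp: sphere_normal_space_def T orthogonal_comp_def orthogonal_def inner_add_right inner_add_left inner_commute)
  qed
qed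

lemma normal_part_in: "normal_part A f p x \<in> sphere_normal_space A f x"
  unfolding normal_part_def by (rule orth_proj_works(1)[OF subspace_sphere_normal_space])

lemma fderiv_height:
  assumes c: "c \<in> A" and u: "u \<in> cimg c"
  shows "fderiv (\<lambda>u. local_rep c f u \<bullet> p) u v = fderiv (local_rep c f) u v \<bullet> p"
  using fderiv_eq[OF has_derivative_inner_left[OF C1_on_has_derivative[OF C1_local_rep[OF c] u], of p]] by simp

text \<open>Pythagoras for the orthogonal decomposition \<open>p = \<phi> f + \<nabla>\<phi> +
  p\<^sup>\<bottom>\<close> of a unit vector; the left-hand side is
  \<open>|\<nabla>\<phi>|\<^sup>2\<close>.\<close>

lemma height_gradient_slope:
  assumes c: "c \<in> A" and u: "u \<in> cimg c"
  shows "fderiv (\<lambda>u. local_rep c f u \<bullet> p) u (height_gradient c u)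
    = 1 - (\<phi> (coord_inv c u))\<^sup>2 - (norm (normal_part A f p (coord_inv c u)))\<^sup>2"
proof -
  let ?x = "coord_inv c u" and ?t = "fderiv (local_rep c f) u (height_gradient c u)"
  have tt: "?t \<bullet> ?t = p \<bullet> ?t" by (rule inner_fderiv_height_gradient[OF c u])
  have ft: "f ?x \<bullet> ?t = 0" using inner_local_rep_fderiv[OF c u] by (simp add: local_rep_def)
  have "(norm (normal_part A f p ?x))\<^sup>2 = (p - \<phi> ?x *\<^sub>R f ?x - ?t) \<bullet> (p - \<phi> ?x *\<^sub>R f ?x - ?t)"
    by (simp add: normal_part_local[OF c u] power2_norm_eq_inner)
  also have "\<dots> = 1 - (\<phi> ?x)\<^sup>2 - p \<bullet> ?t"
    using tt ft by (simp add: inner_diff_left inner_diff_right inner_commute power2_eq_square)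
  finally show ?thesis unfolding fderiv_height[OF c u] by (simp add: inner_commute)
qed

lemma C1_height_gradient: "c \<in> A \<Longrightarrow> C1_on (cimg c) (\<lambda>u. height_gradient c u $ i)"
  unfolding height_gradient_def vec_lambda_beta
  by (intro C1_on_sum C1_on_mult C1_on_matrix_inv C1_metric C1_on_inner C1_fderiv_local_rep C1_on_const
      open_cimg metric_pos[THEN less_imp_neq, symmetric])

text \<open>A vector and its normal projection have the same inner product with a normal vector, so the
  trace of the second fundamental form can be tested on plain second derivatives.\<close>

lemma minimal_local:
  assumes c: "c \<in> A" and u: "u \<in> cimg c"
  shows "(\<Sum>i\<in>UNIV. \<Sum>j\<in>UNIV. inv_metric c u $ i $ j * (d2 c i j u \<bullet> normal_part A f p (coord_inv c u))) = 0"
proof -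
  let ?x = "coord_inv c u" and ?w = "normal_part A f p (coord_inv c u)"
  have "mean_curvature_vector A f c ?x = 0"
    using minimal coord_inv_in_cdom[OF c u] c unfolding minimal_in_sphere_def by blast
  then have "0 = mean_curvature_vector A f c ?x \<bullet> ?w" by simp
  also have "\<dots> = (\<Sum>i\<in>UNIV. \<Sum>j\<in>UNIV. inv_metric c u $ i $ j * (d2 c i j u \<bullet> ?w))"
    unfolding mean_curvature_vector_def second_fundamental_form_def
    by (simp add: inner_sum_left coord_coord_inv[OF c u]
        inner_orth_proj[OF subspace_sphere_normal_space normal_part_in])
  finally show ?thesis by simp
qed

lemma fderiv_metric:
  assumes c: "c \<in> A" and u: "u \<in> cimg c"
  shows "fderiv (\<lambda>u. metric_matrix c f u $ k $ j) u (axis i 1) = d2 c i k u \<bullet> d1 c j u + d2 c i j u \<bullet> d1 c k u"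
proof -
  note F1 = C1_on_has_derivative[OF C1_fderiv_local_rep[OF c] u]
  show ?thesis
    unfolding metric_component fderiv_eq[OF has_derivative_inner[OF F1 F1]] by (simp add: inner_commute)
qed

text \<open>Jacobi's formula; the two terms in the derivative of the metric contribute equally by
  symmetry.\<close>

lemma fderiv_volume_density:
  assumes c: "c \<in> A" and u: "u \<in> cimg c"
  shows "fderiv (volume_density c) u (axis i 1)
    = volume_density c u * (\<Sum>x\<in>UNIV. \<Sum>y\<in>UNIV. inv_metric c u $ x $ y * (d2 c i x u \<bullet> d1 c y u))"
proof -
  let ?G = "metric_matrix c f" and ?I = "inv_metric c u"
  have pos: "det (?G u) > 0" by (rule metric_pos[OF c u])
  let ?s = "\<lambda>h. \<Sum>x\<in>UNIV. \<Sum>y\<in>UNIV. ?I $ x $ y * fderiv (\<lambda>u. ?G u $ y $ x) u h"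
  have "((\<lambda>u. det (?G u)) has_derivative (\<lambda>h. det (?G u) * ?s h)) (at u)"
    by (rule has_derivative_det[OF C1_on_has_derivative[OF C1_metric[OF c] u]]) (use pos in simp)
  moreover have "(sqrt has_derivative (\<lambda>t. t * (inverse (sqrt (det (?G u))) / 2))) (at (det (?G u)))"
    using DERIV_real_sqrt[OF pos] by (simp only: has_field_derivative_def mult_commute_abs)
  ultimately have "(volume_density c has_derivative (\<lambda>h. det (?G u) * ?s h * (inverse (sqrt (det (?G u))) / 2))) (at u)"
    by (rule has_derivative_compose)
  then have "fderiv (volume_density c) u (axis i 1) = det (?G u) * ?s (axis i 1) * (inverse (sqrt (det (?G u))) / 2)"
    by (simp add: fderiv_eq)
  also have "\<dots> = volume_density c u * (?s (axis i 1) / 2)"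
    using pos real_sqrt_mult_self[of "det (?G u)"] by (simp add: field_simps)
  also have "?s (axis i 1) = 2 * (\<Sum>x\<in>UNIV. \<Sum>y\<in>UNIV. ?I $ x $ y * (d2 c i x u \<bullet> d1 c y u))"
  proof -
    have "(\<Sum>x\<in>UNIV. \<Sum>y\<in>UNIV. ?I $ x $ y * (d2 c i y u \<bullet> d1 c x u))
      = (\<Sum>y\<in>UNIV. \<Sum>x\<in>UNIV. ?I $ y $ x * (d2 c i y u \<bullet> d1 c x u))"
      by (subst sum.swap) (simp add: inv_metric_symmetric[OF c u])
    then show ?thesis
      by (simp add: fderiv_metric[OF c u] distrib_left sum.distrib)
  qed
  finally show ?thesis by simp
qed

text \<open>In coordinates, \<open>\<Delta>\<phi> = - n \<phi>\<close>. Contracting the derivative of the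
  equation \<open>g V = d\<phi>\<close> with the inverse metric gives the coordinate divergence
  of the gradient \<open>V\<close>. The derivative of the volume density cancels one of the two
  terms that come from the derivative of the metric; what is left is the metric trace of the
  second derivatives of \<open>f\<close>, paired with the non-tangential part \<open>\<phi> f +
  p\<^sup>\<bottom>\<close> of \<open>p\<close>. Minimality removes the pairing with
  \<open>p\<^sup>\<bottom>\<close>, and the pairing of \<open>f\<close> with its second
  derivatives is minus the metric, whose trace is \<open>n\<close>.\<close>

lemma divergence_height_gradient:
  assumes c: "c \<in> A" and u: "u \<in> cimg c"
  shows "(\<Sum>i\<in>UNIV. fderiv (\<lambda>u. volume_density c u * height_gradient c u $ i) u (axis i 1))
    = - real CARD('n) * volume_density c u * \<phi> (coord_inv c u)"
proof -
  let ?G = "metric_matrix c f" and ?I = "inv_metric c u" and ?J = "volume_density c" and ?x = "coord_inv c u"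
  define V where "V j = height_gradient c u $ j" for j
  define Vd where "Vd i j = fderiv (\<lambda>u. height_gradient c u $ j) u (axis i 1)" for i j
  define a where "a i j k = d2 c i j u \<bullet> d1 c k u" for i j k
  define b where "b i j = d2 c i j u \<bullet> p" for i j
  have dV: "((\<lambda>u. height_gradient c u $ j) has_derivative fderiv (\<lambda>u. height_gradient c u $ j) u) (at u)" for j
    by (rule C1_on_has_derivative[OF C1_height_gradient[OF c] u])
  have dG: "((\<lambda>u. ?G u $ k $ j) has_derivative fderiv (\<lambda>u. ?G u $ k $ j) u) (at u)" for k j
    by (rule C1_on_has_derivative[OF C1_metric[OF c] u])
  have dprod: "((\<lambda>u. ?J u * height_gradient c u $ i) has_derivative
      (\<lambda>h. ?J u * fderiv (\<lambda>u. height_gradient c u $ i) u h + fderiv ?J u h * height_gradient c u $ i)) (at u)" for i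
    by (rule has_derivative_mult[OF C1_on_has_derivative[OF C1_volume_density[OF c] u] dV])
  have prod: "fderiv (\<lambda>u. ?J u * height_gradient c u $ i) u (axis i 1) = ?J u * Vd i i + fderiv ?J u (axis i 1) * V i" for i
    unfolding fderiv_eq[OF dprod] Vd_def V_def ..
  have J': "fderiv ?J u (axis i 1) = ?J u * (\<Sum>x\<in>UNIV. \<Sum>y\<in>UNIV. ?I $ x $ y * a i x y)" for i
    by (simp add: fderiv_volume_density[OF c u] a_def)
  \<comment> \<open>the derivative of \<open>g V = d\<phi>\<close>\<close>
  have lin: "(\<Sum>j\<in>UNIV. ?G u $ k $ j * Vd i j) = b i k - (\<Sum>j\<in>UNIV. (a i k j + a i j k) * V j)" for i k
  proof -
    have "((\<lambda>u. d1 c k u \<bullet> p) has_derivative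
      (\<lambda>h. \<Sum>j\<in>UNIV. ?G u $ k $ j * fderiv (\<lambda>u. height_gradient c u $ j) u h
        + fderiv (\<lambda>u. ?G u $ k $ j) u h * height_gradient c u $ j)) (at u)"
    proof (rule has_derivative_transform_within_open[OF _ open_cimg[OF c] u])
      show "((\<lambda>u. \<Sum>j\<in>UNIV. ?G u $ k $ j * height_gradient c u $ j) has_derivative
        (\<lambda>h. \<Sum>j\<in>UNIV. ?G u $ k $ j * fderiv (\<lambda>u. height_gradient c u $ j) u h
        + fderiv (\<lambda>u. ?G u $ k $ j) u h * height_gradient c u $ j)) (at u)"
        by (intro has_derivative_sum has_derivative_mult dG dV)
    qed (rule metric_height_gradient[OF c])
    moreover have "((\<lambda>u. d1 c k u \<bullet> p) has_derivative (\<lambda>h. fderiv (d1 c k) u h \<bullet> p)) (at u)"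
      by (rule has_derivative_inner_left[OF C1_on_has_derivative[OF C1_fderiv_local_rep[OF c] u]])
    ultimately have "(\<Sum>j\<in>UNIV. ?G u $ k $ j * Vd i j + (a i k j + a i j k) * V j) = b i k"
      unfolding Vd_def V_def a_def b_def fderiv_metric[OF c u, symmetric]
      by (rule fun_cong[OF has_derivative_unique])
    then show ?thesis by (simp add: sum.distrib)
  qed
  have II: "(\<Sum>k\<in>UNIV. ?I $ i $ k * ?G u $ k $ j) = (if i = j then 1 else 0)" for i j
    using arg_cong[OF metric_inverse(2)[OF c u], of "\<lambda>M. M $ i $ j"] by (simp add: matrix_matrix_mult_def mat_def)
  have "(\<Sum>i\<in>UNIV. Vd i i) = (\<Sum>i\<in>UNIV. \<Sum>k\<in>UNIV. ?I $ i $ k * (\<Sum>j\<in>UNIV. ?G u $ k $ j * Vd i j))"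
  proof (rule sum.cong)
    fix i
    have "(\<Sum>k\<in>UNIV. ?I $ i $ k * (\<Sum>j\<in>UNIV. ?G u $ k $ j * Vd i j))
      = (\<Sum>j\<in>UNIV. (\<Sum>k\<in>UNIV. ?I $ i $ k * ?G u $ k $ j) * Vd i j)"
      unfolding sum_distrib_left sum_distrib_right by (subst sum.swap) (simp add: mult.assoc)
    also have "\<dots> = Vd i i" by (simp add: II if_distrib[of "\<lambda>t. t * _"] cong: if_cong)
    finally show "Vd i i = (\<Sum>k\<in>UNIV. ?I $ i $ k * (\<Sum>j\<in>UNIV. ?G u $ k $ j * Vd i j))" ..
  qed simp
  also have "\<dots> = (\<Sum>i\<in>UNIV. \<Sum>k\<in>UNIV. ?I $ i $ k * (b i k - (\<Sum>j\<in>UNIV. a i k j * V j)))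
    - (\<Sum>i\<in>UNIV. \<Sum>k\<in>UNIV. ?I $ i $ k * (\<Sum>j\<in>UNIV. a i j k * V j))"
    unfolding lin by (simp add: distrib_right sum.distrib sum_subtractf right_diff_distrib distrib_left)
  also have "(\<Sum>i\<in>UNIV. \<Sum>k\<in>UNIV. ?I $ i $ k * (\<Sum>j\<in>UNIV. a i j k * V j))
    = (\<Sum>j\<in>UNIV. (\<Sum>i\<in>UNIV. \<Sum>k\<in>UNIV. ?I $ i $ k * a j i k) * V j)"
  proof -
    have "a i j k = a j i k" for i j k by (simp add: a_def d2_symmetric[OF c u, of i j])
    then have "(\<Sum>i\<in>UNIV. \<Sum>k\<in>UNIV. ?I $ i $ k * (\<Sum>j\<in>UNIV. a i j k * V j))
      = (\<Sum>i\<in>UNIV. \<Sum>k\<in>UNIV. \<Sum>j\<in>UNIV. ?I $ i $ k * a j i k * V j)"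
      by (simp add: sum_distrib_left mult.assoc)
    also have "\<dots> = (\<Sum>i\<in>UNIV. \<Sum>j\<in>UNIV. \<Sum>k\<in>UNIV. ?I $ i $ k * a j i k * V j)"
      by (intro sum.cong refl sum.swap)
    also have "\<dots> = (\<Sum>j\<in>UNIV. \<Sum>i\<in>UNIV. \<Sum>k\<in>UNIV. ?I $ i $ k * a j i k * V j)"
      by (rule sum.swap)
    finally show ?thesis by (simp add: sum_distrib_right)
  qed
  finally have div: "(\<Sum>i\<in>UNIV. ?J u * Vd i i + fderiv ?J u (axis i 1) * V i)
    = ?J u * (\<Sum>i\<in>UNIV. \<Sum>k\<in>UNIV. ?I $ i $ k * (b i k - (\<Sum>j\<in>UNIV. a i k j * V j)))"
    by (simp add: J' sum.distrib right_diff_distrib mult.assoc flip: sum_distrib_left)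
  have lr: "local_rep c f u = f ?x" by (simp add: local_rep_def)
  have "b i k - (\<Sum>j\<in>UNIV. a i k j * V j)
    = d2 c i k u \<bullet> normal_part A f p ?x - \<phi> ?x * ?G u $ i $ k" for i k
  proof -
    have "(\<Sum>j\<in>UNIV. a i k j * V j) = d2 c i k u \<bullet> fderiv (local_rep c f) u (height_gradient c u)"
      by (simp add: a_def V_def fderiv_local_rep_sum[OF c u, of "height_gradient c u"] inner_sum_right mult.commute)
    moreover have "d2 c i k u \<bullet> f ?x = - ?G u $ i $ k"
      using inner_local_rep_d2[OF c u, where i = i and j = k] unfolding lr by (simp only: inner_commute)
    ultimately show ?thesis
      by (simp add: b_def normal_part_local[OF c u] inner_diff_right)
  qed
  then have "(\<Sum>i\<in>UNIV. \<Sum>k\<in>UNIV. ?I $ i $ k * (b i k - (\<Sum>j\<in>UNIV. a i k j * V j)))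
    = (\<Sum>i\<in>UNIV. \<Sum>k\<in>UNIV. ?I $ i $ k * (d2 c i k u \<bullet> normal_part A f p ?x))
      - \<phi> ?x * (\<Sum>i\<in>UNIV. \<Sum>k\<in>UNIV. ?I $ i $ k * ?G u $ i $ k)"
    by (simp add: right_diff_distrib sum_subtractf sum_distrib_left mult.left_commute)
  then show ?thesis
    unfolding prod div by (simp add: minimal_local[OF c u] trace_inv_metric[OF c u])
qed

end

section \<open>Green's identity for height functions\<close>

text \<open>Cutting off at a double zero does not destroy differentiability. This serves both for bump
  functions and for restricting the profile functions to positive heights.\<close>

lemma has_real_derivative_positive_part:
  fixes g :: "real \<Rightarrow> real"
  assumes g: "(g has_real_derivative g' t) (at t)" and "g 0 = 0" "g' 0 = 0"
  shows "((\<lambda>t. if t > 0 then g t else 0) has_real_derivative (if t > 0 then g' t else 0)) (at t)"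
proof -
  consider "t > 0" | "t < 0" | "t = 0" by linarith
  then show ?thesis
  proof cases
    case 1
    have "((\<lambda>t. if t > 0 then g t else 0) has_real_derivative g' t) (at t)"
      by (rule has_field_derivative_transform_within_open[OF g, of "{0<..}"]) (use 1 in auto)
    then show ?thesis using 1 by simp
  next
    case 2
    have "((\<lambda>t. if t > 0 then g t else 0) has_real_derivative 0) (at t)"
      by (rule has_field_derivative_transform_within_open[OF DERIV_const, of "{..<0}"]) (use 2 in auto)
    then show ?thesis using 2 by simp
  next
    case 3
    have "((\<lambda>y. g y / y) \<longlongrightarrow> 0) (at 0)"
      using g 3 assms(2,3) by (simp add: has_field_derivative_iff)
    from tendsto_rabs_zero[OF this] have "((\<lambda>y. (if y > 0 then g y else 0) / y) \<longlongrightarrow> 0) (at 0)"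
      by (rule Lim_null_comparison[rotated]) (auto intro!: always_eventually simp: divide_le_0_iff)
    then show ?thesis using 3 by (simp add: has_field_derivative_iff)
  qed
qed

lemma C1_on_bump:
  fixes a :: "'a::euclidean_space" and s :: real
  shows "C1_on UNIV (\<lambda>v. (max 0 (s - (v - a) \<bullet> (v - a)))\<^sup>2)"
proof -
  have q: "C1_on UNIV (\<lambda>v. s - (v - a) \<bullet> (v - a))"
    by (intro C1_on_diff C1_on_inner C1_on_const C1_on_ident)
  have "C1_on UNIV (\<lambda>v. (\<lambda>t. if t > 0 then t\<^sup>2 else 0) (s - (v - a) \<bullet> (v - a)))"
  proof (rule C1_on_real_comp[OF q, of UNIV])
    show "((\<lambda>t :: real. if t > 0 then t\<^sup>2 else 0) has_real_derivative (if t > 0 then 2 * t else 0)) (at t)" for t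
      by (rule has_real_derivative_positive_part[where g' = "\<lambda>t. 2 * t"]) (auto intro!: derivative_eq_intros)
    have "continuous_on UNIV (\<lambda>t :: real. max 0 (2 * t))" by (intro continuous_intros)
    then show "continuous_on UNIV (\<lambda>t :: real. if t > 0 then 2 * t else 0)"
      by (rule continuous_on_eq) auto
  qed simp
  then show ?thesis by (rule C1_on_cong_open[OF open_UNIV, rotated]) auto
qed

context closed_immersion
begin

definition C1_fun :: "('m \<Rightarrow> real) \<Rightarrow> bool" where
  "C1_fun \<eta> \<longleftrightarrow> (\<forall>c\<in>A. C1_on (cimg c) (\<lambda>u. \<eta> (coord_inv c u)))"

lemma C1_funD: "C1_fun \<eta> \<Longrightarrow> c \<in> A \<Longrightarrow> C1_on (cimg c) (\<lambda>u. \<eta> (coord_inv c u))"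
  unfolding C1_fun_def by blast

lemma continuous_charts:
  fixes g :: "'m \<Rightarrow> 'b::topological_space"
  assumes "\<And>c. c \<in> A \<Longrightarrow> continuous_on (cimg c) (\<lambda>u. g (coord_inv c u))"
  shows "continuous_on UNIV g"
proof (rule continuous_at_imp_continuous_on, rule ballI)
  fix x
  obtain c where c: "c \<in> A" "x \<in> cdom c" using cover by blast
  have "continuous_on (cdom c) (\<lambda>y. g (coord_inv c (coord c y)))"
    by (rule continuous_on_compose2[OF assms[OF c(1)] continuous_coord[OF c(1)]]) (auto simp: coord_in_cimg)
  then have "continuous_on (cdom c) g" by (rule continuous_on_eq) (simp add: coord_inv_coord c)
  then show "isCont g x" using c open_cdom by (simp add: continuous_on_eq_continuous_at)
qed

lemma C1_fun_continuous: "C1_fun \<eta> \<Longrightarrow> continuous_on UNIV \<eta>"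
  by (intro continuous_charts C1_on_continuous C1_funD)

lemma integrable_continuous_dV:
  fixes g :: "'m \<Rightarrow> real"
  assumes "continuous_on UNIV g"
  shows "integrable dV g"
proof -
  interpret finite_measure dV by (rule finite_measure_dV)
  have "bounded (range g)" by (rule compact_imp_bounded[OF compact_continuous_image[OF assms compact_M]])
  then obtain B where "\<And>x. norm (g x) \<le> B" unfolding bounded_iff by blast
  then show ?thesis
    using borel_measurable_continuous_onI[OF assms]
    by (intro integrable_const_bound[of _ B]) (auto simp: measurable_cong_sets[OF sets_dV refl])
qed

definition bump_at :: "'m \<Rightarrow> ('m \<Rightarrow> real) \<Rightarrow> ('m, 'n) chart \<Rightarrow> 'm set \<Rightarrow> bool" where
  "bump_at x b c K \<longleftrightarrow> c \<in> A \<and> compact K \<and> K \<subseteq> cdom c \<and> (\<forall>y. y \<notin> K \<longrightarrow> b y = 0) \<and>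
     C1_fun b \<and> (\<forall>y. b y \<ge> 0) \<and> b x > 0"

text \<open>In a chart around \<open>x\<close>, the function \<open>(max 0 (r\<^sup>2 - |u -
  u\<^sub>0|\<^sup>2))\<^sup>2\<close> is \<open>C\<^sup>1\<close>. Its extension by
  \<open>0\<close> is \<open>C\<^sup>1\<close> in every other chart because the support is
  compact, hence closed in the Hausdorff space \<open>'m\<close>.\<close>

lemma ex_bump: "\<exists>b c K. bump_at x b c K"
proof -
  obtain c where c: "c \<in> A" "x \<in> cdom c" using cover by blast
  obtain r where r: "r > 0" "cball (coord c x) r \<subseteq> cimg c"
    using open_contains_cball open_cimg[OF c(1)] coord_in_cimg[OF c(2)] by blast
  define B where "B v = (max 0 (r\<^sup>2 - (v - coord c x) \<bullet> (v - coord c x)))\<^sup>2" for v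
  define b where "b y = (if y \<in> cdom c then B (coord c y) else 0)" for y
  define K where "K = coord_inv c ` cball (coord c x) r"
  have B0: "B v = 0" if "v \<notin> cball (coord c x) r" for v
  proof -
    have "r \<le> norm (v - coord c x)" using that by (simp add: dist_norm norm_minus_commute)
    then have "r\<^sup>2 \<le> (norm (v - coord c x))\<^sup>2" using r(1) by (intro power_mono) auto
    then show ?thesis by (simp add: B_def power2_norm_eq_inner)
  qed
  have CB: "C1_on UNIV B" unfolding B_def by (rule C1_on_bump)
  have K: "compact K" unfolding K_def
    by (rule compact_continuous_image[OF continuous_on_subset[OF continuous_coord_inv[OF c(1)] r(2)]]) simp
  have Kc: "K \<subseteq> cdom c" using coord_inv_in_cdom[OF c(1)] r(2) by (auto simp: K_def)
  have b0: "b y = 0" if "y \<notin> K" for y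
  proof (cases "y \<in> cdom c")
    case True
    then have "coord c y \<notin> cball (coord c x) r"
      using that by (metis K_def c(1) coord_inv_coord image_eqI)
    then show ?thesis by (simp add: b_def B0)
  qed (simp add: b_def)
  have nonneg: "b y \<ge> 0" for y by (simp add: b_def B_def)
  have pos: "b x > 0" using r(1) c by (simp add: b_def B_def)
  have "C1_fun b"
    unfolding C1_fun_def
  proof (intro ballI C1_on_local)
    fix d u assume d: "d \<in> A" "u \<in> cimg d"
    let ?y = "coord_inv d u"
    have y: "?y \<in> cdom d" "coord d ?y = u" using d by (auto simp: coord_inv_in_cdom coord_coord_inv)
    show "\<exists>N. open N \<and> u \<in> N \<and> C1_on N (\<lambda>u. b (coord_inv d u))"
    proof (cases "?y \<in> cdom c")
      case True
      let ?N = "coord d ` (cdom d \<inter> cdom c)"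
      have "C1_on ?N (\<lambda>u. B (transition d c u))"
        by (rule C1_on_compose[OF transition_C1[OF d(1) c(1)] CB]) simp
      then have "C1_on ?N (\<lambda>u. b (coord_inv d u))"
        by (rule C1_on_cong_open[OF open_overlap[OF d(1) c(1)], rotated]) (auto simp: b_def coord_inv_coord d)
      moreover have "u \<in> ?N" using y True by (metis IntI image_eqI)
      ultimately show ?thesis using open_overlap[OF d(1) c(1)] by blast
    next
      case False
      let ?N = "coord d ` (cdom d - K)"
      have N: "open ?N"
        using open_cdom[OF d(1)] K by (intro open_coord_image d) (auto intro: open_Diff compact_imp_closed)
      have "C1_on ?N (\<lambda>u. b (coord_inv d u))"
        by (rule C1_on_cong_open[OF N _ C1_on_const[of _ 0]]) (auto simp: b0 coord_inv_coord d)
      moreover have "u \<in> ?N" using y False Kc by (metis DiffI image_eqI subsetD)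
      ultimately show ?thesis using N by blast
    qed
  qed
  then have "bump_at x b c K" unfolding bump_at_def using c K Kc b0 nonneg pos by blast
  then show ?thesis by blast
qed

text \<open>Finitely many bump functions have a positive sum, and dividing by the sum preserves
  \<open>C\<^sup>1\<close>.\<close>

lemma partition_of_unity:
  obtains I :: "'m set" and \<eta> :: "'m \<Rightarrow> 'm \<Rightarrow> real" and ch K
  where "finite I" "\<And>i. ch i \<in> A" "\<And>i. compact (K i)" "\<And>i. K i \<subseteq> cdom (ch i)"
    "\<And>i y. y \<notin> K i \<Longrightarrow> \<eta> i y = 0" "\<And>i. C1_fun (\<eta> i)" "\<And>y. (\<Sum>i\<in>I. \<eta> i y) = 1"
proof -
  obtain b c K where "\<And>x. bump_at x (b x) (c x) (K x)" using ex_bump by metis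
  then have b: "\<And>x. c x \<in> A" "\<And>x. compact (K x)" "\<And>x. K x \<subseteq> cdom (c x)"
    "\<And>x y. y \<notin> K x \<Longrightarrow> b x y = 0" "\<And>x. C1_fun (b x)" "\<And>x y. b x y \<ge> 0" "\<And>x. b x x > 0"
    unfolding bump_at_def by blast+
  have op: "open {y. b x y > 0}" for x
    using open_Collect_less[OF continuous_on_const C1_fun_continuous[OF b(5)], of 0] by simp
  obtain I where I: "finite I" "UNIV \<subseteq> (\<Union>x\<in>I. {y. b x y > 0})"
    using compactE_image[OF compact_M, of UNIV "\<lambda>x. {y. b x y > 0}"] op b(7)
    by (metis (mono_tags, lifting) UNIV_I UN_I mem_Collect_eq subsetI)
  define S where "S y = (\<Sum>x\<in>I. b x y)" for y
  have S: "S y > 0" for y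
  proof -
    obtain x where "x \<in> I" "b x y > 0" using I(2) by blast
    then show ?thesis unfolding S_def using I(1) b(6) by (intro sum_pos2) auto
  qed
  show ?thesis
  proof (rule that[of I c K "\<lambda>x y. b x y / S y"])
    show "C1_fun (\<lambda>y. b x y / S y)" for x
      unfolding C1_fun_def
    proof
      fix d assume d: "d \<in> A"
      have "C1_on (cimg d) (\<lambda>u. S (coord_inv d u))"
        unfolding S_def by (intro C1_on_sum C1_funD b d)
      then show "C1_on (cimg d) (\<lambda>u. b x (coord_inv d u) / S (coord_inv d u))"
        by (rule C1_on_divide[OF C1_funD[OF b(5) d]]) (rule less_imp_neq[OF S, symmetric])
    qed
    show "(\<Sum>x\<in>I. b x y / S y) = 1" for y
      using S[of y] by (simp add: S_def flip: sum_divide_distrib)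
  qed (use b I in auto)
qed

end

context minimal_sphere_immersion
begin

text \<open>The derivative of \<open>\<eta>\<close> in the direction of the gradient of
  \<open>\<phi>\<close>, that is, the inner product of the two gradients. It is computed in an
  arbitrary chart; by the next lemmas the choice does not matter.\<close>

definition slope :: "('m \<Rightarrow> real) \<Rightarrow> 'm \<Rightarrow> real" where
  "slope \<eta> x = (let c = (SOME c. c \<in> A \<and> x \<in> cdom c)
     in fderiv (\<lambda>u. \<eta> (coord_inv c u)) (coord c x) (height_gradient c (coord c x)))"

text \<open>Both sides are mapped by the injective differential of \<open>f\<close> to the tangential part
  of \<open>p\<close>.\<close>

lemma height_gradient_chart_change:
  assumes c: "c \<in> A" "d \<in> A" and u: "u \<in> coord c ` (cdom c \<inter> cdom d)"
  shows "fderiv (transition c d) u (height_gradient c u) = height_gradient d (transition c d u)"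
proof -
  let ?v = "transition c d u"
  have u': "u \<in> cimg c" and v: "?v \<in> cimg d"
    using subsetD[OF overlap_subset u] transition_in_cimg[OF c(1) u] by blast+
  have same: "coord_inv d ?v = coord_inv c u"
    using u c by (auto simp: coord_inv_coord)
  have "fderiv (local_rep c f) u (height_gradient c u) = fderiv (local_rep d f) ?v (height_gradient d ?v)"
    using normal_part_local[OF c(1) u'] normal_part_local[OF c(2) v] by (simp add: same)
  then have "fderiv (local_rep d f) ?v (fderiv (transition c d) u (height_gradient c u))
    = fderiv (local_rep d f) ?v (height_gradient d ?v)"
    by (simp add: fderiv_local_rep_chart_change[OF c u])
  then show ?thesis using inj_fderiv_local_rep[OF c(2) v] by (rule injD[rotated])
qed

lemma slope_chart:
  assumes \<eta>: "C1_fun \<eta>" and c: "c \<in> A" "x \<in> cdom c"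
  shows "slope \<eta> x = fderiv (\<lambda>u. \<eta> (coord_inv c u)) (coord c x) (height_gradient c (coord c x))"
proof -
  define d where "d = (SOME c. c \<in> A \<and> x \<in> cdom c)"
  have "d \<in> A \<and> x \<in> cdom d" unfolding d_def by (rule someI_ex) (use cover in blast)
  then have d: "d \<in> A" "x \<in> cdom d" by auto
  let ?u = "coord d x"
  have u: "?u \<in> coord d ` (cdom d \<inter> cdom c)" using c d by blast
  have tr: "transition d c ?u = coord c x" by (simp add: coord_inv_coord d)
  have diff: "(\<eta> \<circ> coord_inv c) differentiable (at (transition d c ?u))"
    using C1_funD[OF \<eta> c(1)] coord_in_cimg[OF c(2)] by (simp add: tr o_def)
  have "slope \<eta> x = fderiv (\<eta> \<circ> coord_inv d) ?u (height_gradient d ?u)"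
    by (simp add: slope_def Let_def o_def flip: d_def)
  also have "\<dots> = fderiv (\<eta> \<circ> coord_inv c) (coord c x) (height_gradient c (coord c x))"
    unfolding fderiv_chart_change[OF d(1) c(1) u diff] height_gradient_chart_change[OF d(1) c(1) u] tr ..
  finally show ?thesis by (simp add: o_def)
qed

lemma slope_coord_inv:
  assumes "C1_fun \<eta>" "c \<in> A" "u \<in> cimg c"
  shows "slope \<eta> (coord_inv c u) = fderiv (\<lambda>u. \<eta> (coord_inv c u)) u (height_gradient c u)"
  using slope_chart[OF assms(1,2) coord_inv_in_cdom[OF assms(2,3)]] by (simp add: coord_coord_inv assms)

lemma fderiv_coordinates:
  fixes g :: "real ^ 'n \<Rightarrow> real"
  assumes "g differentiable (at u)"
  shows "fderiv g u v = (\<Sum>i\<in>UNIV. v $ i * fderiv g u (axis i 1))"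
proof -
  have L: "linear (fderiv g u)" by (rule fderiv_linear[OF assms])
  have "v = (\<Sum>j\<in>UNIV. v $ j *\<^sub>R axis j 1)" by (simp add: basis_expansion flip: scalar_mult_eq_scaleR)
  then have "fderiv g u v = fderiv g u (\<Sum>j\<in>UNIV. v $ j *\<^sub>R axis j 1)" by simp
  also have "\<dots> = (\<Sum>i\<in>UNIV. v $ i * fderiv g u (axis i 1))" by (simp add: linear_sum[OF L] linear_cmul[OF L])
  finally show ?thesis .
qed

lemma continuous_slope:
  assumes \<eta>: "C1_fun \<eta>"
  shows "continuous_on UNIV (slope \<eta>)"
proof (rule continuous_charts)
  fix c assume c: "c \<in> A"
  have "continuous_on (cimg c) (\<lambda>u. \<Sum>i\<in>UNIV. height_gradient c u $ i * fderiv (\<lambda>u. \<eta> (coord_inv c u)) u (axis i 1))"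
    by (intro continuous_on_sum continuous_on_mult C1_on_continuous[OF C1_height_gradient[OF c]]
        C1_on_continuous_fderiv[OF C1_funD[OF \<eta> c]])
  then show "continuous_on (cimg c) (\<lambda>u. slope \<eta> (coord_inv c u))"
    by (rule continuous_on_eq)
       (use C1_funD[OF \<eta> c] in \<open>simp add: slope_coord_inv[OF \<eta> c] fderiv_coordinates[of _ _ "height_gradient _ _"]\<close>)
qed

lemma slope_eq_0:
  assumes \<eta>: "C1_fun \<eta>" and K: "closed K" "x \<notin> K" and zero: "\<And>y. y \<notin> K \<Longrightarrow> \<eta> y = 0"
  shows "slope \<eta> x = 0"
proof -
  obtain c where c: "c \<in> A" "x \<in> cdom c" using cover by blast
  let ?N = "coord c ` (cdom c - K)"
  have N: "open ?N" using open_cdom[OF c(1)] K by (intro open_coord_image c) auto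
  have u: "coord c x \<in> ?N" using c K by blast
  have "fderiv (\<lambda>u. \<eta> (coord_inv c u)) (coord c x) = fderiv (\<lambda>u. 0) (coord c x)"
    by (rule fderiv_cong_open[OF N u]) (auto simp: coord_inv_coord c zero)
  then show ?thesis by (simp add: slope_chart[OF \<eta> c] frechet_derivative_const)
qed

lemma slope_sum:
  assumes "\<And>i. i \<in> I \<Longrightarrow> C1_fun (\<eta> i)"
  shows "slope (\<lambda>x. \<Sum>i\<in>I. \<eta> i x) x = (\<Sum>i\<in>I. slope (\<eta> i) x)"
proof -
  obtain c where c: "c \<in> A" "x \<in> cdom c" using cover by blast
  note u = coord_in_cimg[OF c(2)]
  have C: "C1_fun (\<lambda>x. \<Sum>i\<in>I. \<eta> i x)"
    unfolding C1_fun_def by (intro ballI C1_on_sum C1_funD assms)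
  have "((\<lambda>u. \<Sum>i\<in>I. \<eta> i (coord_inv c u)) has_derivative
      (\<lambda>v. \<Sum>i\<in>I. fderiv (\<lambda>u. \<eta> i (coord_inv c u)) (coord c x) v)) (at (coord c x))"
    by (intro has_derivative_sum C1_on_has_derivative[OF C1_funD] assms c u)
  from fderiv_eq[OF this] show ?thesis
    by (simp add: slope_chart[OF C c] slope_chart[OF assms c])
qed

text \<open>The integrand is the divergence of \<open>\<eta> \<nabla>\<phi>\<close>. In coordinates it
  becomes a sum of partial derivatives of compactly supported functions.\<close>

lemma integral_slope_in_chart:
  assumes \<eta>: "C1_fun \<eta>" and c: "c \<in> A" and K: "compact K" "K \<subseteq> cdom c"
    and supp: "\<And>y. y \<notin> K \<Longrightarrow> \<eta> y = 0"
  shows "(\<integral>x. slope \<eta> x - real CARD('n) * \<eta> x * \<phi> x \<partial>dV) = 0"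
proof -
  let ?J = "volume_density c" and ?g = "\<lambda>x. slope \<eta> x - real CARD('n) * \<eta> x * \<phi> x"
  let ?\<eta> = "\<lambda>u. \<eta> (coord_inv c u)"
  define W where "W i u = ?\<eta> u * (?J u * height_gradient c u $ i)" for i u
  have C\<eta>: "C1_on (cimg c) ?\<eta>" by (rule C1_funD[OF \<eta> c])
  have CJV: "C1_on (cimg c) (\<lambda>u. ?J u * height_gradient c u $ i)" for i
    by (intro C1_on_mult C1_volume_density C1_height_gradient c)
  have CW: "C1_on (cimg c) (W i)" for i unfolding W_def by (rule C1_on_mult[OF C\<eta> CJV])
  have div: "(\<Sum>i\<in>UNIV. fderiv (W i) u (axis i 1)) = ?J u * ?g (coord_inv c u)" if u: "u \<in> cimg c" for u
  proof -
    have "fderiv (W i) u (axis i 1) = ?\<eta> u * fderiv (\<lambda>u. ?J u * height_gradient c u $ i) u (axis i 1)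
      + ?J u * (height_gradient c u $ i * fderiv ?\<eta> u (axis i 1))" for i
      unfolding W_def
      using fderiv_eq[OF has_derivative_mult[OF C1_on_has_derivative[OF C\<eta> u] C1_on_has_derivative[OF CJV[of i] u]]]
      by (simp add: ac_simps)
    then have "(\<Sum>i\<in>UNIV. fderiv (W i) u (axis i 1))
      = ?\<eta> u * (\<Sum>i\<in>UNIV. fderiv (\<lambda>u. ?J u * height_gradient c u $ i) u (axis i 1))
        + ?J u * (\<Sum>i\<in>UNIV. height_gradient c u $ i * fderiv ?\<eta> u (axis i 1))"
      by (simp add: sum.distrib sum_distrib_left)
    also have "(\<Sum>i\<in>UNIV. height_gradient c u $ i * fderiv ?\<eta> u (axis i 1)) = slope \<eta> (coord_inv c u)"
      using C\<eta> u by (simp add: slope_coord_inv[OF \<eta> c u] fderiv_coordinates[of _ _ "height_gradient c u"])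
    finally show ?thesis
      unfolding divergence_height_gradient[OF c u] by (simp add: algebra_simps)
  qed
  have clK: "closed K" using K(1) by (rule compact_imp_closed)
  have cont: "continuous_on UNIV ?g"
    by (intro continuous_intros continuous_slope C1_fun_continuous continuous_f \<eta>)
  have g0: "?g x = 0" if "x \<notin> cdom c" for x
  proof -
    have x: "x \<notin> K" using that K(2) by blast
    show ?thesis using supp[OF x] slope_eq_0[OF \<eta> clK x supp] by simp
  qed
  have cK: "compact (coord c ` K)" "coord c ` K \<subseteq> cimg c"
    using K continuous_coord[OF c]
    by (auto intro!: compact_continuous_image continuous_on_subset[OF continuous_coord[OF c]] simp: cimg_def)
  have W0: "W i u = 0" if "u \<in> cimg c - coord c ` K" for i u
  proof -
    have "coord_inv c u \<notin> K" using that coord_coord_inv[OF c] by (metis DiffD1 DiffD2 image_eqI)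
    then show ?thesis by (simp add: W_def supp)
  qed
  note stokes = integral_fderiv_compact_support_eq_0[OF open_cimg[OF c] cK CW W0]
  have "integral\<^sup>L dV ?g = (\<integral>u. indicator (cimg c) u * (?J u * ?g (coord_inv c u)) \<partial>lborel)"
    by (rule integral_chart[OF c borel_measurable_continuous_onI[OF cont] g0])
  also have "\<dots> = (\<integral>u. (\<Sum>i\<in>UNIV. indicator (cimg c) u * fderiv (W i) u (axis i 1)) \<partial>lborel)"
    by (rule Bochner_Integration.integral_cong) (auto simp: indicator_def div simp flip: sum_distrib_left)
  also have "\<dots> = (\<Sum>i\<in>UNIV. \<integral>u. indicator (cimg c) u * fderiv (W i) u (axis i 1) \<partial>lborel)"
    by (rule Bochner_Integration.integral_sum) (rule stokes)
  also have "\<dots> = 0" by (intro sum.neutral ballI stokes(2))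
  finally show ?thesis .
qed

text \<open>Green's identity: the inner product of the gradients of \<open>\<beta>\<close> and
  \<open>\<phi>\<close> integrates to the integral of \<open>- \<beta> \<Delta>\<phi> = n
  \<beta> \<phi>\<close>.\<close>

lemma integral_slope:
  assumes \<beta>: "C1_fun \<beta>"
  shows "(\<integral>x. slope \<beta> x - real CARD('n) * \<beta> x * \<phi> x \<partial>dV) = 0"
proof -
  obtain I :: "'m set" and \<eta> :: "'m \<Rightarrow> 'm \<Rightarrow> real" and ch K where P: "finite I" "\<And>i. ch i \<in> A" "\<And>i. compact (K i)" "\<And>i. K i \<subseteq> cdom (ch i)"
    "\<And>i y. y \<notin> K i \<Longrightarrow> \<eta> i y = 0" "\<And>i. C1_fun (\<eta> i)" "\<And>y. (\<Sum>i\<in>I. \<eta> i y) = 1"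
    by (rule partition_of_unity) blast
  have C: "C1_fun (\<lambda>x. \<eta> i x * \<beta> x)" for i
    unfolding C1_fun_def by (intro ballI C1_on_mult C1_funD P \<beta>)
  have \<beta>_eq: "\<beta> = (\<lambda>x. \<Sum>i\<in>I. \<eta> i x * \<beta> x)" using P(7) by (simp add: fun_eq_iff flip: sum_distrib_right)
  have s: "slope \<beta> x = (\<Sum>i\<in>I. slope (\<lambda>x. \<eta> i x * \<beta> x) x)" for x
    by (subst \<beta>_eq) (rule slope_sum[OF C])
  have "slope \<beta> x - real CARD('n) * \<beta> x * \<phi> x
    = (\<Sum>i\<in>I. slope (\<lambda>x. \<eta> i x * \<beta> x) x - real CARD('n) * (\<eta> i x * \<beta> x) * \<phi> x)" for x
  proof -
    have "real CARD('n) * \<beta> x * \<phi> x = (\<Sum>i\<in>I. real CARD('n) * (\<eta> i x * \<beta> x) * \<phi> x)"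
      using fun_cong[OF \<beta>_eq, of x] by (simp flip: sum_distrib_left sum_distrib_right)
    then show ?thesis by (simp add: s sum_subtractf)
  qed
  then have "(\<integral>x. slope \<beta> x - real CARD('n) * \<beta> x * \<phi> x \<partial>dV)
    = (\<integral>x. (\<Sum>i\<in>I. slope (\<lambda>x. \<eta> i x * \<beta> x) x - real CARD('n) * (\<eta> i x * \<beta> x) * \<phi> x) \<partial>dV)" by simp
  also have "\<dots> = (\<Sum>i\<in>I. \<integral>x. slope (\<lambda>x. \<eta> i x * \<beta> x) x - real CARD('n) * (\<eta> i x * \<beta> x) * \<phi> x \<partial>dV)"
    by (intro Bochner_Integration.integral_sum integrable_continuous_dV continuous_intros continuous_slope
        C1_fun_continuous continuous_f C \<beta> P)
  also have "\<dots> = 0"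
  proof (intro sum.neutral ballI)
    fix i
    show "(\<integral>x. slope (\<lambda>x. \<eta> i x * \<beta> x) x - real CARD('n) * (\<eta> i x * \<beta> x) * \<phi> x \<partial>dV) = 0"
      by (rule integral_slope_in_chart[OF C P(2)[of i] P(3)[of i] P(4)]) (simp add: P(5))
  qed
  finally show ?thesis .
qed

abbreviation normal_sq :: "'m \<Rightarrow> real" where
  "normal_sq x \<equiv> (norm (normal_part A f p x))\<^sup>2"

lemma C1_fun_height: "C1_fun \<phi>"
  unfolding C1_fun_def
proof
  fix c assume "c \<in> A"
  from C1_on_inner[OF C1_local_rep[OF this] C1_on_const[of _ p]]
  show "C1_on (cimg c) (\<lambda>u. \<phi> (coord_inv c u))" by (simp add: local_rep_def)
qed

lemma abs_height_le_1: "\<bar>\<phi> x\<bar> \<le> 1"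
  using Cauchy_Schwarz_ineq2[of "f x" p] by (simp add: norm_eq_sqrt_inner)

lemma slope_height: "slope \<phi> x = 1 - (\<phi> x)\<^sup>2 - normal_sq x"
proof -
  obtain c where c: "c \<in> A" "x \<in> cdom c" using cover by blast
  have "slope \<phi> x = fderiv (\<lambda>u. local_rep c f u \<bullet> p) (coord c x) (height_gradient c (coord c x))"
    by (simp add: slope_chart[OF C1_fun_height c] local_rep_def)
  then show ?thesis
    by (simp add: height_gradient_slope[OF c(1) coord_in_cimg[OF c(2)]] coord_inv_coord c)
qed

lemma continuous_normal_sq: "continuous_on UNIV normal_sq"
proof -
  have "continuous_on UNIV (\<lambda>x. 1 - (\<phi> x)\<^sup>2 - slope \<phi> x)"
    by (intro continuous_intros continuous_slope C1_fun_height continuous_f)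
  then show ?thesis by (simp add: slope_height)
qed

lemma
  assumes \<psi>: "\<And>t. t \<in> {-1..1} \<Longrightarrow> (\<psi> has_real_derivative \<psi>' t) (at t)" and \<psi>': "continuous_on {-1..1} \<psi>'"
  shows C1_fun_comp_height: "C1_fun (\<lambda>x. \<psi> (\<phi> x))"
    and slope_comp_height: "slope (\<lambda>x. \<psi> (\<phi> x)) x = \<psi>' (\<phi> x) * (1 - (\<phi> x)\<^sup>2 - normal_sq x)"
proof -
  have range: "\<phi> y \<in> {-1..1}" for y using abs_height_le_1[of y] by (auto simp: abs_le_iff)
  show C: "C1_fun (\<lambda>x. \<psi> (\<phi> x))"
    unfolding C1_fun_def
  proof
    fix c assume "c \<in> A"
    from C1_on_real_comp[OF C1_funD[OF C1_fun_height this] _ \<psi> \<psi>'] range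
    show "C1_on (cimg c) (\<lambda>u. \<psi> (\<phi> (coord_inv c u)))" by blast
  qed
  obtain c where c: "c \<in> A" "x \<in> cdom c" using cover by blast
  have "((\<lambda>u. \<psi> (\<phi> (coord_inv c u))) has_derivative
    (\<lambda>v. \<psi>' (\<phi> (coord_inv c (coord c x))) * fderiv (\<lambda>u. \<phi> (coord_inv c u)) (coord c x) v)) (at (coord c x))"
    by (rule has_derivative_compose[OF C1_on_has_derivative[OF C1_funD[OF C1_fun_height c(1)] coord_in_cimg[OF c(2)]]
        \<psi>[unfolded has_field_derivative_def]]) (rule range)
  then have "slope (\<lambda>x. \<psi> (\<phi> x)) x = \<psi>' (\<phi> (coord_inv c (coord c x))) * slope \<phi> x"
    unfolding slope_chart[OF C c] slope_chart[OF C1_fun_height c] by (rule fun_cong[OF fderiv_eq])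
  then show "slope (\<lambda>x. \<psi> (\<phi> x)) x = \<psi>' (\<phi> x) * (1 - (\<phi> x)\<^sup>2 - normal_sq x)"
    by (simp only: coord_inv_coord[OF c] slope_height)
qed

lemma integral_height_identity:
  assumes "\<And>t. t \<in> {-1..1} \<Longrightarrow> (\<psi> has_real_derivative \<psi>' t) (at t)" "continuous_on {-1..1} \<psi>'"
  shows "(\<integral>x. \<psi>' (\<phi> x) * (1 - (\<phi> x)\<^sup>2 - normal_sq x) - real CARD('n) * \<psi> (\<phi> x) * \<phi> x \<partial>dV) = 0"
  using integral_slope[OF C1_fun_comp_height[of \<psi> \<psi>', OF assms]]
  by (simp only: slope_comp_height[of \<psi> \<psi>', OF assms])

end

section \<open>The regularised identity\<close>

lemma integral_affine_lborel:
  fixes g :: "'a::euclidean_space \<Rightarrow> real"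
  assumes [measurable]: "g \<in> borel_measurable borel" and "c > 0"
  shows "integral\<^sup>L lborel g = (\<integral>s. c ^ DIM('a) * g (t + c *\<^sub>R s) \<partial>lborel)"
proof -
  have [measurable]: "(\<lambda>s. t + c *\<^sub>R s) \<in> borel_measurable (borel :: 'a measure)" by measurable
  have "integral\<^sup>L lborel g
    = integral\<^sup>L (density (distr lborel borel (\<lambda>s. t + c *\<^sub>R s)) (\<lambda>_. ennreal (c ^ DIM('a)))) g"
    using lborel_affine[of c t] \<open>c > 0\<close> by (simp add: ennreal_power)
  also have "\<dots> = (\<integral>s. c ^ DIM('a) *\<^sub>R g s \<partial>distr lborel borel (\<lambda>s. t + c *\<^sub>R s))"
    by (rule integral_density) (use \<open>c > 0\<close> in auto)
  also have "\<dots> = (\<integral>s. c ^ DIM('a) * g (t + c *\<^sub>R s) \<partial>lborel)"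
    by (subst integral_distr) auto
  finally show ?thesis .
qed

text \<open>How the kernel transforms under a dilation by \<open>d\<close> with regularisation parameter
  \<open>d\<^sup>2\<close>; the factor \<open>d ^ n\<close> is the Jacobian of the dilation.\<close>

lemma powr_rescale:
  fixes d z :: real
  assumes d: "d > 0" and z: "z \<ge> 0"
  shows "d ^ n * (d\<^sup>2 / (d\<^sup>2 + z) powr (real n / 2 + 1)) = 1 / (1 + z / d\<^sup>2) powr (real n / 2 + 1)"
proof -
  have "d\<^sup>2 + z = d\<^sup>2 * (1 + z / d\<^sup>2)" using d by (simp add: field_simps)
  then have "(d\<^sup>2 + z) powr (real n / 2 + 1) = (d\<^sup>2) powr (real n / 2 + 1) * (1 + z / d\<^sup>2) powr (real n / 2 + 1)"
    using d z by (simp add: powr_mult)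
  also have "(d\<^sup>2) powr (real n / 2 + 1) = d ^ (n + 2)"
  proof -
    have "(d\<^sup>2) powr (real n / 2 + 1) = (d powr 2) powr (real n / 2 + 1)" using d by simp
    also have "\<dots> = d powr real (n + 2)" unfolding powr_powr by (simp add: algebra_simps)
    also have "\<dots> = d ^ (n + 2)" using d by (rule powr_realpow)
    finally show ?thesis .
  qed
  finally have "(d\<^sup>2 + z) powr (real n / 2 + 1) = d ^ (n + 2) * (1 + z / d\<^sup>2) powr (real n / 2 + 1)" .
  moreover have "1 + z / d\<^sup>2 > 0" using d z by (simp add: add_pos_nonneg)
  ultimately show ?thesis using d by (simp add: field_simps power_add power2_eq_square)
qed

text \<open>Subtracting the value at \<open>0\<close> gives the profile a double zero there, as its
  derivative carries a factor \<open>t\<close>.\<close>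

lemma regularised_profile_derivative:
  fixes e N :: real
  assumes e: "e > 0" and t: "t \<in> {-1..1}"
  shows "((\<lambda>t. if t > 0 then (1 + e - t\<^sup>2) powr (- N / 2) - (1 + e) powr (- N / 2) else 0) has_real_derivative
    (if t > 0 then N * t * (1 + e - t\<^sup>2) powr (- (N / 2 + 1)) else 0)) (at t)"
proof (rule has_real_derivative_positive_part[where g' = "\<lambda>t. N * t * (1 + e - t\<^sup>2) powr (- (N / 2 + 1))"])
  have "t\<^sup>2 \<le> 1" using t by (simp add: abs_square_le_1 abs_le_iff)
  then have pos: "1 + e - t\<^sup>2 > 0" using e by linarith
  have "((\<lambda>t. 1 + e - t\<^sup>2) has_real_derivative - (2 * t)) (at t)"
    by (auto intro!: derivative_eq_intros)
  from DERIV_powr[OF this pos DERIV_const[of "- N / 2"]]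
  have "((\<lambda>t. (1 + e - t\<^sup>2) powr (- N / 2)) has_real_derivative
    (1 + e - t\<^sup>2) powr (- N / 2) * (0 * ln (1 + e - t\<^sup>2) + - (2 * t) * (- N / 2) / (1 + e - t\<^sup>2))) (at t)" .
  moreover have "(1 + e - t\<^sup>2) powr (- N / 2) * (0 * ln (1 + e - t\<^sup>2) + - (2 * t) * (- N / 2) / (1 + e - t\<^sup>2))
    = N * t * (1 + e - t\<^sup>2) powr (- (N / 2 + 1))"
  proof -
    have "- (N / 2 + 1) = - N / 2 - 1" by simp
    then have "(1 + e - t\<^sup>2) powr (- (N / 2 + 1)) = (1 + e - t\<^sup>2) powr (- N / 2) / (1 + e - t\<^sup>2)"
      using pos powr_diff[of "1 + e - t\<^sup>2" "- N / 2" 1] by simp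
    then show ?thesis by simp
  qed
  ultimately show "((\<lambda>t. (1 + e - t\<^sup>2) powr (- N / 2) - (1 + e) powr (- N / 2)) has_real_derivative
    N * t * (1 + e - t\<^sup>2) powr (- (N / 2 + 1))) (at t)"
    using DERIV_diff[OF _ DERIV_const, of _ _ t UNIV "(1 + e) powr (- N / 2)"] by fastforce
qed simp_all

context minimal_sphere_immersion
begin

text \<open>The common factor of both integrands on the right-hand side of the regularised identity; the
  positive part of \<open>\<phi>\<close> accounts for the restriction to \<open>{\<phi> >
  0}\<close>.\<close>

definition kernel :: "real \<Rightarrow> 'm \<Rightarrow> real" where
  "kernel e x = max 0 (\<phi> x) / (1 + e - (\<phi> x)\<^sup>2) powr (real CARD('n) / 2 + 1)"

lemma height_sq_le_1: "(\<phi> x)\<^sup>2 \<le> 1"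
  using abs_height_le_1[of x] by (simp add: abs_square_le_1)

lemma kernel_nonneg: "kernel e x \<ge> 0"
  by (simp add: kernel_def)

lemma continuous_height: "continuous_on UNIV \<phi>"
  by (intro continuous_intros continuous_f)

lemma continuous_kernel:
  assumes "e > 0"
  shows "continuous_on UNIV (kernel e)"
proof -
  have "1 + e - (\<phi> x)\<^sup>2 \<noteq> 0" for x using height_sq_le_1[of x] assms by linarith
  then show ?thesis
    unfolding kernel_def[abs_def] by (intro continuous_intros continuous_height) auto
qed

lemma regularised_identity:
  assumes e: "e > 0"
  shows "(1 + e) powr (- real CARD('n) / 2) * (\<integral>x. max 0 (\<phi> x) \<partial>dV)
    = (\<integral>x. kernel e x * normal_sq x \<partial>dV) + (\<integral>x. kernel e x * e \<partial>dV)"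
proof -
  let ?N = "real CARD('n)"
  define c where "c = (1 + e) powr (- ?N / 2)"
  define \<psi> where "\<psi> t = (if t > 0 then (1 + e - t\<^sup>2) powr (- ?N / 2) - c else 0)" for t :: real
  define \<psi>' where "\<psi>' t = (if t > 0 then ?N * t * (1 + e - t\<^sup>2) powr (- (?N / 2 + 1)) else 0)" for t :: real
  have pos: "1 + e - t\<^sup>2 > 0" if "t\<^sup>2 \<le> 1" for t :: real using that e by linarith
  have der: "(\<psi> has_real_derivative \<psi>' t) (at t)" if "t \<in> {-1..1}" for t
    unfolding \<psi>_def \<psi>'_def c_def by (rule regularised_profile_derivative[OF e that])
  have "continuous_on {-1..1} (\<lambda>t. ?N * max 0 t * (1 + e - t\<^sup>2) powr (- (?N / 2 + 1)))"
    using pos by (intro continuous_intros) (fastforce simp: abs_square_le_1 abs_le_iff)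
  then have cont: "continuous_on {-1..1} \<psi>'"
    by (rule continuous_on_eq) (auto simp: \<psi>'_def max_def)
  have integrand: "\<psi>' (\<phi> x) * (1 - (\<phi> x)\<^sup>2 - normal_sq x) - ?N * \<psi> (\<phi> x) * \<phi> x
    = ?N * (c * max 0 (\<phi> x) - (kernel e x * normal_sq x + kernel e x * e))" for x
  proof (cases "\<phi> x > 0")
    case True
    define z where "z = 1 + e - (\<phi> x)\<^sup>2"
    have z: "z > 0" using pos[OF height_sq_le_1] by (simp add: z_def)
    have k: "kernel e x = \<phi> x * z powr (- (?N / 2 + 1))"
      using True unfolding kernel_def z_def[symmetric] powr_minus_divide by simp
    define P where "P = z powr (- (?N / 2 + 1))"
    have zP: "z powr (- ?N / 2) = z * P"
      unfolding P_def using z powr_add[of z 1 "- (?N / 2 + 1)"] by (simp add: field_simps)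
    have ze: "1 - (\<phi> x)\<^sup>2 = z - e" by (simp add: z_def)
    show ?thesis
      using True unfolding \<psi>_def \<psi>'_def k z_def[symmetric] zP ze P_def[symmetric] by (simp add: algebra_simps)
  next
    case False
    then show ?thesis by (simp add: \<psi>_def \<psi>'_def kernel_def)
  qed
  have "0 = (\<integral>x. ?N * (c * max 0 (\<phi> x) - (kernel e x * normal_sq x + kernel e x * e)) \<partial>dV)"
    using integral_height_identity[of \<psi> \<psi>', OF der cont] by (simp only: integrand)
  then have "0 = (\<integral>x. c * max 0 (\<phi> x) - (kernel e x * normal_sq x + kernel e x * e) \<partial>dV)" by simp
  also have "\<dots> = c * (\<integral>x. max 0 (\<phi> x) \<partial>dV)
    - ((\<integral>x. kernel e x * normal_sq x \<partial>dV) + (\<integral>x. kernel e x * e \<partial>dV))"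
  proof -
    have i: "integrable dV (\<lambda>x. max 0 (\<phi> x))" "integrable dV (\<lambda>x. kernel e x * normal_sq x)"
      "integrable dV (\<lambda>x. kernel e x * e)"
      by (intro integrable_continuous_dV continuous_intros continuous_height continuous_kernel e continuous_normal_sq)+
    show ?thesis using i by simp
  qed
  finally show ?thesis by (simp add: c_def)
qed

section \<open>Concentration at the fibre over \<open>p\<close>\<close>

lemma norm_f_minus_p: "(norm (f x - p))\<^sup>2 = 2 * (1 - \<phi> x)"
  by (simp add: power2_norm_eq_inner inner_diff_left inner_diff_right inner_commute)

text \<open>A closed coordinate ball around a point of the fibre on which the distance from
  \<open>p\<close> in the ambient space controls the distance in the chart. It contains no
  further point of the fibre, and it supplies the dominating function in the rescaling argument.\<close>

definition isolating_chart :: "'m \<Rightarrow> ('m, 'n) chart \<Rightarrow> real \<Rightarrow> real \<Rightarrow> bool" where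
  "isolating_chart x c r \<kappa> \<longleftrightarrow> f x = p \<and> c \<in> A \<and> x \<in> cdom c \<and> r > 0 \<and> \<kappa> > 0 \<and>
     cball (coord c x) r \<subseteq> cimg c \<and>
     (\<forall>u \<in> cball (coord c x) r. \<kappa> * norm (u - coord c x) \<le> norm (local_rep c f u - p))"

text \<open>An injective differential is bounded below, and the remainder of the first order expansion
  costs at most half of this bound.\<close>

lemma ex_isolating_chart:
  assumes fx: "f x = p"
  shows "\<exists>c r \<kappa>. isolating_chart x c r \<kappa>"
proof -
  obtain c where c: "c \<in> A" "x \<in> cdom c" using cover by blast
  let ?u0 = "coord c x" and ?F = "local_rep c f"
  note u0 = coord_in_cimg[OF c(2)]
  have F0: "?F ?u0 = p" by (simp add: local_rep_def coord_inv_coord c fx)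
  obtain B where B: "B > 0" "\<And>h. B * norm h \<le> norm (fderiv ?F ?u0 h)"
    using linear_inj_bounded_below_pos[OF linear_fderiv_local_rep[OF c(1) u0] inj_fderiv_local_rep[OF c(1) u0]] by blast
  have "(?F has_derivative fderiv ?F ?u0) (at ?u0)" by (rule C1_on_has_derivative[OF C1_local_rep[OF c(1)] u0])
  then obtain d where d: "d > 0"
    "\<And>u. norm (u - ?u0) < d \<Longrightarrow> norm (?F u - ?F ?u0 - fderiv ?F ?u0 (u - ?u0)) \<le> B / 2 * norm (u - ?u0)"
    using B(1) unfolding has_derivative_at_alt by (metis half_gt_zero)
  obtain r where r: "r > 0" "cball ?u0 r \<subseteq> cimg c"
    using open_contains_cball open_cimg[OF c(1)] u0 by blast
  have "isolating_chart x c (min r (d / 2)) (B / 2)"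
    unfolding isolating_chart_def
  proof (intro conjI ballI)
    show "cball ?u0 (min r (d / 2)) \<subseteq> cimg c" using r by auto
    fix u assume "u \<in> cball ?u0 (min r (d / 2))"
    then have "norm (u - ?u0) < d" using d(1) by (auto simp: dist_norm norm_minus_commute)
    from d(2)[OF this] have "norm (?F u - p - fderiv ?F ?u0 (u - ?u0)) \<le> B / 2 * norm (u - ?u0)" by (simp add: F0)
    moreover have "norm (fderiv ?F ?u0 (u - ?u0)) \<le> norm (?F u - p) + norm (?F u - p - fderiv ?F ?u0 (u - ?u0))"
      using norm_triangle_ineq4[of "?F u - p" "?F u - p - fderiv ?F ?u0 (u - ?u0)"] by simp
    ultimately show "B / 2 * norm (u - ?u0) \<le> norm (?F u - p)"
      using B(2)[of "u - ?u0"] by simp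
  qed (use c r d B fx in auto)
  then show ?thesis by blast
qed

text \<open>Rescale the isolating chart by \<open>d k\<close>. The immersion becomes its differential,
  \<open>(1 - \<phi>\<^sup>2) / (d k)\<^sup>2\<close> becomes the square of the pushed forward
  length, and the volume density converges to its value at the centre, so the limit is the
  integral of the ball kernel for the isometric factor of the differential.\<close>

lemma kernel_concentration:
  assumes iso: "isolating_chart x c r \<kappa>"
    and B: "open B" "x \<in> B" "B \<subseteq> coord_inv c ` ball (coord c x) r"
    and d: "\<And>k. d k > 0" "d \<longlonglongrightarrow> 0"
  shows "(\<lambda>k. \<integral>y. indicator B y * (kernel ((d k)\<^sup>2) y * (d k)\<^sup>2) \<partial>dV)
    \<longlonglongrightarrow> measure lborel (ball (0 :: real ^ 'n) 1)"
proof -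
  let ?N = "real CARD('n)" and ?u0 = "coord c x" and ?F = "local_rep c f" and ?J = "volume_density c"
  let ?L = "fderiv ?F ?u0"
  have fx: "f x = p" and c: "c \<in> A" "x \<in> cdom c" and r: "r > 0" and \<kappa>: "\<kappa> > 0"
    and ball: "cball ?u0 r \<subseteq> cimg c"
    and below: "\<And>u. u \<in> cball ?u0 r \<Longrightarrow> \<kappa> * norm (u - ?u0) \<le> norm (?F u - p)"
    using iso unfolding isolating_chart_def by blast+
  note u0 = coord_in_cimg[OF c(2)]
  have F0: "?F ?u0 = p" by (simp add: local_rep_def coord_inv_coord c fx)
  define v where "v k s = ?u0 + d k *\<^sub>R s" for k s
  define \<Phi> where "\<Phi> u = \<phi> (coord_inv c u)" for u
  define B' where "B' = coord c ` B"
  have Bc: "B \<subseteq> cdom c"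
  proof
    fix y assume "y \<in> B"
    then obtain u where "u \<in> ball ?u0 r" "y = coord_inv c u" using B(3) by blast
    then show "y \<in> cdom c" using ball coord_inv_in_cdom[OF c(1), of u] ball_subset_cball by blast
  qed
  have B'ball: "B' \<subseteq> ball ?u0 r"
    using B(3) ball by (auto simp: B'_def subset_iff coord_coord_inv[OF c(1)] image_iff)
  have B'img: "B' \<subseteq> cimg c" by (rule subset_trans[OF B'ball subset_trans[OF ball_subset_cball ball]])
  have B'_iff: "coord_inv c u \<in> B \<longleftrightarrow> u \<in> B'" if "u \<in> cimg c" for u
    using that coord_image_eq_vimage[OF c(1) Bc] by (auto simp: B'_def)
  have openB': "open B'" unfolding B'_def by (rule open_coord_image[OF c(1) B(1) Bc])
  have u0B': "?u0 \<in> B'" using B(2) by (simp add: B'_def)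
  define G where "G k s = indicator B' (v k s) *
    (?J (v k s) * (max 0 (\<Phi> (v k s)) / (1 + (1 - (\<Phi> (v k s))\<^sup>2) / (d k)\<^sup>2) powr (?N / 2 + 1)))" for k s
  define gt where "gt k u = indicator (cimg c) u *
    (?J u * (indicator B (coord_inv c u) * (kernel ((d k)\<^sup>2) (coord_inv c u) * (d k)\<^sup>2)))" for k u
  have mg: "(\<lambda>y. indicator B y * (kernel ((d k)\<^sup>2) y * (d k)\<^sup>2)) \<in> borel_measurable borel" for k
    using continuous_kernel[of "(d k)\<^sup>2"] d(1)[of k] B(1)
    by (intro borel_measurable_times borel_measurable_indicator borel_measurable_const
        borel_measurable_continuous_onI) auto
  have g0: "indicator B y * (kernel ((d k)\<^sup>2) y * (d k)\<^sup>2) = 0" if "y \<notin> cdom c" for y k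
    using that Bc by (auto simp: indicator_def)
  have "integrable dV (\<lambda>y. indicator B y * (kernel ((d k)\<^sup>2) y * (d k)\<^sup>2))" for k
  proof -
    have "integrable dV (\<lambda>y. kernel ((d k)\<^sup>2) y * (d k)\<^sup>2)"
      by (intro integrable_continuous_dV continuous_intros continuous_kernel) (use d(1)[of k] in simp)
    from integrable_mult_indicator[OF _ this, of B] show ?thesis using B(1) by simp
  qed
  then have int_gt: "integrable lborel (gt k)" for k
    unfolding gt_def[abs_def] using integrable_chart[OF c(1) mg g0] by blast
  then have [measurable]: "gt k \<in> borel_measurable borel" for k by (auto dest: borel_measurable_integrable)
  have v_meas [measurable]: "v k \<in> borel_measurable borel" for k unfolding v_def by measurable
  have G_eq: "d k ^ CARD('n) * gt k (v k s) = G k s" for k s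
  proof (cases "v k s \<in> B'")
    case True
    then have "v k s \<in> cimg c" using B'img by blast
    moreover have "d k ^ CARD('n) * ((d k)\<^sup>2 / (1 + (d k)\<^sup>2 - (\<Phi> (v k s))\<^sup>2) powr (?N / 2 + 1))
      = 1 / (1 + (1 - (\<Phi> (v k s))\<^sup>2) / (d k)\<^sup>2) powr (?N / 2 + 1)"
      using powr_rescale[OF d(1), of "1 - (\<Phi> (v k s))\<^sup>2" k "CARD('n)"] height_sq_le_1[of "coord_inv c (v k s)"]
      by (simp add: \<Phi>_def algebra_simps)
    moreover have "dn * (J * (m / P * d2)) = J * (m / Q)" if "dn * (d2 / P) = 1 / Q" for dn J m P d2 Q :: real
    proof -
      have "dn * (J * (m / P * d2)) = J * m * (dn * (d2 / P))" by simp
      then show ?thesis by (simp only: that) simp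
    qed
    ultimately show ?thesis
      using True B'_iff[of "v k s"] unfolding gt_def G_def kernel_def \<Phi>_def[symmetric] by simp
  next
    case False
    then show ?thesis using B'_iff[of "v k s"] by (auto simp: gt_def G_def indicator_def)
  qed
  have int_eq: "(\<integral>y. indicator B y * (kernel ((d k)\<^sup>2) y * (d k)\<^sup>2) \<partial>dV) = integral\<^sup>L lborel (G k)" for k
  proof -
    have "(\<integral>y. indicator B y * (kernel ((d k)\<^sup>2) y * (d k)\<^sup>2) \<partial>dV) = integral\<^sup>L lborel (gt k)"
      unfolding gt_def by (rule integral_chart[OF c(1) mg g0])
    also have "\<dots> = (\<integral>s. d k ^ DIM(real ^ 'n) * gt k (?u0 + d k *\<^sub>R s) \<partial>lborel)"
      by (rule integral_affine_lborel) (use d(1) in auto)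
    also have "\<dots> = integral\<^sup>L lborel (G k)"
      by (rule Bochner_Integration.integral_cong) (auto simp: G_eq[unfolded v_def] v_def[symmetric] G_eq)
    finally show ?thesis .
  qed
  have G_meas: "G k \<in> borel_measurable lborel" for k
  proof -
    have "(\<lambda>s. d k ^ CARD('n) * gt k (v k s)) \<in> borel_measurable lborel" by measurable
    then show ?thesis by (simp add: G_eq)
  qed
  obtain T :: "real ^ 'n \<Rightarrow> real ^ 'n" where T: "linear T" "inj T" "\<And>v w. T v \<bullet> T w = ?L v \<bullet> ?L w"
    using isometric_square_factor[OF linear_fderiv_local_rep[OF c(1) u0] inj_fderiv_local_rep[OF c(1) u0]] by blast
  have J0: "?J ?u0 = \<bar>det (matrix T)\<bar>"
    unfolding metric_matrix_eq_gram by (rule sqrt_det_gram_factor[of T ?L, OF T(3)])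
  define G0 where "G0 s = \<bar>det (matrix T)\<bar> / (1 + T s \<bullet> T s) powr (?N / 2 + 1)" for s
  have G0: "integrable lborel G0" "integral\<^sup>L lborel G0 = measure lborel (ball (0 :: real ^ 'n) 1)"
    unfolding G0_def[abs_def] by (rule integral_ball_kernel[OF T(1,2)])+
  \<comment> \<open>the dominating function\<close>
  have "compact (?J ` cball ?u0 r)"
    by (rule compact_continuous_image[OF continuous_on_subset[OF C1_on_continuous[OF C1_volume_density[OF c(1)]] ball]]) simp
  then have "bounded (?J ` cball ?u0 r)" by (rule compact_imp_bounded)
  then obtain C where C: "\<And>u. u \<in> cball ?u0 r \<Longrightarrow> \<bar>?J u\<bar> \<le> C"
    unfolding bounded_iff by (auto simp del: mem_cball)
  \<comment> \<open>\<open>1 - \<Phi>\<close> is half of the squared distance from \<open>p\<close>, whence the factor \<open>sqrt 2\<close>\<close>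
  define a where "a = \<kappa> / sqrt 2"
  have a: "a > 0" using \<kappa> by (simp add: a_def)
  define S where "S = ((*\<^sub>R) a :: real ^ 'n \<Rightarrow> real ^ 'n)"
  have S: "linear S" "inj S" using a by (auto simp: S_def inj_def linear_scale_self)
  define H where "H s = \<bar>det (matrix S)\<bar> / (1 + S s \<bullet> S s) powr (?N / 2 + 1)" for s
  have H: "integrable lborel H" unfolding H_def[abs_def] by (rule integral_ball_kernel(1)[OF S])
  have detS: "\<bar>det (matrix S)\<bar> > 0" using S by (simp add: det_nz_iff_inj)
  have \<Phi>_eq: "1 - \<Phi> u = (norm (?F u - p))\<^sup>2 / 2" for u
    using norm_f_minus_p[of "coord_inv c u"] by (simp add: \<Phi>_def local_rep_def)
  have dom: "norm (G k s) \<le> C / \<bar>det (matrix S)\<bar> * H s" for k s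
  proof (cases "v k s \<in> B' \<and> \<Phi> (v k s) > 0")
    case True
    then have vb: "v k s \<in> cball ?u0 r" and \<Phi>: "\<Phi> (v k s) > 0" using B'ball by auto
    have \<Phi>1: "\<Phi> (v k s) \<le> 1" using abs_height_le_1[of "coord_inv c (v k s)"] by (simp add: \<Phi>_def abs_le_iff)
    have "\<kappa> * (d k * norm s) \<le> norm (?F (v k s) - p)"
      using below[OF vb] d(1)[of k] by (simp add: v_def)
    then have "(\<kappa> * (d k * norm s))\<^sup>2 \<le> (norm (?F (v k s) - p))\<^sup>2"
      using \<kappa> d(1)[of k] by (intro power_mono) auto
    then have "(a * norm s)\<^sup>2 * (d k)\<^sup>2 \<le> 1 - \<Phi> (v k s)"
      by (simp add: \<Phi>_eq a_def power_mult_distrib power_divide field_simps)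
    also have "\<dots> \<le> 1 - (\<Phi> (v k s))\<^sup>2"
      using \<Phi> \<Phi>1 by (simp add: power2_eq_square mult_left_le_one_le)
    finally have "(a * norm s)\<^sup>2 \<le> (1 - (\<Phi> (v k s))\<^sup>2) / (d k)\<^sup>2"
      using d(1)[of k] by (simp add: pos_le_divide_eq)
    moreover have "S s \<bullet> S s = (a * norm s)\<^sup>2"
      unfolding S_def power_mult_distrib power2_norm_eq_inner by (simp add: power2_eq_square)
    ultimately have den: "1 + S s \<bullet> S s \<le> 1 + (1 - (\<Phi> (v k s))\<^sup>2) / (d k)\<^sup>2" by simp
    have "norm (G k s) = \<bar>?J (v k s)\<bar> * (\<Phi> (v k s) / (1 + (1 - (\<Phi> (v k s))\<^sup>2) / (d k)\<^sup>2) powr (?N / 2 + 1))"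
      using True by (simp add: G_def abs_mult)
    also have "\<dots> \<le> C * (1 / (1 + S s \<bullet> S s) powr (?N / 2 + 1))"
      using C[OF vb] \<Phi> \<Phi>1 den
      by (intro mult_mono frac_le powr_mono2) (auto simp: add_pos_nonneg add_nonneg_eq_0_iff intro: order_trans[OF abs_ge_zero])
    also have "\<dots> = C / \<bar>det (matrix S)\<bar> * H s" using detS by (simp add: H_def)
    finally show ?thesis .
  next
    case False
    then have "G k s = 0" by (auto simp: G_def indicator_def max_def)
    moreover have "C \<ge> 0" using C[of ?u0] r by (auto intro: order_trans[OF abs_ge_zero])
    ultimately show ?thesis by (simp add: H_def)
  qed
  \<comment> \<open>pointwise convergence\<close>
  have lim: "(\<lambda>k. G k s) \<longlonglongrightarrow> G0 s" for s
  proof -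
    have "(\<lambda>k. ?u0 + d k *\<^sub>R s) \<longlonglongrightarrow> ?u0 + 0 *\<^sub>R s" by (intro tendsto_intros d(2))
    then have v: "(\<lambda>k. v k s) \<longlonglongrightarrow> ?u0" by (simp add: v_def)
    have "isCont ?J ?u0" "isCont ?F ?u0"
      using C1_on_continuous[OF C1_volume_density[OF c(1)]] C1_on_continuous[OF C1_local_rep[OF c(1)]] u0 open_cimg[OF c(1)]
      by (auto simp: continuous_on_eq_continuous_at)
    then have Jlim: "(\<lambda>k. ?J (v k s)) \<longlonglongrightarrow> ?J ?u0" and Flim: "(\<lambda>k. ?F (v k s)) \<longlonglongrightarrow> p"
      using v isCont_tendsto_compose[of ?u0 ?J] isCont_tendsto_compose[of ?u0 ?F] F0 by auto
    have \<Phi>_F: "\<Phi> u = ?F u \<bullet> p" for u by (simp add: \<Phi>_def local_rep_def)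
    have "(\<lambda>k. ?F (v k s) \<bullet> p) \<longlonglongrightarrow> p \<bullet> p" by (intro tendsto_intros Flim)
    then have \<Phi>lim: "(\<lambda>k. \<Phi> (v k s)) \<longlonglongrightarrow> 1" by (simp add: \<Phi>_F)
    have "((\<lambda>t. ?F (?u0 + t *\<^sub>R s)) has_vector_derivative ?L s) (at 0)"
    proof -
      have 1: "((\<lambda>t. ?u0 + t *\<^sub>R s) has_derivative (\<lambda>h. h *\<^sub>R s)) (at 0)" by (auto intro!: derivative_eq_intros)
      have 2: "(?F has_derivative ?L) (at (?u0 + 0 *\<^sub>R s))"
        using C1_on_has_derivative[OF C1_local_rep[OF c(1)] u0] by simp
      from has_derivative_compose[OF 1 2] show ?thesis
        by (simp add: has_vector_derivative_def linear_cmul[OF linear_fderiv_local_rep[OF c(1) u0]])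
    qed
    then have "((\<lambda>t. norm (?F (?u0 + t *\<^sub>R s) - p - t *\<^sub>R ?L s) / norm t) \<longlongrightarrow> 0) (at 0)"
      by (simp add: has_vector_derivative_def has_derivative_at F0)
    then have "((\<lambda>t. norm ((?F (?u0 + t *\<^sub>R s) - p) /\<^sub>R t - ?L s)) \<longlongrightarrow> 0) (at 0)"
    proof (rule Lim_transform_eventually)
      have "norm (y - t *\<^sub>R z) / norm t = norm (y /\<^sub>R t - z)" if "t \<noteq> 0" for y z :: "real ^ 'k" and t :: real
      proof -
        have "y - t *\<^sub>R z = t *\<^sub>R (y /\<^sub>R t - z)" using that by (simp add: scaleR_diff_right)
        then have "norm (y - t *\<^sub>R z) = norm t * norm (y /\<^sub>R t - z)" by (simp only: norm_scaleR real_norm_def)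
        then show ?thesis using that by simp
      qed
      then show "eventually (\<lambda>t. norm (?F (?u0 + t *\<^sub>R s) - p - t *\<^sub>R ?L s) / norm t
        = norm ((?F (?u0 + t *\<^sub>R s) - p) /\<^sub>R t - ?L s)) (at 0)"
        by (auto simp: eventually_at_filter)
    qed
    then have "((\<lambda>t. (?F (?u0 + t *\<^sub>R s) - p) /\<^sub>R t) \<longlongrightarrow> ?L s) (at 0)"
      by (rule LIM_zero_cancel[OF tendsto_norm_zero_cancel])
    moreover have "filterlim d (at 0) sequentially"
      using d by (auto intro!: filterlim_atI always_eventually less_imp_neq[symmetric])
    ultimately have "(\<lambda>k. (?F (v k s) - p) /\<^sub>R d k) \<longlonglongrightarrow> ?L s"
      unfolding v_def by (rule filterlim_compose)
    from tendsto_power[OF tendsto_norm[OF this], of 2]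
    have quot: "(\<lambda>k. (norm (?F (v k s) - p))\<^sup>2 / (d k)\<^sup>2) \<longlonglongrightarrow> (norm (?L s))\<^sup>2"
      using d(1) by (simp add: power_mult_distrib power_inverse divide_inverse mult.commute abs_of_pos)
    have "(\<lambda>k. (norm (?F (v k s) - p))\<^sup>2 / (d k)\<^sup>2 * ((1 + \<Phi> (v k s)) / 2)) \<longlonglongrightarrow> (norm (?L s))\<^sup>2 * ((1 + 1) / 2)"
      by (intro tendsto_intros quot \<Phi>lim) simp
    moreover have "(norm (?F u - p))\<^sup>2 / (d k)\<^sup>2 * ((1 + \<Phi> u) / 2) = (1 - (\<Phi> u)\<^sup>2) / (d k)\<^sup>2" for u k
    proof -
      have sq: "(norm (?F u - p))\<^sup>2 = 2 * (1 - \<Phi> u)" by (simp add: \<Phi>_eq)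
      have "(1 - \<Phi> u) * (1 + \<Phi> u) = 1 - (\<Phi> u)\<^sup>2" by (simp add: power2_eq_square algebra_simps)
      moreover have "2 * a / D * (b / 2) = a * b / D" for a b D :: real by simp
      ultimately show ?thesis unfolding sq by (simp only:)
    qed
    ultimately have zlim: "(\<lambda>k. (1 - (\<Phi> (v k s))\<^sup>2) / (d k)\<^sup>2) \<longlonglongrightarrow> T s \<bullet> T s"
      by (simp add: T(3) power2_norm_eq_inner)
    have "eventually (\<lambda>k. v k s \<in> B') sequentially" using v openB' u0B' by (rule topological_tendstoD)
    then have ind: "(\<lambda>k. indicator B' (v k s) :: real) \<longlonglongrightarrow> 1"
      by (intro tendsto_eventually) (auto elim!: eventually_mono)
    have "(\<lambda>k. indicator B' (v k s) *
      (?J (v k s) * (max 0 (\<Phi> (v k s)) / (1 + (1 - (\<Phi> (v k s))\<^sup>2) / (d k)\<^sup>2) powr (?N / 2 + 1))))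
      \<longlonglongrightarrow> 1 * (?J ?u0 * (max 0 1 / (1 + T s \<bullet> T s) powr (?N / 2 + 1)))"
      by (intro tendsto_intros ind Jlim \<Phi>lim zlim) (auto simp: add_nonneg_eq_0_iff)
    then show ?thesis by (simp add: G_def G0_def J0)
  qed
  have "(\<lambda>k. integral\<^sup>L lborel (G k)) \<longlonglongrightarrow> integral\<^sup>L lborel G0"
    by (rule integral_dominated_convergence[OF _ G_meas integrable_mult_right[OF H] AE_I2[OF lim] AE_I2[OF dom]])
       (use G0(1) in auto)
  then show ?thesis by (simp add: int_eq G0(2))
qed

end

context minimal_sphere_immersion
begin

lemma height_eq_1_iff: "\<phi> x = 1 \<longleftrightarrow> f x = p"
proof
  assume "\<phi> x = 1"
  then have "(norm (f x - p))\<^sup>2 = 0" by (simp add: norm_f_minus_p)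
  then show "f x = p" by simp
qed auto

lemma fibre_isolated:
  assumes iso: "isolating_chart x c r \<kappa>" and y: "y \<in> coord_inv c ` cball (coord c x) r" "f y = p"
  shows "y = x"
proof -
  obtain u where u: "u \<in> cball (coord c x) r" "y = coord_inv c u" using y(1) by blast
  have "local_rep c f u = p" using y(2) u(2) by (simp add: local_rep_def)
  then have "\<kappa> * norm (u - coord c x) \<le> 0" using iso u(1) unfolding isolating_chart_def by fastforce
  then have "u = coord c x" using iso by (simp add: isolating_chart_def mult_le_0_iff)
  then show ?thesis using u(2) iso by (simp add: isolating_chart_def coord_inv_coord)
qed

lemma finite_fibre: "finite (f -` {p})"
proof -
  obtain c r \<kappa> where iso: "\<And>x. f x = p \<Longrightarrow> isolating_chart x (c x) (r x) (\<kappa> x)"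
    using ex_isolating_chart by metis
  note N = iso[unfolded isolating_chart_def]
  define W where "W x = coord_inv (c x) ` ball (coord (c x) x) (r x)" for x
  have W: "open (W x)" "x \<in> W x" if "f x = p" for x
  proof -
    have b: "ball (coord (c x) x) (r x) \<subseteq> cimg (c x)" using N[OF that] ball_subset_cball by blast
    show "open (W x)" unfolding W_def by (rule open_coord_inv_image) (use N[OF that] b in auto)
    show "x \<in> W x" unfolding W_def using N[OF that]
      by (intro image_eqI[of _ _ "coord (c x) x"]) (auto simp: coord_inv_coord)
  qed
  have "closed (f -` {p})" by (rule closed_vimage[OF closed_singleton continuous_f])
  then have "compact (f -` {p})" using compact_Int_closed[OF compact_M] by simp
  moreover have "f -` {p} \<subseteq> (\<Union>x\<in>f -` {p}. W x)" using W(2) by auto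
  ultimately obtain T where T: "T \<subseteq> f -` {p}" "finite T" "f -` {p} \<subseteq> (\<Union>x\<in>T. W x)"
    using compactE_image[of "f -` {p}" "f -` {p}" W] W(1) by (metis singletonD vimage_eq)
  have "f -` {p} \<subseteq> T"
  proof
    fix y assume y: "y \<in> f -` {p}"
    then obtain x where x: "x \<in> T" "y \<in> W x" using T(3) by blast
    then have fx: "f x = p" using T(1) by auto
    have "y \<in> coord_inv (c x) ` cball (coord (c x) x) (r x)"
      using x(2) unfolding W_def by (meson ball_subset_cball image_mono subsetD)
    then have "y = x" using fibre_isolated[OF iso[OF fx]] y by simp
    then show "y \<in> T" using x(1) by simp
  qed
  then show ?thesis using T(2) by (rule finite_subset)
qed

text \<open>Each point of the fibre has a neighbourhood that contributes the volume of the unit ball. Away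
  from these neighbourhoods \<open>\<phi>\<close> stays below some \<open>1 - \<eta>\<close>, so
  the kernel is bounded and the factor \<open>(d k)\<^sup>2\<close> forces the integral to
  \<open>0\<close>.\<close>

lemma total_concentration:
  assumes d: "\<And>k. d k > 0" "\<And>k. d k \<le> 1" "d \<longlonglongrightarrow> 0"
  shows "(\<lambda>k. \<integral>y. kernel ((d k)\<^sup>2) y * (d k)\<^sup>2 \<partial>dV)
    \<longlonglongrightarrow> real (card (f -` {p})) * measure lborel (ball (0 :: real ^ 'n) 1)"
proof -
  let ?a = "real CARD('n) / 2 + 1" and ?S = "f -` {p}" and ?\<beta> = "measure lborel (ball (0 :: real ^ 'n) 1)"
  interpret finite_measure dV by (rule finite_measure_dV)
  obtain c r \<kappa> where iso: "\<And>x. f x = p \<Longrightarrow> isolating_chart x (c x) (r x) (\<kappa> x)"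
    using ex_isolating_chart by metis
  note N = iso[unfolded isolating_chart_def]
  define W where "W x = coord_inv (c x) ` ball (coord (c x) x) (r x)" for x
  define K where "K x = coord_inv (c x) ` cball (coord (c x) x) (r x)" for x
  \<comment> \<open>removing the closed balls around the other points makes these neighbourhoods disjoint\<close>
  define B where "B x = W x - (\<Union>y\<in>?S - {x}. K y)" for x
  define R where "R = UNIV - (\<Union>x\<in>?S. B x)"
  have WK: "W x \<subseteq> K x" for x by (auto simp: W_def K_def)
  have clK: "closed (K x)" if "x \<in> ?S" for x
    unfolding K_def using N[of x] that continuous_on_subset[OF continuous_coord_inv]
    by (intro compact_imp_closed compact_continuous_image) auto
  have isolated: "y = x" if "x \<in> ?S" "y \<in> ?S" "y \<in> K x" for x y
    using fibre_isolated[OF iso[of x]] that unfolding K_def by simp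
  have B: "open (B x)" "x \<in> B x" "B x \<subseteq> W x" if x: "x \<in> ?S" for x
  proof -
    have b: "ball (coord (c x) x) (r x) \<subseteq> cimg (c x)" using N[of x] x ball_subset_cball by blast
    have "open (W x)" unfolding W_def by (rule open_coord_inv_image) (use N[of x] x b in auto)
    then show "open (B x)" unfolding B_def using finite_fibre clK by (intro open_Diff closed_UN) auto
    have "x \<in> W x" unfolding W_def using N[of x] x
      by (intro image_eqI[of _ _ "coord (c x) x"]) (auto simp: coord_inv_coord)
    then show "x \<in> B x" using isolated x by (auto simp: B_def)
    show "B x \<subseteq> W x" by (auto simp: B_def)
  qed
  have disj: "disjoint_family_on B ?S"
    unfolding disjoint_family_on_def
  proof (intro ballI impI)
    fix x y assume "x \<in> ?S" "y \<in> ?S" "x \<noteq> y"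
    then show "B x \<inter> B y = {}" using WK[of x] unfolding B_def by blast
  qed
  have R: "closed R" unfolding R_def using B by (intro closed_Diff open_UN) auto
  then have "compact R" using compact_Int_closed[OF compact_M] by simp
  obtain \<eta> where \<eta>: "\<eta> > 0" "\<And>y. y \<in> R \<Longrightarrow> \<phi> y \<le> 1 - \<eta>"
  proof (cases "R = {}")
    case False
    then obtain z where z: "z \<in> R" "\<And>y. y \<in> R \<Longrightarrow> \<phi> y \<le> \<phi> z"
      using continuous_attains_sup[OF \<open>compact R\<close>, of \<phi>] continuous_on_subset[OF continuous_height] by blast
    have "z \<notin> ?S" using z(1) B(2) by (auto simp: R_def)
    then have "\<phi> z \<noteq> 1" using height_eq_1_iff by auto
    then have "\<phi> z < 1" using abs_height_le_1[of z] by (simp add: abs_le_iff)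
    then show ?thesis using that[of "1 - \<phi> z"] z(2) by simp
  qed (use that[of 1] in simp)
  let ?k = "\<lambda>k y. kernel ((d k)\<^sup>2) y * (d k)\<^sup>2"
  have int: "integrable dV (?k k)" for k
    by (intro integrable_continuous_dV continuous_intros continuous_kernel) (use d(1)[of k] in simp)
  have intI: "integrable dV (\<lambda>y. indicator X y * ?k k y)" if "X \<in> sets borel" for X k
    using integrable_mult_indicator[OF _ int, of X] that by simp
  have far: "0 \<le> indicator R y * ?k k y" "indicator R y * ?k k y \<le> (d k)\<^sup>2 / \<eta> powr ?a" for y k
  proof -
    show "0 \<le> indicator R y * ?k k y" by (simp add: kernel_nonneg)
    show "indicator R y * ?k k y \<le> (d k)\<^sup>2 / \<eta> powr ?a"
    proof (cases "y \<in> R \<and> \<phi> y > 0")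
      case True
      have "(\<phi> y)\<^sup>2 \<le> \<phi> y" using True abs_height_le_1[of y] by (simp add: power2_eq_square abs_le_iff mult_left_le_one_le)
      then have den: "\<eta> \<le> 1 + (d k)\<^sup>2 - (\<phi> y)\<^sup>2" using \<eta>(2)[of y] True zero_le_power2[of "d k"] by linarith
      have "\<phi> y / (1 + (d k)\<^sup>2 - (\<phi> y)\<^sup>2) powr ?a \<le> 1 / \<eta> powr ?a"
        using True abs_height_le_1[of y] den \<eta>(1) by (intro frac_le powr_mono2) (auto simp: abs_le_iff)
      then have "\<phi> y / (1 + (d k)\<^sup>2 - (\<phi> y)\<^sup>2) powr ?a * (d k)\<^sup>2 \<le> 1 / \<eta> powr ?a * (d k)\<^sup>2"
        by (rule mult_right_mono) simp
      then show ?thesis using True by (simp add: kernel_def)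
    next
      case False
      then have zero: "indicator R y * ?k k y = 0" by (auto simp: kernel_def indicator_def max_def)
      show ?thesis unfolding zero by simp
    qed
  qed
  have "(\<lambda>k. \<integral>y. indicator R y * ?k k y \<partial>dV) \<longlonglongrightarrow> (\<integral>y. 0 \<partial>dV)"
  proof (rule integral_dominated_convergence[where w = "\<lambda>y. 1 / \<eta> powr ?a"])
    show "(\<lambda>y. indicator R y * ?k k y) \<in> borel_measurable dV" for k
      by (rule borel_measurable_integrable[OF intI]) (use R in simp)
    have "(\<lambda>k. (d k)\<^sup>2 / \<eta> powr ?a) \<longlonglongrightarrow> 0\<^sup>2 / \<eta> powr ?a" using \<eta>(1) by (intro tendsto_intros d(3)) auto
    then have "(\<lambda>k. (d k)\<^sup>2 / \<eta> powr ?a) \<longlonglongrightarrow> 0" by simp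
    then have "(\<lambda>k. indicator R y * ?k k y) \<longlonglongrightarrow> 0" for y
      by (rule tendsto_sandwich[OF _ _ tendsto_const, rotated 2]) (intro always_eventually allI far)+
    then show "AE y in dV. (\<lambda>k. indicator R y * ?k k y) \<longlonglongrightarrow> 0" by simp
    show "AE y in dV. norm (indicator R y * ?k k y) \<le> 1 / \<eta> powr ?a" for k
    proof (rule AE_I2)
      fix y
      have "(d k)\<^sup>2 \<le> 1" using d(1,2)[of k] by (simp add: power_le_one less_imp_le)
      then have "(d k)\<^sup>2 / \<eta> powr ?a \<le> 1 / \<eta> powr ?a" by (rule divide_right_mono) simp
      then show "norm (indicator R y * ?k k y) \<le> 1 / \<eta> powr ?a"
        using far[of y k] unfolding real_norm_def by linarith
    qed
  qed simp_all
  then have limR: "(\<lambda>k. \<integral>y. indicator R y * ?k k y \<partial>dV) \<longlonglongrightarrow> 0" by simp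
  have limB: "(\<lambda>k. \<integral>y. indicator (B x) y * ?k k y \<partial>dV) \<longlonglongrightarrow> ?\<beta>" if "x \<in> ?S" for x
  proof -
    have "isolating_chart x (c x) (r x) (\<kappa> x)" using that by (intro iso) simp
    from kernel_concentration[OF this B[OF that, unfolded W_def] d(1,3)] show ?thesis .
  qed
  have split: "integral\<^sup>L dV (?k k) = (\<Sum>x\<in>?S. \<integral>y. indicator (B x) y * ?k k y \<partial>dV)
      + (\<integral>y. indicator R y * ?k k y \<partial>dV)" for k
  proof -
    have "?k k y = (\<Sum>x\<in>?S. indicator (B x) y * ?k k y) + indicator R y * ?k k y" for y
    proof -
      have "(\<Sum>x\<in>?S. indicator (B x) y :: real) = indicator (\<Union>x\<in>?S. B x) y"
        by (rule indicator_UN_disjoint[OF finite_fibre disj, symmetric])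
      moreover have "indicator (\<Union>x\<in>?S. B x) y + indicator R y = (1 :: real)"
        by (auto simp: R_def indicator_def)
      ultimately have "(\<Sum>x\<in>?S. indicator (B x) y) + indicator R y = (1 :: real)" by simp
      then have "((\<Sum>x\<in>?S. indicator (B x) y) + indicator R y) * ?k k y = ?k k y" by simp
      then show ?thesis by (simp only: distrib_right sum_distrib_right)
    qed
    then have "integral\<^sup>L dV (?k k) = (\<integral>y. (\<Sum>x\<in>?S. indicator (B x) y * ?k k y) + indicator R y * ?k k y \<partial>dV)"
      by (rule Bochner_Integration.integral_cong[OF refl])
    also have "\<dots> = (\<integral>y. (\<Sum>x\<in>?S. indicator (B x) y * ?k k y) \<partial>dV) + (\<integral>y. indicator R y * ?k k y \<partial>dV)"
      by (intro Bochner_Integration.integral_add Bochner_Integration.integrable_sum intI) (use B R in auto)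
    also have "(\<integral>y. (\<Sum>x\<in>?S. indicator (B x) y * ?k k y) \<partial>dV) = (\<Sum>x\<in>?S. \<integral>y. indicator (B x) y * ?k k y \<partial>dV)"
      by (intro Bochner_Integration.integral_sum intI) (use B in auto)
    finally show ?thesis .
  qed
  have "(\<lambda>k. (\<Sum>x\<in>?S. \<integral>y. indicator (B x) y * ?k k y \<partial>dV) + (\<integral>y. indicator R y * ?k k y \<partial>dV))
    \<longlonglongrightarrow> (\<Sum>x\<in>?S. ?\<beta>) + 0"
    by (intro tendsto_add tendsto_sum limB limR)
  then have "(\<lambda>k. integral\<^sup>L dV (?k k)) \<longlonglongrightarrow> (\<Sum>x\<in>?S. ?\<beta>) + 0" by (simp only: split)
  then show ?thesis by simp
qed

section \<open>Passage to the limit\<close>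

text \<open>On the fibre \<open>p\<close> is the position vector, which is orthogonal to the normal space.
  Hence all regularised integrands vanish at the points where the denominator of the limit does.\<close>

lemma normal_part_at_fibre:
  assumes "f x = p"
  shows "normal_part A f p x = 0"
  unfolding normal_part_def
proof (rule orth_proj_eqI[OF subspace_sphere_normal_space])
  show "0 \<in> sphere_normal_space A f x" using subspace_sphere_normal_space by (rule subspace_0)
  show "p - 0 \<in> (sphere_normal_space A f x)\<^sup>\<bottom>"
    using assms by (auto simp: sphere_normal_space_def orthogonal_comp_def orthogonal_def inner_commute)
qed

text \<open>The integrand of the remainder \<open>\<R>\<^sub>p\<close>, extended by \<open>0\<close> to
  the whole manifold.\<close>

definition height_defect :: "'m \<Rightarrow> real" where
  "height_defect x = max 0 (\<phi> x) * normal_sq x / (1 - (\<phi> x)\<^sup>2) powr (real CARD('n) / 2 + 1)"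

text \<open>As \<open>e\<close> decreases to \<open>0\<close>, the functions \<open>kernel e *
  normal_sq\<close> increase to the defect, and by the regularised identity their integrals
  converge. Monotone convergence then gives integrability and the value of the integral
  together.\<close>

lemma
  shows integrable_height_defect: "integrable dV height_defect"
    and integral_height_defect: "integral\<^sup>L dV height_defect
      = (\<integral>x. max 0 (\<phi> x) \<partial>dV) - real (card (f -` {p})) * measure lborel (ball (0 :: real ^ 'n) 1)"
proof -
  let ?a = "real CARD('n) / 2 + 1" and ?I = "\<integral>x. max 0 (\<phi> x) \<partial>dV"
    and ?c = "real (card (f -` {p})) * measure lborel (ball (0 :: real ^ 'n) 1)"
  define d where "d k = inverse (real (Suc k))" for k
  have d: "d k > 0" "d k \<le> 1" for k by (simp_all add: d_def field_simps)
  have d0: "d \<longlonglongrightarrow> 0" unfolding d_def by (rule LIMSEQ_inverse_real_of_nat)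
  define e where "e k = (d k)\<^sup>2" for k
  have e: "e k > 0" for k using d(1)[of k] by (simp add: e_def)
  have e0: "e \<longlonglongrightarrow> 0" unfolding e_def using tendsto_power[OF d0, of 2] by simp
  have e_mono: "e l \<le> e k" if "k \<le> l" for k l
    unfolding e_def d_def using that by (intro power_mono) (auto simp: field_simps)
  define h where "h k x = kernel (e k) x * normal_sq x" for k x
  have int: "integrable dV (h k)" for k
    unfolding h_def by (intro integrable_continuous_dV continuous_intros continuous_kernel continuous_normal_sq e)
  have "mono (\<lambda>k. h k x)" for x
  proof (rule monoI)
    fix k l :: nat assume "k \<le> l"
    then have "1 + e l - (\<phi> x)\<^sup>2 \<le> 1 + e k - (\<phi> x)\<^sup>2" using e_mono by simp
    moreover have "0 < 1 + e l - (\<phi> x)\<^sup>2" using e[of l] height_sq_le_1[of x] by linarith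
    ultimately have "kernel (e k) x \<le> kernel (e l) x"
      unfolding kernel_def by (intro divide_left_mono powr_mono2 mult_pos_pos) auto
    then show "h k x \<le> h l x" unfolding h_def by (rule mult_right_mono) simp
  qed
  then have mono: "AE x in dV. mono (\<lambda>k. h k x)" by simp
  have lim: "(\<lambda>k. h k x) \<longlonglongrightarrow> height_defect x" for x
  proof (cases "\<phi> x = 1 \<or> \<phi> x \<le> 0")
    case True
    have "h k x = 0" for k
    proof (cases "\<phi> x = 1")
      case True
      then have "normal_part A f p x = 0" using height_eq_1_iff normal_part_at_fibre by blast
      then show ?thesis by (simp add: h_def)
    qed (use True in \<open>simp add: h_def kernel_def\<close>)
    moreover have "height_defect x = 0" using True by (auto simp: height_defect_def)
    ultimately show ?thesis by simp
  next
    case False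
    then have "\<phi> x < 1" "0 < \<phi> x" using abs_height_le_1[of x] by (auto simp: abs_le_iff)
    then have pos: "1 - (\<phi> x)\<^sup>2 > 0" by (simp add: power_less_one_iff abs_square_less_1)
    have "(\<lambda>k. max 0 (\<phi> x) / (1 + e k - (\<phi> x)\<^sup>2) powr ?a * normal_sq x)
      \<longlonglongrightarrow> max 0 (\<phi> x) / (1 + 0 - (\<phi> x)\<^sup>2) powr ?a * normal_sq x"
      using pos by (intro tendsto_intros e0) auto
    then show ?thesis by (simp add: h_def kernel_def height_defect_def)
  qed
  have "integral\<^sup>L dV (h k) = (1 + e k) powr (- real CARD('n) / 2) * ?I - (\<integral>x. kernel (e k) x * e k \<partial>dV)" for k
    using regularised_identity[OF e[of k]] by (simp add: h_def[abs_def])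
  moreover have "(\<lambda>k. (1 + e k) powr (- real CARD('n) / 2) * ?I - (\<integral>x. kernel (e k) x * e k \<partial>dV))
    \<longlonglongrightarrow> (1 + 0) powr (- real CARD('n) / 2) * ?I - ?c"
    using total_concentration[of d, OF d d0] by (intro tendsto_intros e0) (auto simp: e_def)
  ultimately have ilim: "(\<lambda>k. integral\<^sup>L dV (h k)) \<longlonglongrightarrow> ?I - ?c" by simp
  have meas: "height_defect \<in> borel_measurable dV"
    by (rule borel_measurable_LIMSEQ_real[OF lim borel_measurable_integrable[OF int]])
  show "integrable dV height_defect"
    by (rule integrable_monotone_convergence[OF int mono AE_I2[OF lim] ilim meas])
  show "integral\<^sup>L dV height_defect = ?I - ?c"
    by (rule integral_monotone_convergence[OF int mono AE_I2[OF lim] ilim meas])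
qed

end

theorem proposition2p4:
  fixes A :: "('m::{t2_space, second_countable_topology}, 'n::finite) chart set"
    and f :: "'m \<Rightarrow> real ^ 'k::finite"
    and q :: nat
    and p :: "real ^ 'k"
  assumes "CARD('n) \<ge> 2" and "q \<ge> 1" and "CARD('k) = CARD('n) + q + 1"
    and "smooth_atlas A" and "compact (UNIV :: 'm set)"
    and "smooth_immersion A f" and "range f \<subseteq> sphere 0 1"
    and "minimal_in_sphere A f"
    and "p \<in> range f"
  shows "let dV = volume_measure A f;
             \<phi> = (\<lambda>x. f x \<bullet> p);
             h = (\<lambda>x. \<phi> x * (norm (normal_part A f p x))\<^sup>2
                        / (1 - (\<phi> x)\<^sup>2) powr (real CARD('n) / 2 + 1));
             R = (LINT x:{x. \<phi> x > 0}|dV. h x)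
         in finite (f -` {p}) \<and>
            set_integrable dV {x. \<phi> x > 0} h \<and> R \<ge> 0 \<and>
            (LINT x:{x. \<phi> x \<ge> 0}|dV. \<phi> x)
              = real (card (f -` {p})) * measure lborel (ball (0 :: real ^ 'n) 1) + R"
proof -
  interpret minimal_sphere_immersion A f p
    by unfold_locales (use assms in auto)
  have defect: "indicator {x. \<phi> x > 0} x *\<^sub>R (\<phi> x * normal_sq x / (1 - (\<phi> x)\<^sup>2) powr (real CARD('n) / 2 + 1))
      = height_defect x" for x
    by (simp add: height_defect_def indicator_def)
  have height: "indicator {x. \<phi> x \<ge> 0} x *\<^sub>R \<phi> x = max 0 (\<phi> x)" for x
    by (simp add: indicator_def)
  have "0 \<le> height_defect x" for x by (simp add: height_defect_def)
  then have "0 \<le> integral\<^sup>L dV height_defect" by (rule Bochner_Integration.integral_nonneg)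
  then show ?thesis
    unfolding Let_def set_integrable_def set_lebesgue_integral_def defect height
    using finite_fibre integrable_height_defect integral_height_defect by simp
qed

end
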